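(* Let $\Omega,\Omega_1,\sigma,\rho,c,\Sigma,D_{\max}$ be as in the context, and suppose that $\sigma\in C^\infty(\overline\Omega)$, that $\partial\Omega$ is infinitely smooth, and that the boundary currents $I_1,I_2,I_3$ are $C^\infty$ functions on $\partial\Omega$ with $\int_{\partial\Omega}I_k\,dA=0$. Let $J^{(k)}=\sigma\nabla w_{I_k}$, $k=1,2,3$, be the corresponding currents. Suppose that $\sigma$ and $I_1,I_2,I_3$ are such that at each point $x\in\Omega$ two of the three vectors $J^{(1)}(x),J^{(2)}(x),J^{(3)}(x)$ are non-parallel (i.e. linearly independent; which two may depend on $x$). Let $B^{(j)}=|B|e_j$, $j=1,2,3$, where $|B|>0$ is fixed and $e_1,e_2,e_3$ is the canonical basis of $\mathbb{R}^3$. Then $\ln\sigma$ is uniquely determined in $\Omega$ by the values of the measuring functionals $$M_{I_k,B^{(j)}}(y,t),\qquad j,k\in\{1,2,3\},\quad y\in\Sigma,\quad t\in[0,D_{\max}/c].$$ That is, if $\sigma$ and $\tilde\sigma$ are two conductivities with the same $\Omega,\Omega_1,\rho,c,\Sigma,|B|,I_1,I_2,I_3$, each of which is a positive function in $C^\infty(\overline\Omega)$, bounded away from $0$, equal to $1$ in a neighbourhood of $\partial\Omega$, with the supports of $\sigma-1$ and $\tilde\sigma-1$ lying in $\Omega_1$, and each of which is such that at each point $x\in\Omega$ two of the three currents corresponding to that conductivity and to $I_1,I_2,I_3$ are non-parallel, and if their measuring functionals $M_{I_k,B^{(j)}}(y,t)$ coincide for all $j,k\in\{1,2,3\}$, $y\in\Sigma$,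 $t\in[0,D_{\max}/c]$, then $\ln\sigma=\ln\tilde\sigma$ in $\Omega$.
   Context: Setting. $\Omega\subset\mathbb{R}^3$ is a bounded open connected set with boundary $\partial\Omega$ and exterior unit normal $n$. The conductivity $\sigma$ is a positive smooth function on $\overline\Omega$, bounded away from $0$, with $\sigma=1$ in a neighbourhood of $\partial\Omega$. The support of $\sigma-1$ lies in a set $\Omega_1\subset\Omega$ whose distance to $\partial\Omega$ is positive. $\rho>0$ (density) and $c>0$ (speed of sound) are constants; $dA$ is the surface area element on $\partial\Omega$. Currents. For a function $I$ on $\partial\Omega$ with $\int_{\partial\Omega}I\,dA=0$, $w_I$ is the solution of $$\nabla\cdot(\sigma\nabla w_I)=0\ \text{ in }\Omega,\qquad \frac{\partial w_I}{\partial n}=I\ \text{ on }\partial\Omega,\qquad \int_\Omega w_I\,dx=0,$$ and $J_I=\sigma\nabla w_I$. Acoustic sources. $\Sigma$ is a closed piecewise smooth surface (for example a sphere or the surface of a cube) bounding a bounded region $R$ with $\Omega_1\subset R$. It is in one of the following positions: $\partial\Omega$ lies inside $\Sigma$ ($\overline\Omega\subset R$), or $\Sigma$ lies inside $\partial\Omega$ ($\overline R\subset\Omega$), or $\Sigma=\partial\Omega$ ($R=\Omega$). $D_{\max}$ is the maximal distance between points of $\overline\Omega$ and points of $\Sigma$. Measuring functionals. For a constant vector $B\in\mathbb{R}^3$ (magnetic induction), the measuring functional is the $I$-weighted boundary integral of the electric potential generated by a spherical acoustic front originating at $y$. It is given by $$M_{I,B}(y,t)=\frac1\rho\int_{\partial\Omega}\frac{\delta(|z-y|-ct)}{4\pi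 c\,|z-y|}\,B\cdot\big(J_I(z)\times n(z)\big)\,dA(z)+\frac1\rho\int_\Omega\frac{\delta(|x-y|-ct)}{4\pi c\,|x-y|}\,B\cdot(\nabla\times J_I)(x)\,dx ,$$ where $\delta$ is the one-dimensional Dirac delta. For fixed $y$ this is understood as a distribution (finite signed measure) in $t\ge0$: pairing with a test function $\chi(t)$ replaces $\delta(|x-y|-ct)$ by $\frac1c\chi(|x-y|/c)$ under the integral. Equality of the data on $[0,D_{\max}/c]$ means equality of these measures for every $y\in\Sigma$. *)

theory Defs
  imports "HOL-Analysis.Analysis"
begin

section \<open>Smooth functions\<close>

primrec Ck_on :: "nat \<Rightarrow> ('a::euclidean_space \<Rightarrow> 'b::real_normed_vector) \<Rightarrow> 'a set \<Rightarrow> bool" where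
  "Ck_on 0 f U \<longleftrightarrow> continuous_on U f"
| "Ck_on (Suc k) f U \<longleftrightarrow>
     (\<forall>x\<in>U. f differentiable (at x)) \<and> (\<forall>v. Ck_on k (\<lambda>x. frechet_derivative f (at x) v) U)"

definition smooth_on :: "('a::euclidean_space \<Rightarrow> 'b::real_normed_vector) \<Rightarrow> 'a set \<Rightarrow> bool" where
  "smooth_on f U \<longleftrightarrow> (\<forall>k. Ck_on k f U)"

text \<open>\<open>Ck_on\<close> and \<open>smooth_on\<close> are meant for open sets. On a closed set (the closure of a smooth
  domain, its boundary, a compact interval), smooth means: restriction of a smooth function
  defined on an open neighbourhood.\<close>

definition smooth_on_closed :: "('a::euclidean_space \<Rightarrow> 'b::real_normed_vector) \<Rightarrow> 'a set \<Rightarrow> bool" where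
  "smooth_on_closed f S \<longleftrightarrow>
     (\<exists>U g. open U \<and> S \<subseteq> U \<and> smooth_on g U \<and> (\<forall>x\<in>S. f x = g x))"


section \<open>Vector calculus in three dimensions\<close>

definition pderivative :: "3 \<Rightarrow> (real^3 \<Rightarrow> real) \<Rightarrow> real^3 \<Rightarrow> real" where
  "pderivative i f x = frechet_derivative f (at x) (axis i 1)"

definition grad :: "(real^3 \<Rightarrow> real) \<Rightarrow> real^3 \<Rightarrow> real^3" where
  "grad f x = (\<chi> i. pderivative i f x)"

definition divg :: "(real^3 \<Rightarrow> real^3) \<Rightarrow> real^3 \<Rightarrow> real" where
  "divg F x = (\<Sum>i\<in>UNIV. pderivative i (\<lambda>y. F y $ i) x)"

definition curl :: "(real^3 \<Rightarrow> real^3) \<Rightarrow> real^3 \<Rightarrow> real^3" where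
  "curl F x = vector
     [pderivative 2 (\<lambda>y. F y $ 3) x - pderivative 3 (\<lambda>y. F y $ 2) x,
      pderivative 3 (\<lambda>y. F y $ 1) x - pderivative 1 (\<lambda>y. F y $ 3) x,
      pderivative 1 (\<lambda>y. F y $ 2) x - pderivative 2 (\<lambda>y. F y $ 1) x]"

text \<open>The gradient of a function on \<open>\<Omega>\<close>, with its boundary values (limits from inside).\<close>

definition closure_grad :: "(real^3) set \<Rightarrow> (real^3 \<Rightarrow> real) \<Rightarrow> real^3 \<Rightarrow> real^3" where
  "closure_grad \<Omega> w z = (if z \<in> \<Omega> then grad w z else Lim (at z within \<Omega>) (grad w))"


section \<open>Smooth boundaries, exterior normal, surface area\<close>

definition boundary_chart ::
  "(real^3) set \<Rightarrow> real^3 \<Rightarrow> (real^3) set \<Rightarrow> (real^3 \<Rightarrow> real) \<Rightarrow> bool" where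
  "boundary_chart \<Omega> p U g \<longleftrightarrow>
     open U \<and> p \<in> U \<and> smooth_on g U \<and> (\<forall>x\<in>U. grad g x \<noteq> 0) \<and> \<Omega> \<inter> U = {x\<in>U. g x < 0}"

definition smooth_boundary :: "(real^3) set \<Rightarrow> bool" where
  "smooth_boundary \<Omega> \<longleftrightarrow> (\<forall>p\<in>frontier \<Omega>. \<exists>U g. boundary_chart \<Omega> p U g)"

text \<open>Two charts at the same boundary point have positively parallel gradients there, so the
  description is unique.\<close>

definition ext_normal :: "(real^3) set \<Rightarrow> real^3 \<Rightarrow> real^3" where
  "ext_normal \<Omega> z =
     (THE \<nu>. \<exists>U g. boundary_chart \<Omega> z U g \<and> \<nu> = grad g z /\<^sub>R norm (grad g z))"

text \<open>Surface area in \<open>real^3\<close> is two-dimensional Hausdorff measure. The factor \<open>pi / 4\<close> makes it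
  agree with the usual area of smooth surfaces.\<close>

definition area_premeasure :: "real \<Rightarrow> (real^3) set \<Rightarrow> ennreal" where
  "area_premeasure \<delta> A =
     (INF C \<in> {C :: nat \<Rightarrow> (real^3) set.
                 A \<subseteq> (\<Union>i. C i) \<and> (\<forall>i. bounded (C i) \<and> diameter (C i) \<le> \<delta>)}.
        \<Sum>i. ennreal (pi / 4 * (diameter (C i))\<^sup>2))"

definition area_outer :: "(real^3) set \<Rightarrow> ennreal" where
  "area_outer A = (SUP \<delta>\<in>{0<..}. area_premeasure \<delta> A)"

definition area_measure :: "(real^3) measure" where
  "area_measure = measure_of UNIV (sets borel) area_outer"


section \<open>Conductivities and currents\<close>

definition conductivity :: "(real^3) set \<Rightarrow> (real^3) set \<Rightarrow> (real^3 \<Rightarrow> real) \<Rightarrow> bool" where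
  "conductivity \<Omega> \<Omega>1 \<sigma> \<longleftrightarrow>
     smooth_on_closed \<sigma> (closure \<Omega>) \<and>
     (\<exists>m>0. \<forall>x\<in>closure \<Omega>. m \<le> \<sigma> x) \<and>
     (\<exists>U. open U \<and> frontier \<Omega> \<subseteq> U \<and> (\<forall>x\<in>U \<inter> closure \<Omega>. \<sigma> x = 1)) \<and>
     closure {x\<in>closure \<Omega>. \<sigma> x \<noteq> 1} \<subseteq> \<Omega>1"

definition boundary_current :: "(real^3) set \<Rightarrow> (real^3 \<Rightarrow> real) \<Rightarrow> bool" where
  "boundary_current \<Omega> I \<longleftrightarrow>
     smooth_on_closed I (frontier \<Omega>) \<and> (LINT z:frontier \<Omega>|area_measure. I z) = 0"

text \<open>Classical solutions of the Neumann problem: twice continuously differentiable inside, with a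
  gradient that is continuous up to the boundary.\<close>

definition neumann_solution ::
  "(real^3) set \<Rightarrow> (real^3 \<Rightarrow> real) \<Rightarrow> (real^3 \<Rightarrow> real) \<Rightarrow> (real^3 \<Rightarrow> real) \<Rightarrow> bool" where
  "neumann_solution \<Omega> \<sigma> I w \<longleftrightarrow>
     Ck_on 2 w \<Omega> \<and> continuous_on (closure \<Omega>) (closure_grad \<Omega> w) \<and>
     (\<forall>x\<in>\<Omega>. divg (\<lambda>y. \<sigma> y *\<^sub>R grad w y) x = 0) \<and>
     (\<forall>z\<in>frontier \<Omega>. closure_grad \<Omega> w z \<bullet> ext_normal \<Omega> z = I z) \<and>
     set_integrable lborel \<Omega> w \<and> (LINT x:\<Omega>|lborel. w x) = 0"

definition current :: "(real^3) set \<Rightarrow> (real^3 \<Rightarrow> real) \<Rightarrow> (real^3 \<Rightarrow> real) \<Rightarrow> real^3 \<Rightarrow> real^3" where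
  "current \<Omega> \<sigma> w z = \<sigma> z *\<^sub>R closure_grad \<Omega> w z"

definition two_non_parallel :: "('k \<Rightarrow> real^3) \<Rightarrow> bool" where
  "two_non_parallel v \<longleftrightarrow> (\<exists>k l. v k \<noteq> v l \<and> independent {v k, v l})"


section \<open>Acoustic source surfaces\<close>

definition smooth_surface :: "(real^3) set \<Rightarrow> bool" where
  "smooth_surface S \<longleftrightarrow>
     (\<forall>p\<in>S. \<exists>U g. open U \<and> p \<in> U \<and> smooth_on g U \<and> (\<forall>x\<in>U. grad g x \<noteq> 0) \<and>
                   S \<inter> U = {x\<in>U. g x = 0})"

text \<open>A compact topological surface without boundary that consists of finitely many disjoint
  smooth faces, together with edges and vertices covered by finitely many smooth arcs. Faces are
  relatively open and need not be connected; constant arcs serve as isolated vertices. A smooth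
  closed surface is the case of a single face and no arcs.\<close>

definition closed_piecewise_smooth_surface :: "(real^3) set \<Rightarrow> bool" where
  "closed_piecewise_smooth_surface S \<longleftrightarrow>
     compact S \<and>
     (\<forall>p\<in>S. \<exists>U. open U \<and> p \<in> U \<and> (S \<inter> U) homeomorphic (UNIV :: (real^2) set)) \<and>
     (\<exists>(\<F> :: (real^3) set set) (\<G> :: (real \<Rightarrow> real^3) set).
        finite \<F> \<and> disjoint \<F> \<and> (\<forall>F\<in>\<F>. smooth_surface F) \<and>
        finite \<G> \<and> (\<forall>\<gamma>\<in>\<G>. smooth_on_closed \<gamma> {0..1}) \<and>
        S = closure (\<Union>\<F>) \<and> S - \<Union>\<F> \<subseteq> (\<Union>\<gamma>\<in>\<G>. \<gamma> ` {0..1}))"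

definition source_surface ::
  "(real^3) set \<Rightarrow> (real^3) set \<Rightarrow> (real^3) set \<Rightarrow> (real^3) set \<Rightarrow> bool" where
  "source_surface \<Omega> \<Omega>1 R S \<longleftrightarrow>
     open R \<and> connected R \<and> R \<noteq> {} \<and> bounded R \<and>
     S = frontier R \<and> closed_piecewise_smooth_surface S \<and>
     \<Omega>1 \<subseteq> R \<and> (closure \<Omega> \<subseteq> R \<or> closure R \<subseteq> \<Omega> \<or> R = \<Omega>)"

definition max_dist :: "(real^3) set \<Rightarrow> (real^3) set \<Rightarrow> real" where
  "max_dist A S = (SUP (x, y) \<in> A \<times> S. dist x y)"


section \<open>Measuring functionals\<close>

text \<open>The pairing of the finite signed measure \<open>M(y, \<cdot>)\<close> in the variable \<open>t \<ge> 0\<close> with a test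
  function \<open>\<phi>\<close>: the delta function \<open>\<delta>(|x - y| - c t)\<close> is replaced by \<open>\<phi>(|x - y| / c) / c\<close>.\<close>

definition measuring_functional ::
  "(real^3) set \<Rightarrow> real \<Rightarrow> real \<Rightarrow> (real^3 \<Rightarrow> real^3) \<Rightarrow> real^3 \<Rightarrow> real^3 \<Rightarrow> (real \<Rightarrow> real) \<Rightarrow> real" where
  "measuring_functional \<Omega> \<rho> c J B y \<phi> =
     1 / \<rho> * (LINT z:frontier \<Omega>|area_measure.
        (1 / c * \<phi> (dist z y / c)) / (4 * pi * c * dist z y) * (B \<bullet> cross3 (J z) (ext_normal \<Omega> z))) +
     1 / \<rho> * (LINT x:\<Omega>|lborel.
        (1 / c * \<phi> (dist x y / c)) / (4 * pi * c * dist x y) * (B \<bullet> curl J x))"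

text \<open>Equality of two finite signed measures on the compact interval \<open>[0, T]\<close>, given by their
  pairings: the pairings with all continuous functions on \<open>[0, T]\<close>, cut off outside, agree.\<close>

definition equal_on_interval ::
  "real \<Rightarrow> ((real \<Rightarrow> real) \<Rightarrow> real) \<Rightarrow> ((real \<Rightarrow> real) \<Rightarrow> real) \<Rightarrow> bool" where
  "equal_on_interval T M N \<longleftrightarrow>
     (\<forall>\<phi>. continuous_on {0..T} \<phi> \<longrightarrow>
        M (\<lambda>t. indicator {0..T} t * \<phi> t) = N (\<lambda>t. indicator {0..T} t * \<phi> t))"

end

theory Submission
  imports Defs "HOL-Computational_Algebra.Polynomial"
begin

text \<open>
Let \<open>D\<close> be the difference of two currents for the same boundary current. The data are the pairings
of radial functions centred on \<open>S = \<partial>R\<close> with the compactly supported measure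
\<open>\<mu> = (curl D) dx + (D \<times> n) dA\<close>. Its even moments
\<open>p\<^sub>m(y) = \<integral> |x - y|\<^bsup>2m\<^esup> d\<mu>(x)\<close> are polynomials that vanish on \<open>\<partial>R\<close>, and
\<open>\<Delta>p\<^sub>m\<close> is a multiple of \<open>p\<^bsub>m-1\<^esub>\<close>. By induction and the maximum
principle on \<open>R\<close> they all vanish identically, so by Weierstrass approximation \<open>\<mu>\<close> is
orthogonal to all radial bumps. Hence \<open>curl D = 0\<close> in \<open>\<Omega>\<close> and \<open>D \<times> n = 0\<close> on \<open>\<partial>\<Omega>\<close>.
As \<open>D\<close> is tangential as well, it vanishes on \<open>\<partial>\<Omega>\<close>, and since \<open>D\<close> is free of divergence and
rotation its components are harmonic, so \<open>D = 0\<close>. Finally \<open>curl J = \<nabla>(ln \<sigma>) \<times> J\<close>, and two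
non-parallel currents determine \<open>\<nabla>(ln \<sigma>)\<close>.
\<close>

section \<open>Area as a measure\<close>

text \<open>Why even moments: the acoustic kernel divides by the distance, so odd powers of
  \<open>t\<close> turn into even powers of the distance. These are polynomials in the centre
  \<open>y\<close>, which lets knowledge on the surface spread to all centres, wherever the surface
  lies relative to \<open>\<Omega>\<close>. They suffice because the bump
  \<open>max 0 (r^2 - dist^2)\<close> is a continuous function of the squared distance. Two
  obstacles shape the proof. Surface area is given by coverings, so it has to be shown that it is a
  Borel measure, finite on the smooth boundary and positive on every relatively open piece of it:
  finiteness makes \<mu> a continuous functional, positivity allows its surface density to be
  recovered. Further, \<open>D\<close> is only known to be C^1 inside and continuous up to the
  boundary. The maximum principle is therefore stated with derivatives along coordinate axes only,
  in a form that covers the moments as well as averages of the components of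
  \<open>D\<close>.\<close>

lemma area_premeasure_le:
  assumes "A \<subseteq> (\<Union>i. C i)" "\<And>i. bounded (C i)" "\<And>i. diameter (C i) \<le> \<delta>"
  shows "area_premeasure \<delta> A \<le> (\<Sum>i. ennreal (pi / 4 * (diameter (C i))\<^sup>2))"
  unfolding area_premeasure_def by (rule INF_lower) (use assms in auto)

lemma area_premeasure_mono: "A \<subseteq> B \<Longrightarrow> area_premeasure \<delta> A \<le> area_premeasure \<delta> B"
  unfolding area_premeasure_def by (rule INF_superset_mono) auto

lemma area_premeasure_le_area_outer: "\<delta> > 0 \<Longrightarrow> area_premeasure \<delta> A \<le> area_outer A"
  unfolding area_outer_def by (rule SUP_upper) auto

lemma area_premeasure_antimono: "\<delta> \<le> \<epsilon> \<Longrightarrow> area_premeasure \<epsilon> A \<le> area_premeasure \<delta> A"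
  unfolding area_premeasure_def by (rule INF_superset_mono) (auto intro: order_trans)

lemma area_outer_mono: "A \<subseteq> B \<Longrightarrow> area_outer A \<le> area_outer B"
  unfolding area_outer_def by (rule SUP_mono) (auto intro: area_premeasure_mono)

lemma area_outer_subsingleton: assumes "A \<subseteq> {x}" shows "area_outer A = 0"
proof -
  have "area_premeasure \<delta> A = 0" if "\<delta> > 0" for \<delta>
  proof -
    have "area_premeasure \<delta> A \<le> (\<Sum>i::nat. ennreal (pi / 4 * (diameter {x})\<^sup>2))"
      by (rule area_premeasure_le) (use assms that in \<open>auto simp: diameter_singleton\<close>)
    then show ?thesis by (simp add: diameter_singleton)
  qed
  then show ?thesis unfolding area_outer_def by (simp add: SUP_constant)
qed

lemma area_premeasure_cover:
  assumes "area_premeasure \<delta> A < u"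
  obtains C where "A \<subseteq> (\<Union>i::nat. C i)" "\<And>i. bounded (C i)" "\<And>i. diameter (C i) \<le> \<delta>"
    "(\<Sum>i. ennreal (pi / 4 * (diameter (C i))\<^sup>2)) < u"
  using assms unfolding area_premeasure_def INF_less_iff by auto

lemma area_premeasure_countably_subadditive:
  "area_premeasure \<delta> (\<Union>n. A n) \<le> (\<Sum>n. area_premeasure \<delta> (A n))"
proof (rule ennreal_le_epsilon)
  fix e :: real assume e: "0 < e" and fin: "(\<Sum>n. area_premeasure \<delta> (A n)) < top"
  have "area_premeasure \<delta> (A n) < area_premeasure \<delta> (A n) + ennreal (e * (1/2) ^ Suc n)" for n
    using e fin by (auto simp add: less_top dest!: ennreal_suminf_lessD)
  then have "\<exists>C. A n \<subseteq> (\<Union>i::nat. C i) \<and> (\<forall>i. bounded (C i) \<and> diameter (C i) \<le> \<delta>) \<and>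
    (\<Sum>i. ennreal (pi / 4 * (diameter (C i))\<^sup>2)) \<le> area_premeasure \<delta> (A n) + ennreal (e * (1/2) ^ Suc n)" for n
    by (rule area_premeasure_cover) (blast intro: less_imp_le)
  then obtain B where B: "\<And>n. A n \<subseteq> (\<Union>i::nat. B n i)" "\<And>n i. bounded (B n i)" "\<And>n i. diameter (B n i) \<le> \<delta>"
    "\<And>n. (\<Sum>i. ennreal (pi / 4 * (diameter (B n i))\<^sup>2)) \<le> area_premeasure \<delta> (A n) + ennreal (e * (1/2) ^ Suc n)"
    by metis
  define C where "C = case_prod B \<circ> prod_decode"
  have "(\<Union>n. A n) \<subseteq> (\<Union>i. C i)"
  proof
    fix x assume "x \<in> (\<Union>n. A n)"
    then obtain n i where "x \<in> B n i" using B(1) by blast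
    then have "x \<in> C (prod_encode (n, i))" by (simp add: C_def)
    then show "x \<in> (\<Union>i. C i)" by blast
  qed
  then have "area_premeasure \<delta> (\<Union>n. A n) \<le> (\<Sum>i. ennreal (pi / 4 * (diameter (C i))\<^sup>2))"
    by (rule area_premeasure_le) (auto simp: C_def B split: prod.split)
  also have "\<dots> = (\<Sum>i. (\<lambda>(n,i). ennreal (pi / 4 * (diameter (B n i))\<^sup>2)) (prod_decode i))"
    by (simp add: C_def split_def)
  also have "\<dots> = (\<Sum>n. \<Sum>i. ennreal (pi / 4 * (diameter (B n i))\<^sup>2))"
    by (rule suminf_ennreal_2dimen[unfolded comp_def]) simp
  also have "\<dots> \<le> (\<Sum>n. area_premeasure \<delta> (A n) + ennreal (e * (1/2) ^ Suc n))"
    by (intro suminf_le B(4)) auto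
  also have "\<dots> = (\<Sum>n. area_premeasure \<delta> (A n)) + (\<Sum>n. ennreal (e * (1/2) ^ Suc n))"
    by (subst suminf_add) auto
  also have "(\<Sum>n. ennreal (e * (1/2) ^ Suc n)) = ennreal e"
    using sums_mult[OF power_half_series, of e] e by (intro suminf_ennreal_eq) auto
  finally show "area_premeasure \<delta> (\<Union>n. A n) \<le> (\<Sum>n. area_premeasure \<delta> (A n)) + ennreal e" .
qed

lemma area_outer_countably_subadditive: "area_outer (\<Union>n. A n) \<le> (\<Sum>n. area_outer (A n))"
proof -
  have "area_premeasure \<delta> (\<Union>n. A n) \<le> (\<Sum>n. area_outer (A n))" if "\<delta> > 0" for \<delta>
    using that by (intro order_trans[OF area_premeasure_countably_subadditive] suminf_le area_premeasure_le_area_outer) auto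
  then show ?thesis unfolding area_outer_def[of "\<Union>n. A n"] by (intro SUP_least) auto
qed

lemma area_outer_space: "outer_measure_space (Pow UNIV) area_outer"
proof -
  have "area_outer {} = 0" by (rule area_outer_subsingleton) simp
  then show ?thesis
    unfolding outer_measure_space_def positive_def increasing_def countably_subadditive_def
    by (simp add: area_outer_mono area_outer_countably_subadditive)
qed

section \<open>Caratheodory's criterion for two-dimensional Hausdorff measure\<close>

lemma area_outer_Un_le: "area_outer (A \<union> B) \<le> area_outer A + area_outer B"
proof -
  have "area_outer (\<Union>n. binaryset A B n) \<le> (\<Sum>n. area_outer (binaryset A B n))"
    by (rule area_outer_countably_subadditive)
  also have "(\<Sum>n. area_outer (binaryset A B n)) = area_outer A + area_outer B"
    by (rule suminf_binaryset_eq) (simp add: area_outer_subsingleton)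
  finally show ?thesis by (simp add: UN_binaryset_eq)
qed

text \<open>A set of diameter below \<open>d\<close> cannot meet both \<open>A\<close> and
  \<open>B\<close>, so a fine cover of the union splits into separate covers of the two parts. This
  is the defining property of a metric outer measure.\<close>

lemma area_outer_separated:
  assumes d: "d > 0" and AB: "\<And>a b. a \<in> A \<Longrightarrow> b \<in> B \<Longrightarrow> d \<le> dist a b"
  shows "area_outer A + area_outer B \<le> area_outer (A \<union> B)"
proof -
  have key: "area_premeasure \<delta> A + area_premeasure \<delta> B \<le> area_outer (A \<union> B)" if \<delta>: "0 < \<delta>" "\<delta> < d" for \<delta>
  proof -
    have "area_premeasure \<delta> A + area_premeasure \<delta> B \<le> area_premeasure \<delta> (A \<union> B)"
      unfolding area_premeasure_def[of _ "A \<union> B"]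
    proof (rule INF_greatest, clarify)
      fix C :: "nat \<Rightarrow> (real^3) set"
      assume C: "A \<union> B \<subseteq> (\<Union>i. C i)" "\<forall>i. bounded (C i) \<and> diameter (C i) \<le> \<delta>"
      define CA where "CA i = (if C i \<inter> A \<noteq> {} then C i else {})" for i
      define CB where "CB i = (if C i \<inter> B \<noteq> {} then C i else {})" for i
      have excl: "C i \<inter> A = {} \<or> C i \<inter> B = {}" for i
      proof (rule ccontr)
        assume "\<not> ?thesis"
        then obtain a b where ab: "a \<in> C i" "a \<in> A" "b \<in> C i" "b \<in> B" by blast
        then have "dist a b \<le> diameter (C i)" using C(2) by (auto intro: diameter_bounded_bound)
        also have "\<dots> \<le> \<delta>" using C(2) by blast
        finally show False using AB[OF ab(2,4)] \<delta> by linarith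
      qed
      have "area_premeasure \<delta> A \<le> (\<Sum>i. ennreal (pi / 4 * (diameter (CA i))\<^sup>2))"
      proof (rule area_premeasure_le)
        show "A \<subseteq> (\<Union>i. CA i)"
        proof
          fix x assume x: "x \<in> A"
          then obtain i where "x \<in> C i" using C(1) by blast
          with x have "x \<in> CA i" by (auto simp: CA_def)
          then show "x \<in> (\<Union>i. CA i)" by blast
        qed
      qed (use C(2) \<delta> in \<open>auto simp: CA_def\<close>)
      moreover have "area_premeasure \<delta> B \<le> (\<Sum>i. ennreal (pi / 4 * (diameter (CB i))\<^sup>2))"
      proof (rule area_premeasure_le)
        show "B \<subseteq> (\<Union>i. CB i)"
        proof
          fix x assume x: "x \<in> B"
          then obtain i where "x \<in> C i" using C(1) by blast
          with x have "x \<in> CB i" by (auto simp: CB_def)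
          then show "x \<in> (\<Union>i. CB i)" by blast
        qed
      qed (use C(2) \<delta> in \<open>auto simp: CB_def\<close>)
      ultimately have "area_premeasure \<delta> A + area_premeasure \<delta> B \<le>
         (\<Sum>i. ennreal (pi / 4 * (diameter (CA i))\<^sup>2)) + (\<Sum>i. ennreal (pi / 4 * (diameter (CB i))\<^sup>2))"
        by (rule add_mono)
      also have "\<dots> = (\<Sum>i. ennreal (pi / 4 * (diameter (CA i))\<^sup>2) + ennreal (pi / 4 * (diameter (CB i))\<^sup>2))"
        by (rule suminf_add) auto
      also have "\<dots> \<le> (\<Sum>i. ennreal (pi / 4 * (diameter (C i))\<^sup>2))"
        using excl by (intro suminf_le) (auto simp: CA_def CB_def)
      finally show "area_premeasure \<delta> A + area_premeasure \<delta> B \<le> (\<Sum>i. ennreal (pi / 4 * (diameter (C i))\<^sup>2))" .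
    qed
    also have "\<dots> \<le> area_outer (A \<union> B)" using \<delta> by (intro area_premeasure_le_area_outer)
    finally show ?thesis .
  qed
  have "area_outer A + area_outer B = (SUP \<delta>\<in>{0<..}. area_premeasure \<delta> A + area_premeasure \<delta> B)"
    unfolding area_outer_def
  proof (rule SUP_add_directed_ennreal[symmetric])
    fix i j :: real assume "i \<in> {0<..}" "j \<in> {0<..}"
    then show "\<exists>k\<in>{0<..}. area_premeasure i A + area_premeasure j B \<le> area_premeasure k A + area_premeasure k B"
      by (intro bexI[of _ "min i j"] add_mono area_premeasure_antimono) auto
  qed
  also have "\<dots> \<le> area_outer (A \<union> B)"
  proof (rule SUP_least)
    fix \<delta> :: real assume "\<delta> \<in> {0<..}"
    \<comment> \<open>Shrinking the scale only increases the premeasure, so scales below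
      \<open>d\<close> determine both suprema.\<close>
    then have "area_premeasure \<delta> A + area_premeasure \<delta> B \<le>
      area_premeasure (min \<delta> (d/2)) A + area_premeasure (min \<delta> (d/2)) B"
      by (intro add_mono area_premeasure_antimono) auto
    also have "\<dots> \<le> area_outer (A \<union> B)" by (rule key) (use d \<open>\<delta> \<in> _\<close> in auto)
    finally show "area_premeasure \<delta> A + area_premeasure \<delta> B \<le> area_outer (A \<union> B)" .
  qed
  finally show ?thesis .
qed

text \<open>The part of \<open>A\<close> at distance at least \<open>1 / (n + 1)\<close> from
  \<open>F\<close> is separated from \<open>A \<inter> F\<close>, so the two areas add. What remains
  is a union of thin distance shells. Alternate shells are separated from each other, hence the
  areas of all shells have a finite sum and the tail is negligible.\<close>

lemma area_outer_Int_Diff_closed: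
  assumes F: "closed F" shows "area_outer (A \<inter> F) + area_outer (A - F) \<le> area_outer A"
proof (cases "F = {} \<or> area_outer A = top")
  case True
  then show ?thesis by (auto simp: area_outer_subsingleton)
next
  case False
  then have ne: "F \<noteq> {}" and fin: "area_outer A < top" by (auto simp: less_top)
  define d where "d x = infdist x F" for x
  have d_lip: "d x \<le> d y + dist x y" for x y
    unfolding d_def by (metis infdist_triangle)
  define R where "R k = {x\<in>A. 1 / real (k + 2) \<le> d x \<and> d x < 1 / real (k + 1)}" for k
  have partial: "(\<Sum>k<n. area_outer (R (2 * k + j))) \<le> area_outer (\<Union>k<n. R (2 * k + j))" for n j
  proof (induction n)
    case (Suc n)
    have "(\<Sum>k<Suc n. area_outer (R (2 * k + j))) \<le> area_outer (\<Union>k<n. R (2 * k + j)) + area_outer (R (2 * n + j))"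
      using Suc by (simp add: add_right_mono)
    also have "\<dots> \<le> area_outer ((\<Union>k<n. R (2 * k + j)) \<union> R (2 * n + j))"
    proof (cases "n = 0")
      case True then show ?thesis by (simp add: area_outer_subsingleton)
    next
      case False
      \<comment> \<open>The gap between the new shell and the earlier ones of the same parity: those
        keep distance at least \<open>1 / (2 * n + j)\<close> from \<open>F\<close>, while the new
        one has distance less than \<open>1 / (2 * n + j + 1)\<close>.\<close>
      define e where "e = 1 / real (2 * n + j) - 1 / real (2 * n + j + 1)"
      show ?thesis
      proof (rule area_outer_separated)
        have "1 / real (2 * n + j + 1) < 1 / real (2 * n + j)"
          using False by (intro divide_strict_left_mono) auto
        then show "e > 0" by (simp add: e_def)
        fix a b assume "a \<in> (\<Union>k<n. R (2 * k + j))" and b: "b \<in> R (2 * n + j)"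
        then obtain k where k: "k < n" "a \<in> R (2 * k + j)" by blast
        have "1 / real (2 * n + j) \<le> 1 / real (2 * k + j + 2)"
          using k False by (intro divide_left_mono) auto
        also have "\<dots> \<le> d a" using k by (simp add: R_def)
        finally have "1 / real (2 * n + j) \<le> d a" .
        moreover have "d b < 1 / real (2 * n + j + 1)" using b by (simp add: R_def)
        ultimately show "e \<le> dist a b" using d_lip[of a b] by (simp add: e_def)
      qed
    qed
    also have "(\<Union>k<n. R (2 * k + j)) \<union> R (2 * n + j) = (\<Union>k<Suc n. R (2 * k + j))"
      by (auto simp: less_Suc_eq)
    finally show ?case .
  qed (simp add: area_outer_subsingleton)
  have partial': "(\<Sum>k<n. area_outer (R (2 * k + j))) \<le> area_outer A" for n j
    by (rule order_trans[OF partial], rule area_outer_mono) (auto simp: R_def)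
  have "(\<Sum>k<2*n. area_outer (R k)) = (\<Sum>k<n. area_outer (R (2 * k + 0))) + (\<Sum>k<n. area_outer (R (2 * k + 1)))" for n
    by (induction n) (auto simp: algebra_simps)
  then have bound: "(\<Sum>k<2*n. area_outer (R k)) \<le> area_outer A + area_outer A" for n
    by (metis add_mono partial')
  have "(\<Sum>k. area_outer (R k)) \<le> area_outer A + area_outer A"
    unfolding suminf_eq_SUP
  proof (rule SUP_least)
    fix n
    have "(\<Sum>k<n. area_outer (R k)) \<le> (\<Sum>k<2*n. area_outer (R k))"
      by (rule sum_mono2) auto
    also note bound
    finally show "(\<Sum>k<n. area_outer (R k)) \<le> area_outer A + area_outer A" .
  qed
  also have "\<dots> < top" using fin by simp
  finally have sumfin: "(\<Sum>k. area_outer (R k)) < top" .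
  show ?thesis
  proof (rule ennreal_le_epsilon)
    fix e :: real assume e: "0 < e"
    have "(\<Sum>k. area_outer (R k)) < (\<Sum>k. area_outer (R k)) + ennreal e"
      using sumfin e by (simp add: ennreal_add_left_cancel_less[of _ 0, simplified])
    moreover have "(\<Sum>k. area_outer (R k)) + ennreal e = (SUP n. (\<Sum>k<n. area_outer (R k)) + ennreal e)"
      unfolding suminf_eq_SUP by (rule ennreal_SUP_add_left[symmetric]) simp
    ultimately obtain n where n: "(\<Sum>k. area_outer (R k)) < (\<Sum>k<n. area_outer (R k)) + ennreal e"
      by (auto simp: less_SUP_iff)
    have "(\<Sum>k. area_outer (R k)) = (\<Sum>k. area_outer (R (k + n))) + (\<Sum>k<n. area_outer (R k))"
      by (rule suminf_offset) (rule summableI)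
    with n have "(\<Sum>k<n. area_outer (R k)) + (\<Sum>k. area_outer (R (k + n))) < (\<Sum>k<n. area_outer (R k)) + ennreal e"
      by (simp only: add.commute)
    then have tail: "(\<Sum>k. area_outer (R (k + n))) \<le> ennreal e"
      by (simp only: ennreal_add_left_cancel_less less_imp_le)
    define An where "An = {x\<in>A. 1 / real (n + 1) \<le> d x}"
    have "A - F \<subseteq> An \<union> (\<Union>k. R (k + n))"
    proof
      fix x assume x: "x \<in> A - F"
      then have dx: "d x > 0"
        unfolding d_def using infdist_pos_not_in_closed[OF F ne] by auto
      show "x \<in> An \<union> (\<Union>k. R (k + n))"
      proof (cases "x \<in> An")
        case False
        with x have lt: "d x < 1 / real (n + 1)" by (auto simp: An_def)
        \<comment> \<open>The least such \<open>k\<close> is the index of the shell of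
          \<open>x\<close>: the bound fails for \<open>k - 1\<close>, which is the upper estimate.
          For \<open>k = n\<close> the upper estimate comes from \<open>x\<close> not lying in
          \<open>An\<close>.\<close>
        define k where "k = (LEAST k. 1 / real (k + 2) \<le> d x)"
        obtain m where "1 / real (Suc m) < d x" using dx by (rule nat_approx_posE)
        moreover have "1 / real (m + 2) \<le> 1 / real (Suc m)" by (intro divide_left_mono) auto
        ultimately have "1 / real (m + 2) \<le> d x" by linarith
        then have k: "1 / real (k + 2) \<le> d x" unfolding k_def by (rule LeastI)
        have kn: "n \<le> k"
        proof (rule ccontr)
          assume "\<not> n \<le> k"
          then have "1 / real (n + 1) \<le> 1 / real (k + 2)" by (intro divide_left_mono) auto
          with k lt show False by linarith
        qed
        have "d x < 1 / real (k + 1)"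
        proof (cases "k = n")
          case False
          with kn have "k - 1 < k" by auto
          then have "\<not> 1 / real (k - 1 + 2) \<le> d x" unfolding k_def by (rule not_less_Least)
          moreover have "k - 1 + 2 = k + 1" using kn False by auto
          ultimately show ?thesis by simp
        qed (use lt in simp)
        with k x have "x \<in> R ((k - n) + n)" using kn by (auto simp: R_def)
        then show ?thesis by blast
      qed simp
    qed
    then have "area_outer (A - F) \<le> area_outer (An \<union> (\<Union>k. R (k + n)))" by (rule area_outer_mono)
    also have "\<dots> \<le> area_outer An + area_outer (\<Union>k. R (k + n))" by (rule area_outer_Un_le)
    also have "\<dots> \<le> area_outer An + ennreal e"
      by (intro add_left_mono order_trans[OF area_outer_countably_subadditive tail])
    finally have 1: "area_outer (A - F) \<le> area_outer An + ennreal e" .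
    have "area_outer (A \<inter> F) + area_outer An \<le> area_outer ((A \<inter> F) \<union> An)"
    proof (rule area_outer_separated)
      show "0 < 1 / real (n + 1)" by simp
      fix a b assume "a \<in> A \<inter> F" "b \<in> An"
      then show "1 / real (n + 1) \<le> dist a b"
        using d_lip[of b a] by (simp add: An_def d_def dist_commute)
    qed
    also have "\<dots> \<le> area_outer A" by (rule area_outer_mono) (auto simp: An_def)
    finally have 2: "area_outer (A \<inter> F) + area_outer An \<le> area_outer A" .
    have "area_outer (A \<inter> F) + area_outer (A - F) \<le> (area_outer (A \<inter> F) + area_outer An) + ennreal e"
      using 1 by (simp add: add.assoc add_left_mono)
    also have "\<dots> \<le> area_outer A + ennreal e" using 2 by (rule add_right_mono)
    finally show "area_outer (A \<inter> F) + area_outer (A - F) \<le> area_outer A + ennreal e" .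
  qed
qed

text \<open>\<open>measure_of\<close> yields the zero measure when the given set function is not a
  measure on the generated sigma algebra, so this is what ties \<open>area_measure\<close> to
  \<open>area_outer\<close>. Closed sets are Caratheodory measurable and generate the Borel
  sets.\<close>

lemma measure_space_area_outer: "measure_space UNIV (sets borel) area_outer"
proof -
  interpret sigma_algebra UNIV "Pow UNIV :: (real^3) set set" by (rule sigma_algebra_Pow)
  define L where "L = lambda_system (UNIV :: (real^3) set) (Pow UNIV) area_outer"
  have L: "measure_space UNIV L area_outer"
    unfolding L_def by (rule caratheodory_lemma) (rule area_outer_space)
  have "closed F \<Longrightarrow> F \<in> L" for F
  proof -
    assume F: "closed F"
    have "area_outer (A \<inter> F) + area_outer (A - F) = area_outer A" for A
      by (rule antisym[OF area_outer_Int_Diff_closed[OF F]])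
        (metis Int_Diff_Un area_outer_Un_le)
    then show "F \<in> L" unfolding L_def lambda_system_eq by simp
  qed
  then have "sigma_sets UNIV (Collect closed) \<subseteq> L"
    using L by (intro sigma_algebra.sigma_sets_subset) (auto simp: measure_space_def)
  then have "sets borel \<subseteq> L" by (simp add: borel_eq_closed)
  with L show ?thesis by (intro measure_down[OF L] sets.sigma_algebra_axioms[of borel, simplified])
qed

lemma sets_area_measure [simp, measurable_cong]: "sets area_measure = sets borel"
  unfolding area_measure_def by (simp add: sets.sigma_sets_eq[of borel, simplified])

lemma space_area_measure [simp]: "space area_measure = UNIV"
  unfolding area_measure_def by simp

lemma emeasure_area_measure: "A \<in> sets borel \<Longrightarrow> emeasure area_measure A = area_outer A"
  unfolding area_measure_def
  using measure_space_area_outer by (intro emeasure_measure_of_sigma) (auto simp: measure_space_def)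

section \<open>Gradients and boundary charts\<close>

lemma linear_axis_expansion:
  fixes f :: "real^'n \<Rightarrow> 'b::real_vector"
  assumes "linear f" shows "f v = (\<Sum>i\<in>UNIV. v $ i *\<^sub>R f (axis i 1))"
proof -
  have "f v = f (\<Sum>i\<in>UNIV. v $ i *\<^sub>R axis i 1)"
    by (simp add: basis_expansion flip: scalar_mult_eq_scaleR)
  also have "\<dots> = (\<Sum>i\<in>UNIV. v $ i *\<^sub>R f (axis i 1))"
    using assms by (simp add: linear_sum linear_scale)
  finally show ?thesis .
qed

lemma frechet_derivative_eq_grad:
  assumes "f differentiable (at x)" shows "frechet_derivative f (at x) v = grad f x \<bullet> v"
  using linear_axis_expansion[OF linear_frechet_derivative[OF assms], of v]
  by (simp add: grad_def pderivative_def inner_vec_def mult.commute)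

lemma has_derivative_grad:
  assumes "f differentiable (at x)" shows "(f has_derivative (\<lambda>v. grad f x \<bullet> v)) (at x)"
proof -
  have "frechet_derivative f (at x) = (\<lambda>v. grad f x \<bullet> v)"
    by (rule ext) (rule frechet_derivative_eq_grad[OF assms])
  then show ?thesis using assms unfolding frechet_derivative_works by simp
qed

lemma has_derivative_grad_eq:
  assumes "(f has_derivative (\<lambda>v. a \<bullet> v)) (at x)" shows "grad f x = a"
proof -
  have "frechet_derivative f (at x) = (\<lambda>v. a \<bullet> v)"
    by (rule frechet_derivative_at[OF assms, symmetric])
  then show ?thesis by (simp add: grad_def pderivative_def vec_eq_iff inner_axis)
qed

lemma line_has_real_derivative:
  assumes "f differentiable (at (x + t *\<^sub>R v))"
  shows "((\<lambda>s. f (x + s *\<^sub>R v)) has_real_derivative grad f (x + t *\<^sub>R v) \<bullet> v) (at t)"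
proof -
  have "((\<lambda>s. x + s *\<^sub>R v) has_derivative (\<lambda>s. s *\<^sub>R v)) (at t)"
    by (auto intro!: derivative_eq_intros)
  from has_derivative_compose[OF this has_derivative_grad[OF assms]]
  show ?thesis by (simp add: has_field_derivative_def mult.commute[of _ "grad f (x + t *\<^sub>R v) \<bullet> v"])
qed

lemma grad_cong_open:
  assumes "open U" "x \<in> U" "\<And>y. y \<in> U \<Longrightarrow> f y = g y"
  shows "grad f x = grad g x"
proof -
  have "(f has_derivative D) (at x) \<longleftrightarrow> (g has_derivative D) (at x)" for D
    by (rule iffI; erule has_derivative_transform_within_open[OF _ assms(1,2)]; simp add: assms(3))
  then show ?thesis by (simp add: grad_def pderivative_def frechet_derivative_def)
qed

lemma Ck_on_SucD: "Ck_on (Suc k) f U \<Longrightarrow> x \<in> U \<Longrightarrow> f differentiable (at x)" by simp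

lemma Ck_on_continuous_on: "Ck_on k f U \<Longrightarrow> continuous_on U f"
  by (cases k) (auto intro!: continuous_at_imp_continuous_on differentiable_imp_continuous_within)

lemma Ck_on_Suc_grad:
  "Ck_on (Suc k) f U \<Longrightarrow> Ck_on k (\<lambda>x. frechet_derivative f (at x) v) U"
  by simp

lemma C1_on_continuous_grad:
  assumes "Ck_on (Suc k) f U" shows "continuous_on U (grad f)"
  unfolding grad_def pderivative_def
  by (intro continuous_on_vec_lambda Ck_on_continuous_on[OF Ck_on_Suc_grad[OF assms]])

lemma smooth_onD: "smooth_on f U \<Longrightarrow> Ck_on k f U"
  by (simp add: smooth_on_def)

lemmas smooth_on_differentiable = Ck_on_SucD[OF smooth_onD]
lemmas smooth_on_continuous_on = Ck_on_continuous_on[OF smooth_onD]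
lemmas smooth_on_continuous_grad = C1_on_continuous_grad[OF smooth_onD]

section \<open>Boundary charts and the exterior normal\<close>

lemma boundary_chart_iff: "boundary_chart \<Omega> p U g \<Longrightarrow> x \<in> U \<Longrightarrow> x \<in> \<Omega> \<longleftrightarrow> g x < 0"
  unfolding boundary_chart_def by blast

text \<open>A chart describes only \<open>\<Omega>\<close> itself. A frontier point is outside the
  open set, so \<open>g\<close> is not negative there; a positive value would persist on a
  neighbourhood containing no point of \<open>\<Omega>\<close>.\<close>

lemma boundary_chart_zero:
  assumes "open \<Omega>" "boundary_chart \<Omega> p U g" "z \<in> frontier \<Omega>" "z \<in> U"
  shows "g z = 0"
proof (rule antisym)
  note c = assms(2)[unfolded boundary_chart_def]
  have "z \<notin> \<Omega>" using assms by (auto simp: frontier_def interior_open)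
  then show "0 \<le> g z" using boundary_chart_iff[OF assms(2,4)] by simp
  show "g z \<le> 0"
  proof (rule ccontr)
    assume "\<not> g z \<le> 0"
    have "open (U \<inter> g -` {0<..})"
      using c by (intro continuous_open_preimage smooth_on_continuous_on) auto
    moreover have "z \<in> U \<inter> g -` {0<..}" using assms(4) \<open>\<not> g z \<le> 0\<close> by auto
    moreover have "z \<in> closure \<Omega>" using assms(3) by (simp add: frontier_def)
    ultimately obtain x where "x \<in> \<Omega>" "x \<in> U" "g x > 0"
      by (auto simp: closure_iff_nhds_not_empty)
    then show False using boundary_chart_iff[OF assms(2)] by fastforce
  qed
qed

lemma boundary_chart_transfer:
  "boundary_chart \<Omega> p U g \<Longrightarrow> z \<in> U \<Longrightarrow> boundary_chart \<Omega> z U g"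
  by (simp add: boundary_chart_def)

lemma boundary_chart_side:
  assumes "boundary_chart \<Omega> p U g" "g p = 0" "grad g p \<bullet> v < 0"
  shows "\<forall>\<^sub>F t in at_right 0. p + t *\<^sub>R v \<in> \<Omega>"
    and "\<forall>\<^sub>F t in at_right 0. p - t *\<^sub>R v \<in> U - \<Omega>"
proof -
  note c = assms(1)[unfolded boundary_chart_def]
  have d: "g differentiable (at p)" using c smooth_on_differentiable[of g U] by simp
  have inU: "\<forall>\<^sub>F t in at_right 0. p + t *\<^sub>R u \<in> U" for u
  proof -
    have "((\<lambda>t. p + t *\<^sub>R u) \<longlongrightarrow> p + 0 *\<^sub>R u) (at_right 0)" by (intro tendsto_intros)
    then show ?thesis using c by (auto intro: topological_tendstoD)
  qed
  have D: "((\<lambda>s. g (p + s *\<^sub>R u)) has_real_derivative grad g p \<bullet> u) (at 0)" for u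
    using line_has_real_derivative[of g p 0 u] d by simp
  have neg: "\<forall>\<^sub>F t in at_right 0. g (p + t *\<^sub>R v) < 0"
    using DERIV_neg_dec_right[OF D assms(3)] by (auto simp: eventually_at_right_field assms(2))
  have "grad g p \<bullet> (- v) > 0" using assms(3) by simp
  then have pos: "\<forall>\<^sub>F t in at_right 0. g (p + t *\<^sub>R (- v)) > 0"
    using DERIV_pos_inc_right[OF D, of "- v"] by (auto simp: eventually_at_right_field assms(2))
  show "\<forall>\<^sub>F t in at_right 0. p + t *\<^sub>R v \<in> \<Omega>"
    using neg inU[of v] by eventually_elim (simp add: boundary_chart_iff[OF assms(1)])
  show "\<forall>\<^sub>F t in at_right 0. p - t *\<^sub>R v \<in> U - \<Omega>"
    using pos inU[of "- v"] by eventually_elim (simp add: boundary_chart_iff[OF assms(1)])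
qed

text \<open>Uniqueness for the \<open>THE\<close> in \<open>ext_normal\<close>: if two charts gave
  different unit normals \<mu> and \<nu>, the direction \<open>\<nu> - \<mu>\<close> would lead into
  \<open>\<Omega>\<close> according to the first chart and out of it according to the
  second.\<close>

lemma ext_normal_boundary_chart:
  assumes "open \<Omega>" "z \<in> frontier \<Omega>" "boundary_chart \<Omega> z U g"
  shows "ext_normal \<Omega> z = grad g z /\<^sub>R norm (grad g z)"
  unfolding ext_normal_def
proof (rule the_equality)
  fix \<nu> assume "\<exists>V h. boundary_chart \<Omega> z V h \<and> \<nu> = grad h z /\<^sub>R norm (grad h z)"
  then obtain V h where h: "boundary_chart \<Omega> z V h" "\<nu> = grad h z /\<^sub>R norm (grad h z)" by blast
  define \<mu> where "\<mu> = grad g z /\<^sub>R norm (grad g z)"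
  have zU: "z \<in> U" "z \<in> V" and n0: "grad g z \<noteq> 0" "grad h z \<noteq> 0"
    using assms(3) h(1) by (auto simp: boundary_chart_def)
  then have unit: "norm \<mu> = 1" "norm \<nu> = 1" by (simp_all add: \<mu>_def h(2))
  have z0: "g z = 0" "h z = 0" using boundary_chart_zero[OF assms(1,3,2) zU(1)] boundary_chart_zero[OF assms(1) h(1) assms(2) zU(2)] by simp_all
  have "\<nu> = \<mu>"
  proof (rule ccontr)
    assume "\<nu> \<noteq> \<mu>"
    then have "0 < (\<nu> - \<mu>) \<bullet> (\<nu> - \<mu>)" by simp
    moreover have "\<nu> \<bullet> \<nu> = 1" "\<mu> \<bullet> \<mu> = 1" using unit by (simp_all add: dot_square_norm)
    ultimately have lt: "\<mu> \<bullet> \<nu> < 1" by (simp add: inner_diff inner_commute)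
    have "\<mu> \<bullet> (\<nu> - \<mu>) < 0" "\<nu> \<bullet> (\<mu> - \<nu>) < 0"
      using lt \<open>\<nu> \<bullet> \<nu> = 1\<close> \<open>\<mu> \<bullet> \<mu> = 1\<close> by (simp_all add: inner_diff inner_commute)
    moreover have "grad g z \<bullet> (\<nu> - \<mu>) = norm (grad g z) * (\<mu> \<bullet> (\<nu> - \<mu>))"
      unfolding inner_scaleR_left[symmetric] using n0 by (simp add: \<mu>_def)
    moreover have "grad h z \<bullet> (\<mu> - \<nu>) = norm (grad h z) * (\<nu> \<bullet> (\<mu> - \<nu>))"
      unfolding inner_scaleR_left[symmetric] using n0 by (simp add: h(2))
    ultimately have neg: "grad g z \<bullet> (\<nu> - \<mu>) < 0" "grad h z \<bullet> (\<mu> - \<nu>) < 0"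
      using n0 by (simp_all add: mult_pos_neg)
    have "\<forall>\<^sub>F t in at_right (0::real). False"
      using boundary_chart_side(1)[OF assms(3) z0(1) neg(1)] boundary_chart_side(2)[OF h(1) z0(2) neg(2)]
    proof eventually_elim
      case (elim t)
      have "z + t *\<^sub>R (\<nu> - \<mu>) = z - t *\<^sub>R (\<mu> - \<nu>)" by (simp add: algebra_simps)
      with elim show False by simp
    qed
    then show False by simp
  qed
  then show "\<nu> = grad g z /\<^sub>R norm (grad g z)" by (simp add: \<mu>_def)
qed (use assms in blast)

lemma norm_ext_normal:
  assumes "open \<Omega>" "smooth_boundary \<Omega>" "z \<in> frontier \<Omega>"
  shows "norm (ext_normal \<Omega> z) = 1"
proof -
  obtain U g where c: "boundary_chart \<Omega> z U g" using assms by (auto simp: smooth_boundary_def)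
  then have "grad g z \<noteq> 0" by (auto simp: boundary_chart_def)
  then show ?thesis by (simp add: ext_normal_boundary_chart[OF assms(1,3) c])
qed

lemma continuous_on_ext_normal:
  assumes "open \<Omega>" "smooth_boundary \<Omega>"
  shows "continuous_on (frontier \<Omega>) (ext_normal \<Omega>)"
  unfolding continuous_on_def
proof
  fix p assume p: "p \<in> frontier \<Omega>"
  then obtain U g where c: "boundary_chart \<Omega> p U g" using assms by (auto simp: smooth_boundary_def)
  have U: "open U" "p \<in> U" "smooth_on g U" "\<forall>x\<in>U. grad g x \<noteq> 0"
    using c by (simp_all add: boundary_chart_def)
  define N where "N z = grad g z /\<^sub>R norm (grad g z)" for z
  have "continuous_on U N"
    unfolding N_def using U by (auto intro!: continuous_intros smooth_on_continuous_grad)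
  then have "isCont N p" using U by (simp add: continuous_on_eq_continuous_at)
  then have N: "(N \<longlongrightarrow> N p) (at p within frontier \<Omega>)"
    using continuous_at_imp_continuous_at_within continuous_within by blast
  have eq: "ext_normal \<Omega> z = N z" if "z \<in> frontier \<Omega>" "z \<in> U" for z
    unfolding N_def by (rule ext_normal_boundary_chart[OF assms(1) that(1) boundary_chart_transfer[OF c that(2)]])
  have ev: "\<forall>\<^sub>F z in at p within frontier \<Omega>. ext_normal \<Omega> z = N z"
    unfolding eventually_at_topological using U(1,2) eq by (intro exI[of _ U]) simp
  show "(ext_normal \<Omega> \<longlongrightarrow> ext_normal \<Omega> p) (at p within frontier \<Omega>)"
    unfolding eq[OF p U(2)] using tendsto_cong[OF ev] N by blast
qed

text \<open>Avoiding the closure, and not just \<open>\<Omega>\<close>, provides a whole ball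
  outside \<open>\<Omega>\<close> around the point reached; the lower bound for the area depends on
  it.\<close>

lemma boundary_chart_side_closure:
  assumes "open \<Omega>" "boundary_chart \<Omega> p U g" "g p = 0" "grad g p \<bullet> v < 0"
  shows "\<forall>\<^sub>F t in at_right 0. p - t *\<^sub>R v \<notin> closure \<Omega>"
proof -
  have d: "g differentiable (at p)" and U: "open U" "p \<in> U"
    using assms(2) smooth_on_differentiable[of g U] by (simp_all add: boundary_chart_def)
  have "((\<lambda>t. p - t *\<^sub>R v) \<longlongrightarrow> p - 0 *\<^sub>R v) (at_right 0)" by (intro tendsto_intros)
  then have inU: "\<forall>\<^sub>F t in at_right 0. p - t *\<^sub>R v \<in> U" using U by (auto intro: topological_tendstoD)
  have "((\<lambda>s. g (p + s *\<^sub>R (- v))) has_real_derivative grad g p \<bullet> (- v)) (at 0)"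
    using line_has_real_derivative[of g p 0 "- v"] d by simp
  from DERIV_pos_inc_right[OF this] assms(4)
  have "\<forall>\<^sub>F t in at_right 0. g (p + t *\<^sub>R (- v)) > 0"
    by (auto simp: eventually_at_right_field assms(3))
  then show ?thesis using inU
  proof eventually_elim
    case (elim t)
    then have "p - t *\<^sub>R v \<notin> \<Omega>" using boundary_chart_iff[OF assms(2)] by auto
    moreover have "p - t *\<^sub>R v \<notin> frontier \<Omega>" using boundary_chart_zero[OF assms(1,2)] elim by auto
    ultimately show ?case using assms(1) by (auto simp: frontier_def interior_open)
  qed
qed

section \<open>Area of smooth boundaries\<close>

lemma area_premeasure_le_finite:
  assumes I: "finite I" and "A \<subseteq> (\<Union>i\<in>I. C i)" and C: "\<And>i. i \<in> I \<Longrightarrow> bounded (C i)" "\<And>i. i \<in> I \<Longrightarrow> diameter (C i) \<le> \<delta>"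
    and "0 \<le> \<delta>"
  shows "area_premeasure \<delta> A \<le> ennreal (\<Sum>i\<in>I. pi / 4 * (diameter (C i))\<^sup>2)"
proof -
  obtain f where f: "bij_betw f {0..<card I} I" using ex_bij_betw_nat_finite[OF I] by blast
  define D where "D k = (if k < card I then C (f k) else {})" for k
  have fI: "f k \<in> I" if "k < card I" for k using f that by (auto simp: bij_betw_def)
  have "A \<subseteq> (\<Union>k. D k)"
  proof
    fix x assume "x \<in> A"
    then obtain i where i: "i \<in> I" "x \<in> C i" using assms(2) by blast
    then have "i \<in> f ` {0..<card I}" using f by (simp add: bij_betw_def)
    then obtain k where "k < card I" "i = f k" by auto
    with i have "x \<in> D k" by (simp add: D_def)
    then show "x \<in> (\<Union>k. D k)" by blast
  qed
  then have "area_premeasure \<delta> A \<le> (\<Sum>k. ennreal (pi / 4 * (diameter (D k))\<^sup>2))"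
    by (rule area_premeasure_le) (use C fI \<open>0 \<le> \<delta>\<close> in \<open>auto simp: D_def\<close>)
  also have "\<dots> = (\<Sum>k\<in>{0..<card I}. ennreal (pi / 4 * (diameter (D k))\<^sup>2))"
    by (rule suminf_finite) (auto simp: D_def)
  also have "\<dots> = (\<Sum>k\<in>{0..<card I}. ennreal (pi / 4 * (diameter (C (f k)))\<^sup>2))"
    by (rule sum.cong) (auto simp: D_def)
  also have "\<dots> = (\<Sum>i\<in>I. ennreal (pi / 4 * (diameter (C i))\<^sup>2))"
    by (rule sum.reindex_bij_betw[OF f])
  also have "\<dots> = ennreal (\<Sum>i\<in>I. pi / 4 * (diameter (C i))\<^sup>2)"
    by (rule sum_ennreal) simp
  finally show ?thesis .
qed

text \<open>A square grid of mesh \<open>s\<close> in the coordinates \<open>j\<close> and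
  \<open>k\<close> cuts \<open>A\<close> into at most \<open>(2 * N + 1)^2\<close> pieces of
  diameter at most \<open>2 * L * s\<close>. Since \<open>s * N = r\<close>, the total is bounded
  independently of the scale \<delta>.\<close>

lemma area_outer_finite_of_two_coordinates:
  fixes A :: "(real^3) set"
  assumes A: "A \<subseteq> ball p r" and r: "r > 0" and L: "L \<ge> 0"
    and lip: "\<And>x y. x \<in> A \<Longrightarrow> y \<in> A \<Longrightarrow> dist x y \<le> L * (\<bar>x $ j - y $ j\<bar> + \<bar>x $ k - y $ k\<bar>)"
  shows "area_outer A < top"
proof -
  have "area_premeasure \<delta> A \<le> ennreal (9 * pi * (L * r)\<^sup>2)" if \<delta>: "\<delta> > 0" for \<delta>
  proof -
    obtain n where n: "2 * L * r / \<delta> < real n" using reals_Archimedean2 by blast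
    define N where "N = Suc n"
    define s where "s = r / real N"
    have s: "s > 0" using r by (simp add: s_def N_def)
    have sN: "s * real N = r" by (simp add: s_def N_def)
    have "2 * L * r / \<delta> \<le> real N" using n by (simp add: N_def)
    then have sd: "2 * L * s \<le> \<delta>" using \<delta> by (simp add: s_def N_def field_simps)
    define I where "I = {- int N..int N} \<times> {- int N..int N}"
    define C where "C ab = {x\<in>A. \<lfloor>(x $ j - p $ j) / s\<rfloor> = fst ab \<and> \<lfloor>(x $ k - p $ k) / s\<rfloor> = snd ab}" for ab
    have fl: "\<lfloor>(x $ l - p $ l) / s\<rfloor> \<in> {- int N..int N}" if "x \<in> A" for x l
    proof -
      have "\<bar>(x - p) $ l\<bar> \<le> norm (x - p)" by (rule component_le_norm_cart)
      also have "\<dots> < r" using A that by (auto simp: dist_norm norm_minus_commute)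
      finally have "\<bar>x $ l - p $ l\<bar> < r" by simp
      then have "\<bar>x $ l - p $ l\<bar> / s < real N" using s sN by (simp add: pos_divide_less_eq mult.commute)
      then have "\<bar>(x $ l - p $ l) / s\<bar> < real N" using s by simp
      then have "- real N < (x $ l - p $ l) / s" "(x $ l - p $ l) / s < real N" unfolding abs_less_iff by linarith+
      then show ?thesis by (simp add: le_floor_iff floor_le_iff)
    qed
    have near: "\<bar>x $ l - y $ l\<bar> \<le> s" if "\<lfloor>(x $ l - p $ l) / s\<rfloor> = \<lfloor>(y $ l - p $ l) / s\<rfloor>" for x y :: "real^3" and l
    proof -
      have "\<bar>(x $ l - p $ l) / s - (y $ l - p $ l) / s\<bar> \<le> 1" using that by linarith
      moreover have "(x $ l - p $ l) / s - (y $ l - p $ l) / s = (x $ l - y $ l) / s" by (simp add: diff_divide_distrib)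
      ultimately show ?thesis using s by (simp add: field_simps)
    qed
    have diam: "diameter (C ab) \<le> 2 * L * s" for ab
    proof (rule diameter_le)
      show "C ab \<noteq> {} \<or> 0 \<le> 2 * L * s" using L s by simp
      fix x y assume "x \<in> C ab" "y \<in> C ab"
      then have xy: "x \<in> A" "y \<in> A" "\<bar>x $ j - y $ j\<bar> \<le> s" "\<bar>x $ k - y $ k\<bar> \<le> s"
        by (auto simp: C_def intro!: near)
      have "norm (x - y) \<le> L * (\<bar>x $ j - y $ j\<bar> + \<bar>x $ k - y $ k\<bar>)" using lip xy by (simp add: dist_norm)
      also have "\<dots> \<le> L * (s + s)" using xy L by (intro mult_left_mono add_mono) auto
      finally show "norm (x - y) \<le> 2 * L * s" by simp
    qed
    have bA: "bounded A" using A bounded_subset bounded_ball by blast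
    have bC: "bounded (C ab)" for ab by (rule bounded_subset[OF bA]) (auto simp: C_def)
    have "area_premeasure \<delta> A \<le> ennreal (\<Sum>ab\<in>I. pi / 4 * (diameter (C ab))\<^sup>2)"
    proof (rule area_premeasure_le_finite)
      show "A \<subseteq> (\<Union>ab\<in>I. C ab)"
      proof
        fix x assume x: "x \<in> A"
        have "x \<in> C (\<lfloor>(x $ j - p $ j) / s\<rfloor>, \<lfloor>(x $ k - p $ k) / s\<rfloor>)" using x by (simp add: C_def)
        then show "x \<in> (\<Union>ab\<in>I. C ab)" unfolding I_def using fl[OF x] by blast
      qed
      show "diameter (C ab) \<le> \<delta>" for ab using diam sd by (rule order_trans)
    qed (use bC \<delta> in \<open>auto simp: I_def\<close>)
    also have "\<dots> \<le> ennreal (\<Sum>ab\<in>I. pi / 4 * (2 * L * s)\<^sup>2)"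
      using bC diam by (intro ennreal_leI sum_mono mult_left_mono power_mono diameter_ge_0) auto
    also have "(\<Sum>ab\<in>I. pi / 4 * (2 * L * s)\<^sup>2) = (2 * real N + 1)\<^sup>2 * (pi * (L * s)\<^sup>2)"
      by (simp add: I_def card_cartesian_product power2_eq_square algebra_simps)
    also have "\<dots> \<le> (3 * real N)\<^sup>2 * (pi * (L * s)\<^sup>2)"
      by (intro mult_right_mono power_mono) (auto simp: N_def)
    also have "\<dots> = 9 * pi * (L * (s * real N))\<^sup>2" by (simp add: power2_eq_square)
    also note sN
    finally show ?thesis by (simp add: ennreal_leI)
  qed
  then have "area_outer A \<le> ennreal (9 * pi * (L * r)\<^sup>2)"
    unfolding area_outer_def by (intro SUP_least) auto
  then show ?thesis by (rule le_less_trans) simp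
qed

text \<open>Stated through sums, this expands both inner products and the l1 norm, whichever
  coordinate \<open>i\<close> is singled out.\<close>

lemma obtain_other_coordinates:
  obtains j k :: 3 where "\<And>f. sum f UNIV = f i + f j + (f k :: real)"
proof (cases "i = 1")
  case True
  then show ?thesis using that[of 2 3] by (simp add: sum_3)
next
  case False
  show ?thesis
  proof (cases "i = 2")
    case True then show ?thesis using that[of 1 3] by (simp add: sum_3)
  next
    case False
    with \<open>i \<noteq> 1\<close> have "i = 3" using exhaust_3 by blast
    then show ?thesis using that[of 1 2] by (simp add: sum_3)
  qed
qed

text \<open>Two frontier points in a small ball have the same value of \<open>g\<close>, so by the
  mean value theorem their difference is orthogonal to a gradient whose component \<open>i\<close>
  is bounded away from 0. Hence the other two coordinates control the distance, and no graph
  representation is needed.\<close>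

lemma area_outer_frontier_locally_finite:
  assumes "open \<Omega>" "smooth_boundary \<Omega>" "p \<in> frontier \<Omega>"
  obtains r where "r > 0" "area_outer (frontier \<Omega> \<inter> ball p r) < top"
proof -
  obtain U g where c: "boundary_chart \<Omega> p U g" using assms by (auto simp: smooth_boundary_def)
  have U: "open U" "p \<in> U" "smooth_on g U" "grad g p \<noteq> 0"
    using c by (simp_all add: boundary_chart_def)
  then obtain i where i: "grad g p $ i \<noteq> 0" by (auto simp: vec_eq_iff)
  define a where "a = \<bar>grad g p $ i\<bar>"
  have a: "a > 0" using i by (simp add: a_def)
  have "isCont (grad g) p"
    using U smooth_on_continuous_grad[of g U] by (simp add: continuous_on_eq_continuous_at)
  then obtain r1 where r1: "r1 > 0" "\<And>x. dist x p < r1 \<Longrightarrow> dist (grad g x) (grad g p) < a / 2"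
    using a unfolding continuous_at_eps_delta by (metis half_gt_zero)
  obtain r2 where r2: "r2 > 0" "ball p r2 \<subseteq> U" using U open_contains_ball by blast
  define r where "r = min r1 r2"
  have r: "r > 0" using r1 r2 by (simp add: r_def)
  define M where "M = norm (grad g p) + a / 2"
  have M: "M \<ge> 0" using a by (simp add: M_def)
  have inU: "x \<in> U" and gi: "a / 2 \<le> \<bar>grad g x $ i\<bar>" and gl: "\<And>l. \<bar>grad g x $ l\<bar> \<le> M" if "x \<in> ball p r" for x
  proof -
    show "x \<in> U" using that r2 by (auto simp: r_def)
    have d: "norm (grad g x - grad g p) < a / 2"
      using r1(2)[of x] that by (simp add: r_def dist_norm norm_minus_commute)
    have "\<bar>(grad g x - grad g p) $ i\<bar> \<le> norm (grad g x - grad g p)" by (rule component_le_norm_cart)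
    with d have "\<bar>grad g x $ i - grad g p $ i\<bar> < a / 2" by simp
    then show "a / 2 \<le> \<bar>grad g x $ i\<bar>" unfolding a_def by linarith
    fix l
    have "\<bar>grad g x $ l\<bar> \<le> norm (grad g x)" by (rule component_le_norm_cart)
    also have "\<dots> \<le> M" using d norm_triangle_sub[of "grad g x" "grad g p"] by (simp add: M_def)
    finally show "\<bar>grad g x $ l\<bar> \<le> M" .
  qed
  obtain j k where jk: "\<And>f. sum f UNIV = f i + f j + (f k :: real)" using obtain_other_coordinates[of i] by blast
  \<comment> \<open>The factor \<open>2 * M / a\<close> bounds component \<open>i\<close> of a
    difference by the other two; the summand 1 accounts for these two themselves in the l1
    norm.\<close>
  define L where "L = 1 + 2 * M / a"
  have "area_outer (frontier \<Omega> \<inter> ball p r) < top"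
  proof (rule area_outer_finite_of_two_coordinates)
    show "frontier \<Omega> \<inter> ball p r \<subseteq> ball p r" "r > 0" "L \<ge> 0" using r a M by (auto simp: L_def)
    fix x y assume xy: "x \<in> frontier \<Omega> \<inter> ball p r" "y \<in> frontier \<Omega> \<inter> ball p r"
    define u where "u = y - x"
    have ball: "x + s *\<^sub>R u \<in> ball p r" if "0 \<le> s" "s \<le> 1" for s
    proof -
      have "(1 - s) *\<^sub>R x + s *\<^sub>R y \<in> ball p r"
        using xy that by (intro convexD[OF convex_ball]) auto
      then show ?thesis by (simp add: u_def algebra_simps)
    qed
    have g0: "g x = 0" "g y = 0"
      using boundary_chart_zero[OF assms(1) c] xy inU by auto
    have "\<exists>s>0. s < 1 \<and> g (x + 1 *\<^sub>R u) - g (x + 0 *\<^sub>R u) = (1 - 0) * (grad g (x + s *\<^sub>R u) \<bullet> u)"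
      by (rule MVT2) (use U ball inU in \<open>auto intro!: line_has_real_derivative smooth_on_differentiable[of g U]\<close>)
    then obtain s where s: "0 < s" "s < 1" "grad g (x + s *\<^sub>R u) \<bullet> u = 0"
      using g0 by (auto simp: u_def)
    define G where "G = grad g (x + s *\<^sub>R u)"
    have \<xi>: "x + s *\<^sub>R u \<in> ball p r" using ball s by auto
    have "G $ i * u $ i + G $ j * u $ j + G $ k * u $ k = 0"
      using s(3) jk[of "\<lambda>l. G $ l * u $ l"] by (simp add: G_def inner_vec_def)
    then have "\<bar>G $ i * u $ i\<bar> \<le> \<bar>G $ j * u $ j\<bar> + \<bar>G $ k * u $ k\<bar>" by linarith
    also have "\<dots> \<le> M * \<bar>u $ j\<bar> + M * \<bar>u $ k\<bar>"
      unfolding abs_mult G_def using gl[OF \<xi>] by (intro add_mono mult_right_mono) auto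
    finally have "\<bar>G $ i\<bar> * \<bar>u $ i\<bar> \<le> M * (\<bar>u $ j\<bar> + \<bar>u $ k\<bar>)" by (simp add: abs_mult algebra_simps)
    moreover have "a / 2 * \<bar>u $ i\<bar> \<le> \<bar>G $ i\<bar> * \<bar>u $ i\<bar>"
      unfolding G_def using gi[OF \<xi>] by (intro mult_right_mono) auto
    ultimately have "a / 2 * \<bar>u $ i\<bar> \<le> M * (\<bar>u $ j\<bar> + \<bar>u $ k\<bar>)" by linarith
    then have ui: "\<bar>u $ i\<bar> \<le> 2 * M / a * (\<bar>u $ j\<bar> + \<bar>u $ k\<bar>)" using a by (simp add: field_simps)
    have "dist x y = norm u" by (simp add: u_def dist_norm norm_minus_commute)
    also have "\<dots> \<le> (\<Sum>l\<in>UNIV. \<bar>u $ l\<bar>)" by (rule norm_le_l1_cart)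
    also have "\<dots> = \<bar>u $ i\<bar> + \<bar>u $ j\<bar> + \<bar>u $ k\<bar>" by (rule jk)
    also have "\<dots> \<le> 2 * M / a * (\<bar>u $ j\<bar> + \<bar>u $ k\<bar>) + (\<bar>u $ j\<bar> + \<bar>u $ k\<bar>)" using ui by simp
    also have "\<dots> = L * (\<bar>u $ j\<bar> + \<bar>u $ k\<bar>)" by (simp add: L_def distrib_right)
    finally show "dist x y \<le> L * (\<bar>x $ j - y $ j\<bar> + \<bar>x $ k - y $ k\<bar>)"
      by (simp add: u_def abs_minus_commute)
  qed
  with r show ?thesis using that by blast
qed

lemma area_outer_frontier_finite:
  assumes "open \<Omega>" "bounded \<Omega>" "smooth_boundary \<Omega>"
  shows "area_outer (frontier \<Omega>) < top"
proof -
  have "compact (frontier \<Omega>)" using assms(2) by (rule compact_frontier_bounded)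
  have "\<exists>r. r > 0 \<and> area_outer (frontier \<Omega> \<inter> ball p r) < top" if "p \<in> frontier \<Omega>" for p
    using area_outer_frontier_locally_finite[OF assms(1,3) that] by blast
  then obtain r where r: "\<And>p. p \<in> frontier \<Omega> \<Longrightarrow> r p > 0 \<and> area_outer (frontier \<Omega> \<inter> ball p (r p)) < top"
    by metis
  have "frontier \<Omega> \<subseteq> (\<Union>p\<in>frontier \<Omega>. ball p (r p))" using r by fastforce
  then obtain F where F: "F \<subseteq> frontier \<Omega>" "finite F" "frontier \<Omega> \<subseteq> (\<Union>p\<in>F. ball p (r p))"
    using compactE_image[OF \<open>compact (frontier \<Omega>)\<close>, of "frontier \<Omega>" "\<lambda>p. ball p (r p)"] by (metis open_ball)
  have "area_outer (\<Union>p\<in>G. frontier \<Omega> \<inter> ball p (r p)) < top" if "finite G" "G \<subseteq> F" for G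
    using that
  proof (induction G rule: finite_induct)
    case empty then show ?case by (simp add: area_outer_subsingleton)
  next
    case (insert p G)
    have "area_outer (\<Union>p\<in>insert p G. frontier \<Omega> \<inter> ball p (r p)) \<le>
      area_outer (frontier \<Omega> \<inter> ball p (r p)) + area_outer (\<Union>p\<in>G. frontier \<Omega> \<inter> ball p (r p))"
      using area_outer_Un_le by simp
    also have "\<dots> < top" using insert F r by (auto simp: ennreal_add_less_top)
    finally show ?case .
  qed
  from this[OF F(2) order_refl] show ?thesis
    by (rule le_less_trans[rotated]) (rule area_outer_mono, use F in auto)
qed

text \<open>A cover of \<open>A\<close> by small sets thickens in direction \<open>i\<close> to a
  cover of the ball by boxes. The volume of a box is a constant times the squared diameter of its
  set, so coverings of arbitrarily small area would force the ball to have volume 0.\<close>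

lemma area_outer_pos_of_projection:
  fixes A :: "(real^3) set"
  assumes \<eta>: "\<eta> > 0"
    and proj: "\<And>x. x \<in> ball p \<eta> \<Longrightarrow> \<exists>y\<in>A. \<bar>x $ i - y $ i\<bar> \<le> 1 \<and> (\<forall>l. l \<noteq> i \<longrightarrow> x $ l = y $ l)"
  shows "area_outer A > 0"
proof (rule ccontr)
  assume "\<not> area_outer A > 0"
  \<comment> \<open>A box has volume \<open>16 * d^2\<close>, which is \<open>64 / pi\<close> times
    the term \<open>pi / 4 * d^2\<close> of the covering sum; total area below \<open>e\<close> thus
    means total volume below that of the ball.\<close>
  define e where "e = measure lborel (ball p \<eta>) * pi / 64"
  have e: "e > 0" using content_ball_pos[OF \<eta>] by (simp add: e_def)
  have "area_premeasure 1 A \<le> 0"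
    using \<open>\<not> area_outer A > 0\<close> area_premeasure_le_area_outer[of 1 A] by (simp add: not_less)
  then have "area_premeasure 1 A < ennreal e" using e by simp
  then obtain C where C: "A \<subseteq> (\<Union>n::nat. C n)" "\<And>n. bounded (C n)" "\<And>n. diameter (C n) \<le> 1"
    and sum: "(\<Sum>n. ennreal (pi / 4 * (diameter (C n))\<^sup>2)) < ennreal e"
    using area_premeasure_cover by blast
  define q where "q n = (SOME x. x \<in> C n)" for n
  \<comment> \<open>The half-width 2 in direction \<open>i\<close> is 1 for the distance from
    \<open>x\<close> to \<open>y\<close> plus 1 for the diameter of \<open>C n\<close>, which is at
    most 1 at the chosen scale.\<close>
  define w where "w n = (\<chi> l. if l = i then 2 else diameter (C n))" for n
  define E where "E n = cbox (q n - w n) (q n + w n)" for n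
  have d0: "diameter (C n) \<ge> 0" for n by (rule diameter_ge_0[OF C(2)])
  have "ball p \<eta> \<subseteq> (\<Union>n. E n)"
  proof
    fix x assume "x \<in> ball p \<eta>"
    then obtain y where y: "y \<in> A" "\<bar>x $ i - y $ i\<bar> \<le> 1" "\<And>l. l \<noteq> i \<Longrightarrow> x $ l = y $ l"
      using proj by blast
    then obtain n where n: "y \<in> C n" using C(1) by blast
    then have q: "q n \<in> C n" unfolding q_def by (rule someI)
    have "\<bar>y $ l - q n $ l\<bar> \<le> diameter (C n)" for l
    proof -
      have "\<bar>(y - q n) $ l\<bar> \<le> norm (y - q n)" by (rule component_le_norm_cart)
      also have "\<dots> \<le> diameter (C n)" using diameter_bounded_bound[OF C(2) n q] by (simp add: dist_norm)
      finally show ?thesis by simp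
    qed
    then have yq: "\<bar>y $ l - q n $ l\<bar> \<le> diameter (C n)" for l .
    have "\<bar>x $ l - q n $ l\<bar> \<le> w n $ l" for l
    proof (cases "l = i")
      case True
      then have "w n $ l = 2" by (simp add: w_def)
      then show ?thesis using y(2) C(3)[of n] yq[of i] unfolding True by linarith
    next
      case False
      then show ?thesis using y(3)[of l] yq[of l] by (simp add: w_def)
    qed
    then have "x \<in> E n" by (auto simp: E_def mem_box_cart abs_le_iff algebra_simps)
    then show "x \<in> (\<Union>n. E n)" by blast
  qed
  have emE: "emeasure lborel (E n) = ennreal (64 / pi) * ennreal (pi / 4 * (diameter (C n))\<^sup>2)" for n
  proof -
    have ne: "E n \<noteq> {}"
      using d0[of n] by (auto simp: E_def w_def interval_ne_empty_cart)
    have "emeasure lborel (E n) = ennreal (measure lborel (E n))"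
      by (rule emeasure_eq_ennreal_measure)
        (use emeasure_lborel_cbox_finite[of "q n - w n" "q n + w n"] in \<open>simp add: E_def\<close>)
    also have "measure lborel (E n) = (\<Prod>l\<in>UNIV. (q n + w n) $ l - (q n - w n) $ l)"
      using ne unfolding E_def by (rule content_cbox_cart)
    also have "\<dots> = (\<Prod>l\<in>UNIV. if l = i then 4 else 2 * diameter (C n))"
      by (rule prod.cong) (auto simp: w_def)
    also have "\<dots> = 4 * (\<Prod>l\<in>UNIV - {i}. if l = i then 4 else 2 * diameter (C n))"
      by (subst prod.remove[of _ i]) auto
    also have "(\<Prod>l\<in>UNIV - {i}. if l = i then 4 else 2 * diameter (C n)) = (\<Prod>l\<in>UNIV - {i}. 2 * diameter (C n))"
      by (rule prod.cong) auto
    also have "\<dots> = (2 * diameter (C n))\<^sup>2"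
      by (simp only: prod_constant) (simp add: card_Diff_singleton)
    also have "4 * \<dots> = 16 * (diameter (C n))\<^sup>2" by (simp add: power_mult_distrib)
    also have "ennreal \<dots> = ennreal (64 / pi * (pi / 4 * (diameter (C n))\<^sup>2))" by simp
    also have "\<dots> = ennreal (64 / pi) * ennreal (pi / 4 * (diameter (C n))\<^sup>2)"
      by (rule ennreal_mult) auto
    finally show ?thesis .
  qed
  have "emeasure lborel (ball p \<eta>) \<le> emeasure lborel (\<Union>n. E n)"
    by (rule emeasure_mono) (use \<open>ball p \<eta> \<subseteq> _\<close> in \<open>auto simp: E_def\<close>)
  also have "\<dots> \<le> (\<Sum>n. emeasure lborel (E n))"
    by (rule emeasure_subadditive_countably) (auto simp: E_def)
  also have "\<dots> = ennreal (64 / pi) * (\<Sum>n. ennreal (pi / 4 * (diameter (C n))\<^sup>2))"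
    unfolding emE by (rule ennreal_suminf_cmult)
  also have "\<dots> < ennreal (64 / pi) * ennreal e"
    using sum by (intro ennreal_mult_strict_left_mono) auto
  also have "\<dots> = ennreal (64 / pi * e)" using e by (intro ennreal_mult[symmetric]) auto
  also have "64 / pi * e = measure lborel (ball p \<eta>)" by (simp add: e_def)
  also have "ennreal \<dots> = emeasure lborel (ball p \<eta>)"
    using emeasure_lborel_ball_finite[of p \<eta>] by (intro emeasure_eq_ennreal_measure[symmetric]) auto
  finally show False by simp
qed

text \<open>Near \<open>p\<close> there is a ball inside \<open>\<Omega>\<close> and a ball outside,
  displaced from \<open>p\<close> along a coordinate axis. Each axis-parallel segment joining
  corresponding points of the two balls crosses the frontier, so the projection along that axis
  covers an open set.\<close>

lemma area_outer_frontier_pos: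
  assumes "open \<Omega>" "smooth_boundary \<Omega>" "p \<in> frontier \<Omega>" "r > 0"
  shows "area_outer (frontier \<Omega> \<inter> ball p r) > 0"
proof -
  obtain U g where c: "boundary_chart \<Omega> p U g" using assms by (auto simp: smooth_boundary_def)
  have U: "p \<in> U" "grad g p \<noteq> 0" using c by (simp_all add: boundary_chart_def)
  then obtain i where i: "grad g p $ i \<noteq> 0" by (auto simp: vec_eq_iff)
  define v :: "real^3" where "v = (- sgn (grad g p $ i)) *\<^sub>R axis i 1"
  have v: "grad g p \<bullet> v < 0" using i by (auto simp: v_def inner_axis sgn_real_def)
  have nv: "norm v = 1" using i by (auto simp: v_def sgn_real_def)
  have g0: "g p = 0" by (rule boundary_chart_zero[OF assms(1) c assms(3) U(1)])
  have "\<forall>\<^sub>F t in at_right 0. t < min (r / 2) 1"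
    using assms(4) unfolding eventually_at_right_field by (intro exI[of _ "min (r / 2) 1"]) auto
  then have "\<forall>\<^sub>F t in at_right 0. p + t *\<^sub>R v \<in> \<Omega> \<and> p - t *\<^sub>R v \<notin> closure \<Omega> \<and> t < min (r / 2) 1 \<and> t > 0"
    using boundary_chart_side(1)[OF c g0 v] boundary_chart_side_closure[OF assms(1) c g0 v]
      eventually_at_right_less[of 0] by eventually_elim auto
  then obtain t where t: "p + t *\<^sub>R v \<in> \<Omega>" "p - t *\<^sub>R v \<in> - closure \<Omega>" "t < r / 2" "t < 1" "t > 0"
    using eventually_happens'[OF trivial_limit_at_right_real] by fastforce
  obtain \<eta>1 where \<eta>1: "\<eta>1 > 0" "ball (p + t *\<^sub>R v) \<eta>1 \<subseteq> \<Omega>" using t assms(1) open_contains_ball by blast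
  obtain \<eta>2 where \<eta>2: "\<eta>2 > 0" "ball (p - t *\<^sub>R v) \<eta>2 \<subseteq> - closure \<Omega>"
    using t(2) open_contains_ball[of "- closure \<Omega>"] by blast
  \<comment> \<open>The bound \<open>r / 2\<close>, together with \<open>t < r / 2\<close>, keeps
    the crossing points inside \<open>ball p r\<close>.\<close>
  define \<eta> where "\<eta> = min (r / 2) (min \<eta>1 \<eta>2)"
  show ?thesis
  proof (rule area_outer_pos_of_projection)
    show "\<eta> > 0" using \<eta>1 \<eta>2 assms(4) by (simp add: \<eta>_def)
    fix x assume x: "x \<in> ball p \<eta>"
    have "dist (p + t *\<^sub>R v) (x + t *\<^sub>R v) = dist p x" "dist (p - t *\<^sub>R v) (x - t *\<^sub>R v) = dist p x"
      by (simp_all add: dist_norm)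
    then have "x + t *\<^sub>R v \<in> ball (p + t *\<^sub>R v) \<eta>1" "x - t *\<^sub>R v \<in> ball (p - t *\<^sub>R v) \<eta>2"
      using x by (simp_all add: \<eta>_def)
    then have "x + t *\<^sub>R v \<in> \<Omega>" "x - t *\<^sub>R v \<in> - closure \<Omega>" using \<eta>1(2) \<eta>2(2) by blast+
    then have sides: "x + t *\<^sub>R v \<in> \<Omega>" "x - t *\<^sub>R v \<notin> \<Omega>" using closure_subset by auto
    let ?S = "closed_segment (x + t *\<^sub>R v) (x - t *\<^sub>R v)"
    have "?S \<inter> frontier \<Omega> \<noteq> {}"
      by (rule connected_Int_frontier) (use sides in auto)
    then obtain y where y: "y \<in> ?S" "y \<in> frontier \<Omega>" by blast
    then obtain u where u: "0 \<le> u" "u \<le> 1" "y = (1 - u) *\<^sub>R (x + t *\<^sub>R v) + u *\<^sub>R (x - t *\<^sub>R v)"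
      by (auto simp: in_segment)
    define \<tau> where "\<tau> = (1 - 2 * u) * t"
    have yx: "y = x + \<tau> *\<^sub>R v" unfolding u(3) by (simp add: \<tau>_def vec_eq_iff algebra_simps)
    have "\<bar>\<tau>\<bar> = \<bar>1 - 2 * u\<bar> * t" using t by (simp add: \<tau>_def abs_mult)
    also have "\<dots> \<le> 1 * t" using u t by (intro mult_right_mono) auto
    finally have \<tau>: "\<bar>\<tau>\<bar> \<le> t" by simp
    have "dist p y \<le> dist p x + dist x y" by (rule dist_triangle)
    also have "dist x y = \<bar>\<tau>\<bar>" by (simp add: yx dist_norm nv)
    finally have "y \<in> ball p r" using x \<tau> t by (simp add: \<eta>_def)
    moreover have "\<bar>x $ i - y $ i\<bar> \<le> 1"
      using \<tau> t component_le_norm_cart[of "x - y" i] nv by (simp add: yx)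
    moreover have "x $ l = y $ l" if "l \<noteq> i" for l
      using that by (simp add: yx v_def axis_def)
    ultimately show "\<exists>y\<in>frontier \<Omega> \<inter> ball p r. \<bar>x $ i - y $ i\<bar> \<le> 1 \<and> (\<forall>l. l \<noteq> i \<longrightarrow> x $ l = y $ l)"
      using y(2) by blast
  qed
qed

section \<open>A maximum principle\<close>

lemma second_derivative_nonpos_at_local_max:
  fixes f f' :: "real \<Rightarrow> real"
  assumes f: "\<forall>\<^sub>F t in nhds a. (f has_real_derivative f' t) (at t)"
    and f': "(f' has_real_derivative s) (at a)"
    and max: "\<forall>\<^sub>F t in nhds a. f t \<le> f a"
  shows "s \<le> 0"
proof (rule ccontr)
  assume "\<not> s \<le> 0"
  then have s: "s > 0" by simp
  obtain d where d: "d > 0" "\<And>t. dist t a < d \<Longrightarrow> (f has_real_derivative f' t) (at t) \<and> f t \<le> f a"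
    using eventually_conj[OF f max] unfolding eventually_nhds_metric by blast
  have "f' a = 0"
    by (rule DERIV_local_max[of f _ a d]) (use d in \<open>auto simp: dist_real_def abs_minus_commute\<close>)
  with DERIV_pos_inc_right[OF f' s] obtain e where e: "e > 0" "\<And>h. 0 < h \<Longrightarrow> h < e \<Longrightarrow> 0 < f' (a + h)" by auto
  define h where "h = min d e / 2"
  have h: "0 < h" "h < d" "h < e" using d e by (auto simp: h_def)
  have "\<exists>z>a. z < a + h \<and> f (a + h) - f a = (a + h - a) * f' z"
    by (rule MVT2) (use h d(2) in \<open>auto simp: dist_real_def\<close>)
  then obtain z where z: "a < z" "z < a + h" "f (a + h) - f a = h * f' z" by auto
  have "f' z > 0" using e(2)[of "z - a"] z h by simp
  then have "f (a + h) > f a" using z(3) h by (metis diff_gt_0_iff_gt mult_pos_pos)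
  moreover have "f (a + h) \<le> f a" using d(2)[of "a + h"] h by (simp add: dist_real_def)
  ultimately show False by simp
qed

text \<open>A vanishing Laplacian in a weak pointwise sense: first derivatives along each axis line
  near \<open>x\<close>, second ones only at \<open>x\<close>. An interior maximum can be refuted
  from this alone, and it can be verified for functions that are known only along lines.\<close>

definition axis_harmonic_at :: "(real^'n \<Rightarrow> real) \<Rightarrow> real^'n \<Rightarrow> bool" where
  "axis_harmonic_at u x \<longleftrightarrow> (\<exists>u' u''. (\<forall>j.
     (\<forall>\<^sub>F t in nhds 0. ((\<lambda>t. u (x + t *\<^sub>R axis j 1)) has_real_derivative u' j t) (at t)) \<and>
     (u' j has_real_derivative u'' j) (at 0)) \<and> (\<Sum>j\<in>UNIV. u'' j) = (0::real))"

lemma axis_harmonic_at_minus: "axis_harmonic_at u x \<Longrightarrow> axis_harmonic_at (\<lambda>x. - u x) x"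
  unfolding axis_harmonic_at_def
proof (elim exE conjE)
  fix u' u'' assume A: "\<forall>j. (\<forall>\<^sub>F t in nhds 0. ((\<lambda>t. u (x + t *\<^sub>R axis j 1)) has_real_derivative u' j t) (at t)) \<and>
     (u' j has_real_derivative u'' j) (at 0)" "(\<Sum>j\<in>UNIV. u'' j) = 0"
  have "(\<forall>\<^sub>F t in nhds 0. ((\<lambda>t. - u (x + t *\<^sub>R axis j 1)) has_real_derivative - u' j t) (at t)) \<and>
     ((\<lambda>t. - u' j t) has_real_derivative - u'' j) (at 0)" for j
    using A(1)[rule_format, of j] by (auto intro: DERIV_minus elim!: eventually_mono)
  then show "\<exists>u' u''. (\<forall>j. (\<forall>\<^sub>F t in nhds 0. ((\<lambda>t. - u (x + t *\<^sub>R axis j 1)) has_real_derivative u' j t) (at t)) \<and>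
     (u' j has_real_derivative u'' j) (at 0)) \<and> (\<Sum>j\<in>UNIV. u'' j) = 0"
    using A(2) by (intro exI[of _ "\<lambda>j t. - u' j t"] exI[of _ "\<lambda>j. - u'' j"]) (simp add: sum_negf)
qed

text \<open>Adding \<open>e * (y \<bullet> y)\<close> makes the sum of the second axis derivatives
  strictly positive, which excludes an interior maximum of \<open>w\<close>.\<close>

lemma axis_harmonic_max_principle:
  fixes u :: "real^'n \<Rightarrow> real"
  assumes R: "open R" "bounded R" and cont: "continuous_on (closure R) u"
    and harm: "\<And>x. x \<in> R \<Longrightarrow> axis_harmonic_at u x"
    and bd: "\<And>x. x \<in> frontier R \<Longrightarrow> u x \<le> M"
    and x: "x \<in> R"
  shows "u x \<le> M"
proof (rule ccontr)
  assume "\<not> u x \<le> M"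
  obtain B where B: "B > 0" "\<And>y. y \<in> closure R \<Longrightarrow> norm y \<le> B"
    using R(2) bounded_closure bounded_pos by metis
  \<comment> \<open>With this choice the perturbation adds at most \<open>e * B^2\<close>, half of
    the assumed excess \<open>u x - M\<close>, so the maximum of \<open>w\<close> still cannot lie
    on the frontier.\<close>
  define e where "e = (u x - M) / (2 * B\<^sup>2)"
  have e: "e > 0" using B \<open>\<not> u x \<le> M\<close> by (simp add: e_def)
  define w where "w y = u y + e * (y \<bullet> y)" for y
  have eB: "M + e * B\<^sup>2 < u x" using \<open>\<not> u x \<le> M\<close> B by (simp add: e_def field_simps)
  have "compact (closure R)" using R(2) by simp
  moreover have "closure R \<noteq> {}" using x by auto
  moreover have "continuous_on (closure R) w" unfolding w_def by (intro continuous_intros cont)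
  ultimately obtain z where z: "z \<in> closure R" "\<And>y. y \<in> closure R \<Longrightarrow> w y \<le> w z"
    using continuous_attains_sup by metis
  have "u x \<le> w x" using e by (simp add: w_def)
  also have "w x \<le> w z" using z(2) x closure_subset by blast
  finally have wz: "M + e * B\<^sup>2 < w z" using eB by simp
  have "z \<in> R"
  proof (rule ccontr)
    assume "z \<notin> R"
    then have "z \<in> frontier R" using z(1) R(1) by (simp add: frontier_def interior_open)
    then have "u z \<le> M" by (rule bd)
    moreover have "z \<bullet> z \<le> B\<^sup>2" using B(2)[OF z(1)] by (simp add: dot_square_norm power_mono)
    ultimately have "w z \<le> M + e * B\<^sup>2" unfolding w_def using e by (intro add_mono mult_left_mono) auto
    with wz show False by simp
  qed
  from harm[OF this] obtain u' u'' where
    u: "\<And>j. \<forall>\<^sub>F t in nhds 0. ((\<lambda>t. u (z + t *\<^sub>R axis j 1)) has_real_derivative u' j t) (at t)"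
       "\<And>j. (u' j has_real_derivative u'' j) (at 0)" and sum0: "(\<Sum>j\<in>UNIV. u'' j) = 0"
    unfolding axis_harmonic_at_def by blast
  have "u'' j + 2 * e \<le> 0" for j
  proof (rule second_derivative_nonpos_at_local_max)
    have eq: "w (z + t *\<^sub>R axis j 1) = u (z + t *\<^sub>R axis j 1) + e * (z \<bullet> z + 2 * t * z $ j + t\<^sup>2)" for t
      by (simp add: w_def inner_add inner_axis inner_axis' power2_eq_square algebra_simps)
    show "\<forall>\<^sub>F t in nhds 0. ((\<lambda>t. w (z + t *\<^sub>R axis j 1)) has_real_derivative u' j t + e * (2 * z $ j + 2 * t)) (at t)"
      unfolding eq using u(1)[of j] by eventually_elim (auto intro!: derivative_eq_intros)
    show "((\<lambda>t. u' j t + e * (2 * z $ j + 2 * t)) has_real_derivative u'' j + 2 * e) (at 0)"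
      using u(2)[of j] by (auto intro!: derivative_eq_intros)
    have "((\<lambda>t. z + t *\<^sub>R axis j 1) \<longlongrightarrow> z + 0 *\<^sub>R axis j 1) (nhds 0)"
      by (intro tendsto_intros filterlim_ident)
    then have "\<forall>\<^sub>F t in nhds 0. z + t *\<^sub>R axis j 1 \<in> R"
      using R(1) \<open>z \<in> R\<close> by (auto intro: topological_tendstoD)
    then show "\<forall>\<^sub>F t in nhds 0. w (z + t *\<^sub>R axis j 1) \<le> w (z + 0 *\<^sub>R axis j 1)"
      by eventually_elim (use z(2) closure_subset[of R] in auto)
  qed
  then have "(\<Sum>j\<in>UNIV. u'' j + 2 * e) \<le> (\<Sum>j\<in>(UNIV::'n set). 0)" by (intro sum_mono) auto
  then show False using sum0 e by (simp add: sum.distrib mult_le_0_iff)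
qed

lemma axis_harmonic_zero:
  fixes u :: "real^'n \<Rightarrow> real"
  assumes "open R" "bounded R" "continuous_on (closure R) u"
    "\<And>x. x \<in> R \<Longrightarrow> axis_harmonic_at u x" "\<And>x. x \<in> frontier R \<Longrightarrow> u x = 0" "x \<in> R"
  shows "u x = 0"
proof (rule antisym)
  show "u x \<le> 0" by (rule axis_harmonic_max_principle[OF assms(1-4) _ assms(6)]) (use assms(5) in auto)
  have "- u x \<le> 0"
    by (rule axis_harmonic_max_principle[where u="\<lambda>x. - u x", OF assms(1,2) _ _ _ assms(6)])
      (use assms in \<open>auto intro: axis_harmonic_at_minus continuous_intros\<close>)
  then show "0 \<le> u x" by simp
qed

section \<open>Even moments of a compactly supported measure\<close>

text \<open>A continuous linear functional on the continuous functions, localised on a compact set, i.e. a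
  finite signed measure with compact support.\<close>

locale compact_functional =
  fixes \<Lambda> :: "(real^3 \<Rightarrow> real) \<Rightarrow> real" and K :: "(real^3) set" and C :: real
  assumes compact: "compact K"
    and add: "\<And>f g. continuous_on UNIV f \<Longrightarrow> continuous_on UNIV g \<Longrightarrow> \<Lambda> (\<lambda>x. f x + g x) = \<Lambda> f + \<Lambda> g"
    and scale: "\<And>a f. continuous_on UNIV f \<Longrightarrow> \<Lambda> (\<lambda>x. a * f x) = a * \<Lambda> f"
    and bound: "\<And>f e. continuous_on UNIV f \<Longrightarrow> (\<And>x. x \<in> K \<Longrightarrow> \<bar>f x\<bar> \<le> e) \<Longrightarrow> 0 \<le> e \<Longrightarrow> \<bar>\<Lambda> f\<bar> \<le> C * e"
begin

lemma zero: "\<Lambda> (\<lambda>x. 0) = 0"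
  using scale[of "\<lambda>x. 0" 0] by simp

lemma diff:
  assumes "continuous_on UNIV f" "continuous_on UNIV g"
  shows "\<Lambda> (\<lambda>x. f x - g x) = \<Lambda> f - \<Lambda> g"
  using add[of f "\<lambda>x. (-1) * g x"] scale[of g "-1"] assms by (simp add: continuous_on_minus)

lemma sum:
  assumes "\<And>i. i \<in> I \<Longrightarrow> continuous_on UNIV (f i)"
  shows "\<Lambda> (\<lambda>x. \<Sum>i\<in>I. f i x) = (\<Sum>i\<in>I. \<Lambda> (f i))"
  using assms
proof (induction I rule: infinite_finite_induct)
  case (insert i I)
  then show ?case by (simp add: add[of "f i" "\<lambda>x. \<Sum>i\<in>I. f i x"] continuous_on_sum)
qed (simp_all add: zero)

section \<open>Moments as polynomials along lines\<close>

definition moment :: "nat \<Rightarrow> real^3 \<Rightarrow> real" where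
  "moment m x = \<Lambda> (\<lambda>y. (dist x y)\<^sup>2 ^ m)"

definition line_poly :: "real^3 \<Rightarrow> real^3 \<Rightarrow> real^3 \<Rightarrow> real poly" where
  "line_poly x v y = [:(dist x y)\<^sup>2, 2 * (v \<bullet> (x - y)), v \<bullet> v:]"

lemma poly_line_poly: "poly (line_poly x v y) t = (dist (x + t *\<^sub>R v) y)\<^sup>2"
proof -
  have "(dist (x + t *\<^sub>R v) y)\<^sup>2 = ((x - y) + t *\<^sub>R v) \<bullet> ((x - y) + t *\<^sub>R v)"
    by (simp add: dist_norm power2_norm_eq_inner algebra_simps)
  also have "\<dots> = (x - y) \<bullet> (x - y) + t * (2 * (v \<bullet> (x - y)) + t * (v \<bullet> v))"
    by (simp add: inner_add_left inner_add_right inner_commute algebra_simps)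
  finally show ?thesis by (simp add: line_poly_def dist_norm power2_norm_eq_inner)
qed

lemma continuous_coeff_line_poly: "continuous_on UNIV (\<lambda>y. coeff (line_poly x v y ^ m) i)"
proof (induction m arbitrary: i)
  case (Suc m)
  have "continuous_on UNIV (\<lambda>y. coeff (line_poly x v y) k)" for k
    by (cases k; cases "k - 1"; cases "k - 2")
      (auto simp: line_poly_def coeff_pCons split: nat.split intro!: continuous_intros)
  then show ?case using Suc by (simp add: coeff_mult continuous_on_sum continuous_on_mult)
qed (cases i; simp)

lemma degree_line_poly_power: "degree (line_poly x v y ^ m) \<le> 2 * m"
proof -
  have "degree (line_poly x v y) \<le> 2" by (simp add: line_poly_def)
  then show ?thesis
    by (meson degree_power_le le_trans mult_le_mono1)
qed

text \<open>Applying \<open>\<Lambda>\<close> to each coefficient turns the moment along a line into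
  a polynomial in one variable. Its derivatives are then algebraic, with no differentiation under
  \<open>\<Lambda>\<close>. The index range reflects that the squared distance has degree at most 2
  in \<open>t\<close>.\<close>

definition moment_poly :: "nat \<Rightarrow> real^3 \<Rightarrow> real^3 \<Rightarrow> real poly" where
  "moment_poly m x v = (\<Sum>i\<le>2 * m. monom (\<Lambda> (\<lambda>y. coeff (line_poly x v y ^ m) i)) i)"

lemma coeff_moment_poly: "coeff (moment_poly m x v) i = \<Lambda> (\<lambda>y. coeff (line_poly x v y ^ m) i)"
proof (cases "i \<le> 2 * m")
  case True
  then show ?thesis by (simp add: moment_poly_def coeff_sum sum.delta')
next
  case False
  then have "coeff (line_poly x v y ^ m) i = 0" for y
    using degree_line_poly_power[of x v y m] by (intro coeff_eq_0) simp
  then show ?thesis using False by (simp add: moment_poly_def coeff_sum zero)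
qed

lemma moment_on_line: "moment m (x + t *\<^sub>R v) = poly (moment_poly m x v) t"
proof -
  have "(dist (x + t *\<^sub>R v) y)\<^sup>2 ^ m = (\<Sum>i\<le>2 * m. t ^ i * coeff (line_poly x v y ^ m) i)" for y
  proof -
    have "(dist (x + t *\<^sub>R v) y)\<^sup>2 ^ m = poly (line_poly x v y ^ m) t"
      by (simp add: poly_line_poly)
    also have "\<dots> = poly (\<Sum>i\<le>2 * m. monom (coeff (line_poly x v y ^ m) i) i) t"
      by (simp only: poly_as_sum_of_monoms'[OF degree_line_poly_power])
    finally show ?thesis by (simp add: poly_sum poly_monom mult.commute)
  qed
  then have "moment m (x + t *\<^sub>R v) = \<Lambda> (\<lambda>y. \<Sum>i\<le>2 * m. t ^ i * coeff (line_poly x v y ^ m) i)"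
    unfolding moment_def by simp
  also have "\<dots> = (\<Sum>i\<le>2 * m. \<Lambda> (\<lambda>y. t ^ i * coeff (line_poly x v y ^ m) i))"
    by (intro sum continuous_on_mult continuous_on_const continuous_coeff_line_poly)
  also have "\<dots> = (\<Sum>i\<le>2 * m. t ^ i * \<Lambda> (\<lambda>y. coeff (line_poly x v y ^ m) i))"
    by (intro sum.cong refl scale continuous_coeff_line_poly)
  also have "\<dots> = poly (moment_poly m x v) t"
    by (simp add: moment_poly_def poly_sum poly_monom mult.commute)
  finally show ?thesis .
qed

text \<open>This is the identity that the Laplacian of \<open>|x - y|^(2n+2)\<close> equals
  \<open>(2n+2)(2n+3) |x - y|^(2n)\<close> in dimension three, halved because the coefficient of
  \<open>t^2\<close> is half a second derivative.\<close>

lemma sum_coeff2_line_poly: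
  "(\<Sum>j\<in>UNIV. coeff (line_poly x (axis j 1) y ^ Suc n) 2) = (real n + 1) * (2 * real n + 3) * (dist x y)\<^sup>2 ^ n"
proof -
  let ?r = "(dist x y)\<^sup>2"
  \<comment> \<open>For \<open>n = 0\<close> the exponent \<open>n - 1\<close> truncates to 0, and
    the factor \<open>real n\<close> removes the term.\<close>
  have c: "2 * coeff (line_poly x (axis j 1) y ^ Suc n) 2 =
     (real n + 1) * (2 * ?r ^ n + real n * ?r ^ (n - 1) * (4 * ((x - y) $ j)\<^sup>2))" for j
  proof -
    define P where "P = line_poly x (axis j 1) y"
    have P0: "poly P 0 = ?r" "poly (pderiv P) 0 = 2 * (x - y) $ j" "poly (pderiv (pderiv P)) 0 = 2"
      by (simp_all add: P_def line_poly_def pderiv_pCons inner_axis' inner_axis)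
    have "2 * coeff (P ^ Suc n) 2 = coeff (pderiv (pderiv (P ^ Suc n))) 0"
      by (simp add: coeff_pderiv numeral_2_eq_2)
    also have "\<dots> = poly (pderiv (pderiv (P ^ Suc n))) 0" by (simp add: poly_0_coeff_0)
    also have "\<dots> = (real n + 1) * (2 * ?r ^ n + real n * ?r ^ (n - 1) * (4 * ((x - y) $ j)\<^sup>2))"
      by (cases n) (simp_all add: pderiv_power_Suc pderiv_mult pderiv_smult P0 power2_eq_square algebra_simps del: power_Suc)
    finally show ?thesis by (simp add: P_def)
  qed
  have r: "(\<Sum>j\<in>UNIV. ((x - y) $ j)\<^sup>2) = ?r"
    unfolding dist_norm power2_norm_eq_inner inner_vec_def by (simp add: power2_eq_square)
  have "2 * (\<Sum>j\<in>UNIV. coeff (line_poly x (axis j 1) y ^ Suc n) 2) =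
    (\<Sum>j\<in>UNIV. (real n + 1) * (2 * ?r ^ n + real n * ?r ^ (n - 1) * (4 * ((x - y) $ j)\<^sup>2)))"
    unfolding sum_distrib_left by (rule sum.cong[OF refl]) (rule c)
  also have "\<dots> = (real n + 1) * (6 * ?r ^ n + real n * ?r ^ (n - 1) * (4 * (\<Sum>j\<in>UNIV. ((x - y) $ j)\<^sup>2)))"
    by (simp add: sum.distrib flip: sum_distrib_left)
  also have "\<dots> = 2 * ((real n + 1) * (2 * real n + 3) * ?r ^ n)"
    unfolding r by (cases n) (simp_all add: algebra_simps)
  finally show ?thesis by simp
qed

text \<open>The Laplacian of \<open>moment (n + 1)\<close> is a multiple of \<open>moment n\<close>.\<close>

lemma axis_harmonic_moment:
  assumes "moment n x = 0" shows "axis_harmonic_at (moment (Suc n)) x"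
proof -
  define Q where "Q j = moment_poly (Suc n) x (axis j 1)" for j
  have "(\<Sum>j\<in>UNIV. poly (pderiv (pderiv (Q j))) 0) = (\<Sum>j\<in>UNIV. 2 * coeff (Q j) 2)"
    by (simp add: poly_0_coeff_0 coeff_pderiv numeral_2_eq_2)
  also have "\<dots> = 2 * (\<Sum>j\<in>UNIV. \<Lambda> (\<lambda>y. coeff (line_poly x (axis j 1) y ^ Suc n) 2))"
    by (simp only: Q_def coeff_moment_poly sum_distrib_left)
  also have "\<dots> = 2 * \<Lambda> (\<lambda>y. \<Sum>j\<in>UNIV. coeff (line_poly x (axis j 1) y ^ Suc n) 2)"
    by (subst sum[OF continuous_coeff_line_poly]) simp
  also have "\<dots> = 2 * ((real n + 1) * (2 * real n + 3) * moment n x)"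
    unfolding sum_coeff2_line_poly moment_def by (subst scale) (auto intro!: continuous_intros)
  finally have 0: "(\<Sum>j\<in>UNIV. poly (pderiv (pderiv (Q j))) 0) = 0" using assms by simp
  show ?thesis
    unfolding axis_harmonic_at_def moment_on_line
    by (rule exI[of _ "\<lambda>j t. poly (pderiv (Q j)) t"], rule exI[of _ "\<lambda>j. poly (pderiv (pderiv (Q j))) 0"])
      (use 0 in \<open>auto simp: Q_def intro!: poly_DERIV\<close>)
qed

lemma continuous_on_moment:
  assumes "compact S" shows "continuous_on S (moment m)"
proof -
  define h :: "(real^3) \<times> (real^3) \<Rightarrow> real" where "h z = (dist (fst z) (snd z))\<^sup>2 ^ m" for z
  have "uniformly_continuous_on (S \<times> K) h"
    unfolding h_def by (intro compact_uniformly_continuous compact_Times assms compact continuous_intros)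
  then have uc: "\<exists>d>0. \<forall>x\<in>S \<times> K. \<forall>x'\<in>S \<times> K. dist x' x < d \<longrightarrow> dist (h x') (h x) < e" if "e > 0" for e
    using that unfolding uniformly_continuous_on_def by blast
  show ?thesis
    unfolding continuous_on_iff
  proof (intro ballI allI impI)
    fix x and e :: real assume x: "x \<in> S" and e: "e > 0"
    \<comment> \<open>\<open>C\<close> carries no sign assumption, hence the denominator
      \<open>\<bar>C\<bar> + 1\<close>.\<close>
    define e' where "e' = e / (\<bar>C\<bar> + 1)"
    have e': "e' > 0" using e by (simp add: e'_def)
    obtain d where d: "d > 0" "\<And>z z'. z \<in> S \<times> K \<Longrightarrow> z' \<in> S \<times> K \<Longrightarrow> dist z' z < d \<Longrightarrow> dist (h z') (h z) < e'"
      using uc[OF e'] by blast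
    have "dist (moment m x') (moment m x) < e" if "x' \<in> S" "dist x' x < d" for x'
    proof -
      have "\<bar>\<Lambda> (\<lambda>y. h (x', y) - h (x, y))\<bar> \<le> C * e'"
      proof (rule bound)
        show "continuous_on UNIV (\<lambda>y. h (x', y) - h (x, y))" unfolding h_def by (intro continuous_intros)
        show "\<bar>h (x', y) - h (x, y)\<bar> \<le> e'" if "y \<in> K" for y
          using d(2)[of "(x, y)" "(x', y)"] that x \<open>x' \<in> S\<close> \<open>dist x' x < d\<close>
          by (simp add: dist_Pair_Pair dist_real_def)
      qed (use e' in simp)
      also have "\<Lambda> (\<lambda>y. h (x', y) - h (x, y)) = moment m x' - moment m x"
        unfolding h_def moment_def fst_conv snd_conv by (rule diff) (intro continuous_intros)+
      also have "C * e' \<le> \<bar>C\<bar> * e'" using e' by (intro mult_right_mono) auto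
      also have "\<dots> < e" using e by (simp add: e'_def field_simps)
      finally show ?thesis by (simp add: dist_real_def)
    qed
    then show "\<exists>d>0. \<forall>x'\<in>S. dist x' x < d \<longrightarrow> dist (moment m x') (moment m x) < e"
      using d(1) by blast
  qed
qed

text \<open>The maximum principle gives vanishing in \<open>R\<close> only, but the bumps used later
  are centred at arbitrary points of \<open>closure \<Omega>\<close>, which may lie outside
  \<open>R\<close>. Polynomial dependence along lines carries the zero to the whole space within
  each induction step. For \<open>m = 0\<close> the moment does not depend on the centre.\<close>

lemma moment_zero:
  assumes R: "open R" "bounded R" "R \<noteq> {}"
    and van: "\<And>m x. x \<in> frontier R \<Longrightarrow> moment m x = 0"
  shows "moment m x = 0"
proof (induction m arbitrary: x)
  case 0
  have "frontier R \<noteq> {}" using R by (metis frontier_eq_empty not_bounded_UNIV)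
  then obtain z where "z \<in> frontier R" by blast
  with van[of z 0] show ?case by (simp add: moment_def)
next
  case (Suc n)
  have zR: "moment (Suc n) z = 0" if "z \<in> R" for z
    by (rule axis_harmonic_zero[OF R(1,2) _ _ _ that])
      (use R van Suc in \<open>auto intro!: continuous_on_moment axis_harmonic_moment\<close>)
  \<comment> \<open>On the line from \<open>z\<close> through \<open>x\<close> the moment is a
    polynomial with infinitely many zeros near \<open>t = 0\<close>; the value at
    \<open>t = 1\<close> is the moment at \<open>x\<close>.\<close>
  obtain z where z: "z \<in> R" using R by blast
  define Q where "Q = moment_poly (Suc n) z (x - z)"
  have Q: "poly Q t = moment (Suc n) (z + t *\<^sub>R (x - z))" for t by (simp add: Q_def moment_on_line)
  have "((\<lambda>t. z + t *\<^sub>R (x - z)) \<longlongrightarrow> z + 0 *\<^sub>R (x - z)) (nhds 0)"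
    by (intro tendsto_intros filterlim_ident)
  then have "\<forall>\<^sub>F t in nhds 0. z + t *\<^sub>R (x - z) \<in> R"
    using R(1) z by (auto intro: topological_tendstoD)
  then obtain d where d: "d > 0" "\<And>t. dist t 0 < d \<Longrightarrow> z + t *\<^sub>R (x - z) \<in> R"
    unfolding eventually_nhds_metric by blast
  have "Q = 0"
  proof (rule ccontr)
    assume "Q \<noteq> 0"
    then have "finite {t. poly Q t = 0}" by (rule poly_roots_finite)
    moreover have "{0<..<d} \<subseteq> {t. poly Q t = 0}" using d(2) zR Q by auto
    ultimately have "finite {0<..<d}" by (rule rev_finite_subset)
    then show False using d(1) by (simp add: infinite_Ioo)
  qed
  then show ?case using Q[of 1] by simp
qed

text \<open>Approximation takes place in the variable \<open>s\<close>, the squared distance, on the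
  compact interval of values that it assumes on \<open>K\<close>. A polynomial in \<open>s\<close>
  involves even powers of the distance only, so \<open>\<Lambda>\<close> annihilates it.\<close>

lemma radial_zero:
  assumes "\<And>m. moment m x = 0" "continuous_on UNIV F"
  shows "\<Lambda> (\<lambda>y. F ((dist x y)\<^sup>2)) = 0"
proof -
  obtain b where b: "\<And>y. y \<in> K \<Longrightarrow> dist x y \<le> b"
    using compact_imp_bounded[OF compact] bounded_any_center[of K x] by blast
  define B where "B = max b 1"
  have B: "\<And>y. y \<in> K \<Longrightarrow> dist x y \<le> B" "B > 0"
    using b by (auto simp: B_def max.coboundedI1)
  have small: "\<bar>\<Lambda> (\<lambda>y. F ((dist x y)\<^sup>2))\<bar> \<le> C * e" if e: "e > 0" for e
  proof -
    have "continuous_on {0..B\<^sup>2} F" using assms(2) by (rule continuous_on_subset) simp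
    then obtain g where g: "real_polynomial_function g" "\<And>s. s \<in> {0..B\<^sup>2} \<Longrightarrow> \<bar>F s - g s\<bar> < e"
      using Stone_Weierstrass_real_polynomial_function[of "{0..B\<^sup>2}" F e] e by auto
    from g(1) obtain a n where a: "g = (\<lambda>s. \<Sum>i\<le>n. a i * s ^ i)"
      by (auto simp: real_polynomial_function_iff_sum)
    have cF: "continuous_on UNIV (\<lambda>y. F ((dist x y)\<^sup>2))"
      by (rule continuous_on_compose2[OF assms(2)]) (auto intro!: continuous_intros)
    have cg: "continuous_on UNIV (\<lambda>y. g ((dist x y)\<^sup>2))" unfolding a by (intro continuous_intros)
    have "\<Lambda> (\<lambda>y. g ((dist x y)\<^sup>2)) = (\<Sum>i\<le>n. \<Lambda> (\<lambda>y. a i * ((dist x y)\<^sup>2) ^ i))"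
      unfolding a by (rule sum) (intro continuous_intros)
    also have "\<dots> = (\<Sum>i\<le>n. a i * moment i x)"
      unfolding moment_def by (intro sum.cong refl scale continuous_intros)
    also have "\<dots> = 0" using assms(1) by simp
    finally have "\<Lambda> (\<lambda>y. F ((dist x y)\<^sup>2)) = \<Lambda> (\<lambda>y. F ((dist x y)\<^sup>2) - g ((dist x y)\<^sup>2))"
      using diff[OF cF cg] by simp
    also have "\<bar>\<dots>\<bar> \<le> C * e"
      using e B by (intro bound continuous_on_diff cF cg less_imp_le[OF g(2)]) (auto intro!: power_mono)
    finally show ?thesis .
  qed
  show ?thesis
  proof (rule ccontr)
    assume "\<not> ?thesis"
    then have l: "\<bar>\<Lambda> (\<lambda>y. F ((dist x y)\<^sup>2))\<bar> > 0" (is "?l > 0") by simp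
    have "C * (?l / (2 * (\<bar>C\<bar> + 1))) \<le> \<bar>C\<bar> * (?l / (2 * (\<bar>C\<bar> + 1)))" using l by (intro mult_right_mono) auto
    also have "\<dots> < ?l" using l by (auto simp: field_simps intro: add_nonneg_pos)
    finally show False using small[of "?l / (2 * (\<bar>C\<bar> + 1))"] l by simp
  qed
qed

end

section \<open>Fields without divergence and rotation\<close>

lemma second_difference_mean_value:
  fixes f :: "real^3 \<Rightarrow> real"
  assumes f: "\<And>y. y \<in> ball x d \<Longrightarrow> f differentiable (at y)"
    and f': "\<And>y. y \<in> ball x d \<Longrightarrow> pderivative i f differentiable (at y)"
    and h: "0 < h" "2 * h < d"
  obtains p where "p \<in> ball x d"
    "f (x + h *\<^sub>R axis i 1 + h *\<^sub>R axis j 1) - f (x + h *\<^sub>R axis i 1) - f (x + h *\<^sub>R axis j 1) + f x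
      = h\<^sup>2 * pderivative j (pderivative i f) p"
proof -
  have inb: "x + s *\<^sub>R axis i 1 + t *\<^sub>R axis j 1 \<in> ball x d" if "0 \<le> s" "s \<le> h" "0 \<le> t" "t \<le> h" for s t
  proof -
    have "norm (s *\<^sub>R axis i 1 + t *\<^sub>R axis j (1::real)) \<le> s + t"
      using norm_triangle_ineq[of "s *\<^sub>R axis i (1::real)" "t *\<^sub>R axis j 1"] that by simp
    then have "norm (- (s *\<^sub>R axis i 1 + t *\<^sub>R axis j (1::real))) < d" unfolding norm_minus_cancel using that h by linarith
    then show ?thesis by (simp add: dist_norm)
  qed
  have line: "((\<lambda>s. g (y + s *\<^sub>R axis k 1)) has_real_derivative pderivative k g (y + s *\<^sub>R axis k 1)) (at s)"
    if "g differentiable (at (y + s *\<^sub>R axis k 1))" for g y k s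
    using line_has_real_derivative[OF that] by (simp add: grad_def inner_axis)
  \<comment> \<open>The difference in direction \<open>j\<close> as a function of the shift in
    direction \<open>i\<close>; the mean value theorem is applied to it first, and then in direction
    \<open>j\<close>.\<close>
  define \<phi> where "\<phi> s = f (x + s *\<^sub>R axis i 1 + h *\<^sub>R axis j 1) - f (x + s *\<^sub>R axis i 1)" for s
  have "\<exists>s>0. s < h \<and> \<phi> h - \<phi> 0 = (h - 0) *
     (pderivative i f (x + s *\<^sub>R axis i 1 + h *\<^sub>R axis j 1) - pderivative i f (x + s *\<^sub>R axis i 1))"
  proof (rule MVT2)
    fix s assume s: "0 \<le> s" "s \<le> h"
    have "f differentiable (at ((x + h *\<^sub>R axis j 1) + s *\<^sub>R axis i 1))" "f differentiable (at (x + s *\<^sub>R axis i 1))"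
      using f[OF inb[of s h]] f[OF inb[of s 0]] s h by (simp_all add: add_ac)
    from DERIV_diff[OF line[OF this(1)] line[OF this(2)]]
    show "(\<phi> has_real_derivative pderivative i f (x + s *\<^sub>R axis i 1 + h *\<^sub>R axis j 1) -
       pderivative i f (x + s *\<^sub>R axis i 1)) (at s)"
      by (simp add: \<phi>_def[abs_def] add_ac)
  qed (use h in simp)
  then obtain s where s: "0 < s" "s < h" and \<phi>: "\<phi> h - \<phi> 0 = h *
     (pderivative i f (x + s *\<^sub>R axis i 1 + h *\<^sub>R axis j 1) - pderivative i f (x + s *\<^sub>R axis i 1))" by auto
  define y where "y = x + s *\<^sub>R axis i 1"
  have "\<exists>t>0. t < h \<and> pderivative i f (y + h *\<^sub>R axis j 1) - pderivative i f (y + 0 *\<^sub>R axis j 1) =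
     (h - 0) * pderivative j (pderivative i f) (y + t *\<^sub>R axis j 1)"
    by (rule MVT2) (use h s f' inb[of s] in \<open>auto simp: y_def intro!: line\<close>)
  then obtain t where t: "0 < t" "t < h" "pderivative i f (y + h *\<^sub>R axis j 1) - pderivative i f y =
     h * pderivative j (pderivative i f) (y + t *\<^sub>R axis j 1)" by auto
  have "f (x + h *\<^sub>R axis i 1 + h *\<^sub>R axis j 1) - f (x + h *\<^sub>R axis i 1) - f (x + h *\<^sub>R axis j 1) + f x = \<phi> h - \<phi> 0"
    by (simp add: \<phi>_def)
  also have "\<dots> = h\<^sup>2 * pderivative j (pderivative i f) (y + t *\<^sub>R axis j 1)"
    using \<phi> t(3) by (simp add: y_def power2_eq_square)
  finally show ?thesis
    using that[of "y + t *\<^sub>R axis j 1"] inb[of s t] s t by (simp add: y_def)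
qed

text \<open>The second difference is symmetric in \<open>i\<close> and \<open>j\<close>, so both
  mixed derivatives take a common value at points near \<open>x\<close>, and continuity identifies
  them at \<open>x\<close>.\<close>

lemma pderivative_commute:
  fixes f :: "real^3 \<Rightarrow> real"
  assumes "open U" "Ck_on 2 f U" "x \<in> U"
  shows "pderivative j (pderivative i f) x = pderivative i (pderivative j f) x"
proof -
  have C2: "Ck_on (Suc (Suc 0)) f U" using assms(2) by (simp only: numeral_2_eq_2)
  have d1: "f differentiable (at y)" if "y \<in> U" for y using Ck_on_SucD[OF C2 that] .
  have C1: "Ck_on (Suc 0) (pderivative k f) U" for k
    using Ck_on_Suc_grad[OF C2, of "axis k 1"] by (simp add: pderivative_def[abs_def])
  have d2: "pderivative k f differentiable (at y)" if "y \<in> U" for y k using Ck_on_SucD[OF C1 that] .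
  have cont: "isCont (pderivative l (pderivative k f)) x" for k l
    using Ck_on_Suc_grad[OF C1, of k "axis l 1"] assms(1,3)
    by (simp add: pderivative_def[abs_def] continuous_on_eq_continuous_at)
  have "\<bar>pderivative j (pderivative i f) x - pderivative i (pderivative j f) x\<bar> \<le> 2 * e" if e: "e > 0" for e
  proof -
    obtain d0 where d0: "d0 > 0" "ball x d0 \<subseteq> U" using assms open_contains_ball by blast
    obtain d1' where d1': "d1' > 0" "\<And>y. dist y x < d1' \<Longrightarrow> dist (pderivative j (pderivative i f) y) (pderivative j (pderivative i f) x) < e"
      using cont e unfolding continuous_at_eps_delta by blast
    obtain d2' where d2': "d2' > 0" "\<And>y. dist y x < d2' \<Longrightarrow> dist (pderivative i (pderivative j f) y) (pderivative i (pderivative j f) x) < e"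
      using cont e unfolding continuous_at_eps_delta by blast
    define d where "d = min d0 (min d1' d2')"
    define h where "h = d / 3"
    have h: "0 < h" "2 * h < d" using d0 d1' d2' by (auto simp: h_def d_def)
    have sub: "y \<in> U" if "y \<in> ball x d" for y using that d0 by (auto simp: d_def)
    obtain p where p: "p \<in> ball x d"
      "f (x + h *\<^sub>R axis i 1 + h *\<^sub>R axis j 1) - f (x + h *\<^sub>R axis i 1) - f (x + h *\<^sub>R axis j 1) + f x
        = h\<^sup>2 * pderivative j (pderivative i f) p"
      using second_difference_mean_value[of x d f i h j] d1 d2 sub h by blast
    obtain q where q: "q \<in> ball x d"
      "f (x + h *\<^sub>R axis j 1 + h *\<^sub>R axis i 1) - f (x + h *\<^sub>R axis j 1) - f (x + h *\<^sub>R axis i 1) + f x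
        = h\<^sup>2 * pderivative i (pderivative j f) q"
      using second_difference_mean_value[of x d f j h i] d1 d2 sub h by blast
    have comm: "x + h *\<^sub>R axis j 1 + h *\<^sub>R axis i 1 = x + h *\<^sub>R axis i 1 + h *\<^sub>R axis j 1" by simp
    have "h\<^sup>2 * pderivative j (pderivative i f) p = h\<^sup>2 * pderivative i (pderivative j f) q"
      using p(2) q(2)[unfolded comm] by linarith
    then have "pderivative j (pderivative i f) p = pderivative i (pderivative j f) q" using h by simp
    moreover have "dist (pderivative j (pderivative i f) p) (pderivative j (pderivative i f) x) < e"
      using d1'(2)[of p] p(1) by (simp add: d_def dist_commute)
    moreover have "dist (pderivative i (pderivative j f) q) (pderivative i (pderivative j f) x) < e"
      using d2'(2)[of q] q(1) by (simp add: d_def dist_commute)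
    ultimately show ?thesis by (simp add: dist_real_def)
  qed
  note small = this
  show ?thesis
  proof (rule ccontr)
    assume "\<not> ?thesis"
    then show False
      using small[of "\<bar>pderivative j (pderivative i f) x - pderivative i (pderivative j f) x\<bar> / 3"] by simp
  qed
qed

section \<open>Averages of fields without divergence and rotation\<close>

lemma axis_line_has_real_derivative:
  assumes "f differentiable (at (x + t *\<^sub>R axis j 1))"
  shows "((\<lambda>s. f (x + s *\<^sub>R axis j 1)) has_real_derivative pderivative j f (x + t *\<^sub>R axis j 1)) (at t)"
  using line_has_real_derivative[OF assms] by (simp add: grad_def inner_axis)

text \<open>The components of a \<open>C\<^sup>1\<close> field without divergence and rotation are harmonic. Since they need not
  be known to be twice differentiable, the maximum principle is applied to their averages over a
  segment of length \<open>t\<close>.\<close>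

lemma segment_average_axis_harmonic:
  fixes F :: "real^3 \<Rightarrow> real^3"
  assumes "open R"
    and seg: "\<And>y s. y \<in> R \<Longrightarrow> 0 \<le> s \<Longrightarrow> s \<le> t \<Longrightarrow> y + s *\<^sub>R axis i 1 \<in> \<Omega>"
    and diff: "\<And>y k. y \<in> \<Omega> \<Longrightarrow> (\<lambda>y. F y $ k) differentiable (at y)"
    and cont: "\<And>k l. continuous_on \<Omega> (pderivative l (\<lambda>y. F y $ k))"
    and curl: "\<And>y k l. y \<in> \<Omega> \<Longrightarrow> pderivative l (\<lambda>y. F y $ k) y = pderivative k (\<lambda>y. F y $ l) y"
    and div: "\<And>y. y \<in> \<Omega> \<Longrightarrow> divg F y = 0"
    and t: "t > 0" and x: "x \<in> R"
  shows "axis_harmonic_at (\<lambda>y. integral {0..t} (\<lambda>s. F (y + s *\<^sub>R axis i 1) $ i)) x"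
proof -
  let ?q = "\<lambda>y. integral {0..t} (\<lambda>s. F (y + s *\<^sub>R axis i 1) $ i)"
  \<comment> \<open>Differentiating under the integral gives the integral of the
    \<open>j\<close>-derivative of component \<open>i\<close>. Symmetry of the Jacobian makes it an
    \<open>i\<close>-derivative of component \<open>j\<close>, which integrates along the segment to
    this difference of end values. One further derivative of \<open>F\<close> then suffices for the
    second derivatives of the average.\<close>
  define u' where "u' j \<tau> = F (x + t *\<^sub>R axis i 1 + \<tau> *\<^sub>R axis j 1) $ j - F (x + \<tau> *\<^sub>R axis j 1) $ j" for j \<tau>
  have contF: "continuous_on \<Omega> (\<lambda>y. F y $ k)" for k
    using diff by (intro continuous_at_imp_continuous_on) (auto intro: differentiable_imp_continuous_within)
  have R\<Omega>: "y \<in> \<Omega>" if "y \<in> R" for y using seg[OF that, of 0] t by simp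
  obtain r where r: "r > 0" "ball x r \<subseteq> R" using assms(1) x open_contains_ball by blast
  have inR: "x + \<tau> *\<^sub>R axis j 1 \<in> R" if "\<tau> \<in> {-r<..<r}" for \<tau> j
    using that r(2) by (auto simp: dist_norm intro!: subsetD[OF r(2)])
  have q': "((\<lambda>\<tau>. ?q (x + \<tau> *\<^sub>R axis j 1)) has_real_derivative u' j \<tau>) (at \<tau>)" if \<tau>: "\<tau> \<in> {-r<..<r}" for j \<tau>
  proof -
    let ?U = "{-r<..<r}"
    have shift: "x + \<tau>' *\<^sub>R axis j 1 + s *\<^sub>R axis i 1 \<in> \<Omega>" if "\<tau>' \<in> ?U" "s \<in> {0..t}" for \<tau>' s
      using seg[OF inR[OF that(1)]] that(2) by simp
    have "((\<lambda>\<tau>. integral (cbox 0 t) (\<lambda>s. F (x + \<tau> *\<^sub>R axis j 1 + s *\<^sub>R axis i 1) $ i)) has_real_derivative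
       integral (cbox 0 t) (\<lambda>s. pderivative j (\<lambda>y. F y $ i) (x + \<tau> *\<^sub>R axis j 1 + s *\<^sub>R axis i 1))) (at \<tau> within ?U)"
    proof (rule leibniz_rule_field_derivative)
      fix \<tau>' s assume ts: "\<tau>' \<in> ?U" "s \<in> cbox 0 t"
      have eq: "x + s *\<^sub>R axis i 1 + \<tau>' *\<^sub>R axis j 1 = x + \<tau>' *\<^sub>R axis j 1 + s *\<^sub>R axis i 1" by simp
      have "(\<lambda>y. F y $ i) differentiable (at ((x + s *\<^sub>R axis i 1) + \<tau>' *\<^sub>R axis j 1))"
        unfolding eq using ts by (intro diff shift) auto
      from axis_line_has_real_derivative[OF this]
      have "((\<lambda>\<tau>. F (x + \<tau> *\<^sub>R axis j 1 + s *\<^sub>R axis i 1) $ i) has_real_derivative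
        pderivative j (\<lambda>y. F y $ i) (x + \<tau>' *\<^sub>R axis j 1 + s *\<^sub>R axis i 1)) (at \<tau>')"
        by (simp add: add_ac)
      then show "((\<lambda>\<tau>. F (x + \<tau> *\<^sub>R axis j 1 + s *\<^sub>R axis i 1) $ i) has_real_derivative
        pderivative j (\<lambda>y. F y $ i) (x + \<tau>' *\<^sub>R axis j 1 + s *\<^sub>R axis i 1)) (at \<tau>' within ?U)"
        by (rule has_field_derivative_at_within)
    next
      fix \<tau>' assume "\<tau>' \<in> ?U"
      then show "(\<lambda>s. F (x + \<tau>' *\<^sub>R axis j 1 + s *\<^sub>R axis i 1) $ i) integrable_on cbox 0 t"
        by (intro integrable_continuous continuous_on_compose2[OF contF]) (auto intro!: continuous_intros shift)
    next
      show "continuous_on (?U \<times> cbox 0 t) (\<lambda>(\<tau>, s). pderivative j (\<lambda>y. F y $ i) (x + \<tau> *\<^sub>R axis j 1 + s *\<^sub>R axis i 1))"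
        unfolding case_prod_beta
        by (intro continuous_on_compose2[OF cont]) (auto intro!: continuous_intros shift)
    qed (use \<tau> in auto)
    moreover have "integral (cbox 0 t) (\<lambda>s. pderivative j (\<lambda>y. F y $ i) (x + \<tau> *\<^sub>R axis j 1 + s *\<^sub>R axis i 1)) =
      integral (cbox 0 t) (\<lambda>s. pderivative i (\<lambda>y. F y $ j) (x + \<tau> *\<^sub>R axis j 1 + s *\<^sub>R axis i 1))"
      using shift[OF \<tau>] curl by (intro integral_cong) simp
    moreover have "((\<lambda>s. pderivative i (\<lambda>y. F y $ j) (x + \<tau> *\<^sub>R axis j 1 + s *\<^sub>R axis i 1)) has_integral
       F (x + \<tau> *\<^sub>R axis j 1 + t *\<^sub>R axis i 1) $ j - F (x + \<tau> *\<^sub>R axis j 1 + 0 *\<^sub>R axis i 1) $ j) {0..t}"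
      using t shift[OF \<tau>] diff
      by (intro fundamental_theorem_of_calculus)
        (auto simp flip: has_real_derivative_iff_has_vector_derivative
          intro!: has_field_derivative_at_within[OF axis_line_has_real_derivative])
    ultimately have "((\<lambda>\<tau>. ?q (x + \<tau> *\<^sub>R axis j 1)) has_real_derivative u' j \<tau>) (at \<tau> within ?U)"
      by (simp add: u'_def integral_unique add_ac)
    then show ?thesis using \<tau> by (simp add: at_within_open[of \<tau> ?U])
  qed
  have ev: "\<forall>\<^sub>F \<tau> in nhds 0. \<tau> \<in> {-r<..<r}"
    using r(1) by (intro eventually_nhds_in_open) auto
  define u'' where "u'' j = pderivative j (\<lambda>y. F y $ j) (x + t *\<^sub>R axis i 1) - pderivative j (\<lambda>y. F y $ j) x" for j
  have xt: "x + t *\<^sub>R axis i 1 \<in> \<Omega>" using seg[OF x, of t] t by simp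
  have "(u' j has_real_derivative u'' j) (at 0)" for j
    unfolding u'_def[abs_def] u''_def
    using axis_line_has_real_derivative[of "\<lambda>y. F y $ j" "x + t *\<^sub>R axis i 1" 0 j]
      axis_line_has_real_derivative[of "\<lambda>y. F y $ j" x 0 j] diff[OF xt] diff[OF R\<Omega>[OF x]]
    by (auto intro!: DERIV_diff)
  \<comment> \<open>The second derivatives add up to the divergence at one end of the segment minus
    that at the other.\<close>
  moreover have "(\<Sum>j\<in>UNIV. u'' j) = 0"
    using div[OF xt] div[OF R\<Omega>[OF x]] by (simp add: u''_def sum_subtractf divg_def)
  moreover have "\<forall>\<^sub>F \<tau> in nhds 0. ((\<lambda>\<tau>. ?q (x + \<tau> *\<^sub>R axis j 1)) has_real_derivative u' j \<tau>) (at \<tau>)" for j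
    using ev by eventually_elim (rule q')
  ultimately show ?thesis unfolding axis_harmonic_at_def by blast
qed

text \<open>Averages make sense where a whole segment fits, so the maximum principle is used on the
  inner parallel set \<open>R\<close> of points farther than \<open>t\<close> from the complement.
  At its frontier a zero of \<open>F\<close> is at distance \<open>t\<close>, which makes the
  averages small; at \<open>x\<close> the average is close to \<open>t * F x $ i\<close>.\<close>

lemma curl_div_free_zero:
  fixes F :: "real^3 \<Rightarrow> real^3"
  assumes \<Omega>: "open \<Omega>" "bounded \<Omega>" and contF: "continuous_on (closure \<Omega>) F"
    and diff: "\<And>y k. y \<in> \<Omega> \<Longrightarrow> (\<lambda>y. F y $ k) differentiable (at y)"
    and cont: "\<And>k l. continuous_on \<Omega> (pderivative l (\<lambda>y. F y $ k))"
    and curl: "\<And>y k l. y \<in> \<Omega> \<Longrightarrow> pderivative l (\<lambda>y. F y $ k) y = pderivative k (\<lambda>y. F y $ l) y"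
    and div: "\<And>y. y \<in> \<Omega> \<Longrightarrow> divg F y = 0"
    and bd: "\<And>z. z \<in> frontier \<Omega> \<Longrightarrow> F z = 0"
    and x: "x \<in> \<Omega>"
  shows "F x = 0"
proof (rule ccontr)
  assume "F x \<noteq> 0"
  then obtain i where i: "F x $ i \<noteq> 0" by (auto simp: vec_eq_iff)
  \<comment> \<open>The two estimates at \<open>x\<close> add up to
    \<open>\<bar>F x $ i\<bar> \<le> 2 * e\<close>, which contradicts
    \<open>4 * e = \<bar>F x $ i\<bar>\<close>.\<close>
  define e where "e = \<bar>F x $ i\<bar> / 4"
  have e: "e > 0" using i by (simp add: e_def)
  have "uniformly_continuous_on (closure \<Omega>) F"
    using \<Omega>(2) contF by (intro compact_uniformly_continuous) auto
  then obtain d where d: "d > 0" "\<And>y z. y \<in> closure \<Omega> \<Longrightarrow> z \<in> closure \<Omega> \<Longrightarrow> dist z y < d \<Longrightarrow> dist (F z) (F y) < e"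
    using e unfolding uniformly_continuous_on_def by metis
  have ne: "- \<Omega> \<noteq> {}"
  proof
    assume "- \<Omega> = {}"
    then have "\<Omega> = UNIV" by blast
    then show False using \<Omega>(2) not_bounded_UNIV by simp
  qed
  have clo: "closed (- \<Omega>)" using \<Omega>(1) by (simp add: closed_def)
  define \<delta> where "\<delta> y = infdist y (- \<Omega>)" for y
  have "\<delta> x > 0" unfolding \<delta>_def using infdist_pos_not_in_closed[OF clo ne] x by auto
  \<comment> \<open>\<open>t < \<delta> x\<close> puts \<open>x\<close> into \<open>R\<close>. The
    bound \<open>2 * t < d\<close> covers the way from a point of the segment to its start and on to
    a nearest boundary zero.\<close>
  define t where "t = min (\<delta> x) d / 4"
  have t: "0 < t" "t < \<delta> x" "2 * t < d" using \<open>\<delta> x > 0\<close> d(1) by (auto simp: t_def)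
  define R where "R = {y. t < \<delta> y}"
  have cont\<delta>: "continuous_on UNIV \<delta>" unfolding \<delta>_def by (intro continuous_intros)
  have R: "open R" unfolding R_def by (intro open_Collect_less cont\<delta> continuous_on_const)
  have "closed {y. t \<le> \<delta> y}" by (intro closed_Collect_le cont\<delta> continuous_on_const)
  then have clR: "closure R \<subseteq> {y. t \<le> \<delta> y}" by (intro closure_minimal) (auto simp: R_def)
  have near: "z \<in> \<Omega>" if "dist y z < \<delta> y" for y z
    using that infdist_le[of z "- \<Omega>" y] by (auto simp: \<delta>_def)
  have R\<Omega>: "R \<subseteq> \<Omega>" using near[of y y for y] t by (auto simp: R_def)
  \<comment> \<open>Segments starting on \<open>closure R\<close> may end on the boundary of
    \<open>\<Omega>\<close>; they stay in \<open>closure \<Omega>\<close>, where \<open>F\<close> is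
    still continuous.\<close>
  have cball: "cball y t \<subseteq> closure \<Omega>" if "y \<in> closure R" for y
  proof -
    have "t \<le> \<delta> y" using clR that by blast
    then have "ball y t \<subseteq> \<Omega>" by (intro subsetI near[of y]) auto
    then have "closure (ball y t) \<subseteq> closure \<Omega>" by (rule closure_mono)
    then show ?thesis using t by simp
  qed
  have segcl: "y + s *\<^sub>R axis i 1 \<in> cball y t" if "0 \<le> s" "s \<le> t" for y :: "real^3" and s
    using that by (simp add: dist_norm)
  have segcl\<Omega>: "y + s *\<^sub>R axis i 1 \<in> closure \<Omega>" if "y \<in> closure R" "0 \<le> s" "s \<le> t" for y s
    using cball[OF that(1)] segcl[OF that(2,3)] by blast
  have seg: "y + s *\<^sub>R axis i 1 \<in> \<Omega>" if "y \<in> R" "0 \<le> s" "s \<le> t" for y s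
    using that by (intro near[of y]) (auto simp: R_def dist_norm)
  define q where "q y = integral {0..t} (\<lambda>s. F (y + s *\<^sub>R axis i 1) $ i)" for y
  have contq: "continuous_on (closure R) q"
    unfolding q_def cbox_interval[symmetric]
    by (rule integral_continuous_on_param, unfold case_prod_beta, rule continuous_on_component,
        rule continuous_on_compose2[OF contF]) (use segcl\<Omega> in \<open>auto intro!: continuous_intros\<close>)
  have integrable: "(\<lambda>s. F (y + s *\<^sub>R axis i 1) $ i) integrable_on {0..t}" if "y \<in> closure R" for y
    by (rule integrable_continuous_real, rule continuous_on_component,
        rule continuous_on_compose2[OF contF]) (use segcl\<Omega>[OF that] in \<open>auto intro!: continuous_intros\<close>)
  have est: "\<bar>q y - t * c\<bar> \<le> t * e"
    if y: "y \<in> closure R" and c: "\<And>s. 0 \<le> s \<Longrightarrow> s \<le> t \<Longrightarrow> \<bar>F (y + s *\<^sub>R axis i 1) $ i - c\<bar> \<le> e" for y c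
  proof -
    have "((\<lambda>s. F (y + s *\<^sub>R axis i 1) $ i - c) has_integral (q y - t * c)) {0..t}"
      using has_integral_diff[OF integrable_integral[OF integrable[OF y]] has_integral_const_real[of c 0 t]] t(1)
      by (simp add: q_def)
    from has_integral_bound_real[OF _ finite.emptyI this, of e] show ?thesis
      using c e t(1) by (simp add: mult.commute)
  qed
  have small: "\<bar>q y\<bar> \<le> t * e" if y: "y \<in> frontier R" for y
  proof -
    have yc: "y \<in> closure R" "y \<notin> R" using y R by (auto simp: frontier_def interior_open)
    then have "\<delta> y = t" using clR by (auto simp: R_def)
    obtain z where z: "z \<in> - \<Omega>" "\<delta> y = dist y z"
      unfolding \<delta>_def using infdist_attains_inf[OF clo ne] by metis
    have "z \<in> cball y t" using z \<open>\<delta> y = t\<close> by simp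
    then have zc: "z \<in> closure \<Omega>" using cball[OF yc(1)] by blast
    then have "F z = 0" using z(1) \<Omega>(1) by (intro bd) (simp add: frontier_def interior_open)
    have "\<bar>q y - t * 0\<bar> \<le> t * e"
    proof (rule est[OF yc(1)])
      fix s assume s: "0 \<le> s" "s \<le> t"
      have "dist (y + s *\<^sub>R axis i 1) z \<le> dist (y + s *\<^sub>R axis i 1) y + dist y z" by (rule dist_triangle)
      also have "\<dots> < d" using s t z \<open>\<delta> y = t\<close> by (simp add: dist_norm)
      finally have "dist (F (y + s *\<^sub>R axis i 1)) (F z) < e"
        by (intro d(2)[OF zc segcl\<Omega>[OF yc(1) s]])
      then have "norm (F (y + s *\<^sub>R axis i 1)) < e" using \<open>F z = 0\<close> by simp
      then show "\<bar>F (y + s *\<^sub>R axis i 1) $ i - 0\<bar> \<le> e"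
        using component_le_norm_cart[of "F (y + s *\<^sub>R axis i 1)" i] by simp
    qed
    then show ?thesis by simp
  qed
  have harm: "axis_harmonic_at q y" if "y \<in> R" for y
    unfolding q_def by (rule segment_average_axis_harmonic[OF R seg diff cont curl div t(1) that])
  have bR: "bounded R" using R\<Omega> \<Omega>(2) bounded_subset by blast
  have xR: "x \<in> R" using t by (simp add: R_def)
  have "q x \<le> t * e"
    by (rule axis_harmonic_max_principle[OF R bR contq harm _ xR]) (use small in \<open>auto simp: abs_le_iff\<close>)
  moreover have "- q x \<le> t * e"
    by (rule axis_harmonic_max_principle[where u="\<lambda>x. - q x", OF R bR _ _ _ xR])
      (use small harm contq in \<open>auto simp: abs_le_iff intro: axis_harmonic_at_minus continuous_intros\<close>)
  ultimately have 1: "\<bar>q x\<bar> \<le> t * e" by simp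
  have 2: "\<bar>q x - t * F x $ i\<bar> \<le> t * e"
  proof (rule est)
    show "x \<in> closure R" using xR closure_subset by blast
    fix s assume s: "0 \<le> s" "s \<le> t"
    have "dist (F (x + s *\<^sub>R axis i 1)) (F x) < e"
      using seg[OF xR s] x closure_subset[of \<Omega>] s t by (intro d(2)) (auto simp: dist_norm)
    then show "\<bar>F (x + s *\<^sub>R axis i 1) $ i - F x $ i\<bar> \<le> e"
      using component_le_norm_cart[of "F (x + s *\<^sub>R axis i 1) - F x" i] by (simp add: dist_norm)
  qed
  have "t * \<bar>F x $ i\<bar> = \<bar>t * F x $ i\<bar>" using t by (simp add: abs_mult)
  also have "\<dots> \<le> \<bar>q x\<bar> + \<bar>q x - t * F x $ i\<bar>" by linarith
  also have "\<dots> \<le> t * (2 * e)" using 1 2 by simp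
  finally have "\<bar>F x $ i\<bar> \<le> 2 * e" using t by simp
  then show False using e by (simp add: e_def)
qed

section \<open>Densities on a domain and its boundary\<close>

lemma set_integrable_bounded_continuous:
  fixes f :: "'a::topological_space \<Rightarrow> real"
  assumes M: "sets M = sets borel" and A: "A \<in> sets borel" "emeasure M A < \<infinity>"
    and f: "continuous_on A f" "\<And>x. x \<in> A \<Longrightarrow> \<bar>f x\<bar> \<le> C"
  shows "set_integrable M A f"
  unfolding set_integrable_def
proof (rule integrableI_bounded_set)
  show "(\<lambda>x. indicator A x *\<^sub>R f x) \<in> borel_measurable M"
    using borel_measurable_continuous_on_indicator[OF A(1) f(1)] M by (simp cong: measurable_cong_sets)
  show "AE x in M. x \<in> A \<longrightarrow> norm (indicator A x *\<^sub>R f x) \<le> C" using f(2) by simp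
qed (use A M in auto)

lemma set_integral_pos:
  fixes g :: "'a \<Rightarrow> real"
  assumes "set_integrable M A g" "\<And>x. x \<in> A \<Longrightarrow> 0 \<le> g x"
    and V: "V \<in> sets M" "V \<subseteq> A" "emeasure M V > 0" "\<And>x. x \<in> V \<Longrightarrow> 0 < g x"
  shows "0 < (LINT x:A|M. g x)"
proof -
  have nonneg: "0 \<le> indicator A x *\<^sub>R g x" for x using assms(2) by (simp add: indicator_def)
  then have "0 \<le> (LINT x:A|M. g x)" unfolding set_lebesgue_integral_def by (intro integral_nonneg_AE) simp
  moreover have "(LINT x:A|M. g x) \<noteq> 0"
  proof
    assume "(LINT x:A|M. g x) = 0"
    then have "AE x in M. indicator A x *\<^sub>R g x = 0"
      using integral_nonneg_eq_0_iff_AE[of M "\<lambda>x. indicator A x *\<^sub>R g x"] assms(1) nonneg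
      by (simp add: set_lebesgue_integral_def set_integrable_def)
    then have "AE x in M. x \<notin> V"
    proof eventually_elim
      case (elim x)
      show ?case
      proof
        assume "x \<in> V"
        with V(2) V(4)[OF \<open>x \<in> V\<close>] elim show False by (auto simp: indicator_def)
      qed
    qed
    then have "emeasure M V = 0" using V(1) by (simp add: AE_iff_null_sets null_setsD1)
    with V(3) show False by simp
  qed
  ultimately show ?thesis by simp
qed

lemma emeasure_area_measure_singleton: "emeasure area_measure {x} = 0"
  by (simp add: emeasure_area_measure area_outer_subsingleton)

definition surface_volume_functional ::
  "(real^3) set \<Rightarrow> (real^3 \<Rightarrow> real) \<Rightarrow> (real^3 \<Rightarrow> real) \<Rightarrow> (real^3 \<Rightarrow> real) \<Rightarrow> real" where
  "surface_volume_functional \<Omega> f h \<psi> =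
     (LINT z:frontier \<Omega>|area_measure. \<psi> z * f z) + (LINT x:\<Omega>|lborel. \<psi> x * h x)"

locale smooth_domain =
  fixes \<Omega> :: "(real^3) set"
  assumes open_domain: "open \<Omega>" and bounded_domain: "bounded \<Omega>" and smooth_boundary: "smooth_boundary \<Omega>"
begin

lemma compact_frontier: "compact (frontier \<Omega>)"
  using bounded_domain by (rule compact_frontier_bounded)

lemma frontier_subset_closure: "frontier \<Omega> \<subseteq> closure \<Omega>" by (simp add: frontier_def)

lemma frontier_disjoint: "z \<in> frontier \<Omega> \<Longrightarrow> z \<notin> \<Omega>"
  using open_domain by (simp add: frontier_def interior_open)

lemma emeasure_frontier: "emeasure area_measure (frontier \<Omega>) < \<infinity>"
  using area_outer_frontier_finite[OF open_domain bounded_domain smooth_boundary]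
  by (simp add: emeasure_area_measure)

lemma emeasure_domain: "emeasure lborel \<Omega> < \<infinity>"
  using emeasure_bounded_finite[OF bounded_domain] .

lemma compact_bounded_function:
  fixes f :: "real^3 \<Rightarrow> 'b::real_normed_vector"
  assumes "compact S" "continuous_on S f"
  obtains C where "0 \<le> C" "\<And>x. x \<in> S \<Longrightarrow> norm (f x) \<le> C"
proof -
  have "bounded (f ` S)" using assms by (intro compact_imp_bounded compact_continuous_image)
  then obtain C where "C > 0" "\<forall>y\<in>f ` S. norm y \<le> C" unfolding bounded_pos by blast
  then show ?thesis using that[of C] by simp
qed

lemma surface_integrable:
  fixes f :: "real^3 \<Rightarrow> real"
  assumes "continuous_on (frontier \<Omega>) f" shows "set_integrable area_measure (frontier \<Omega>) f"
proof -
  obtain C where "\<And>x. x \<in> frontier \<Omega> \<Longrightarrow> norm (f x) \<le> C"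
    using compact_bounded_function[OF compact_frontier assms] by blast
  then show ?thesis
    using assms emeasure_frontier by (intro set_integrable_bounded_continuous[where C=C]) auto
qed

lemma volume_integrable:
  fixes \<psi> h :: "real^3 \<Rightarrow> real"
  assumes "continuous_on UNIV \<psi>" "continuous_on \<Omega> h" "bounded (h ` \<Omega>)"
  shows "set_integrable lborel \<Omega> (\<lambda>x. \<psi> x * h x)"
proof -
  obtain C where C: "0 \<le> C" "\<And>x. x \<in> closure \<Omega> \<Longrightarrow> norm (\<psi> x) \<le> C"
    using compact_bounded_function[of "closure \<Omega>" \<psi>] bounded_domain continuous_on_subset[OF assms(1)]
    by (metis compact_closure subset_UNIV)
  obtain H where H: "\<And>x. x \<in> \<Omega> \<Longrightarrow> \<bar>h x\<bar> \<le> H" using assms(3) by (auto simp: bounded_real)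
  have "\<bar>\<psi> x * h x\<bar> \<le> C * H" if "x \<in> \<Omega>" for x
    unfolding abs_mult using C H[OF that] that closure_subset[of \<Omega>] by (intro mult_mono) auto
  then show ?thesis
    using open_domain emeasure_domain assms(2) continuous_on_subset[OF assms(1)]
    by (intro set_integrable_bounded_continuous[where C="C * H"] continuous_on_mult) auto
qed

lemma surface_density_integrable:
  fixes \<psi> f :: "real^3 \<Rightarrow> real"
  assumes "continuous_on UNIV \<psi>" "continuous_on (frontier \<Omega>) f"
  shows "set_integrable area_measure (frontier \<Omega>) (\<lambda>x. \<psi> x * f x)"
  by (intro surface_integrable continuous_on_mult assms continuous_on_subset[OF assms(1)] subset_UNIV)

context
  fixes f h :: "real^3 \<Rightarrow> real"
  assumes f: "continuous_on (frontier \<Omega>) f" and h: "continuous_on \<Omega> h" "bounded (h ` \<Omega>)"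
begin

lemma compact_functional_surface_volume:
  "\<exists>C. compact_functional (surface_volume_functional \<Omega> f h) (closure \<Omega>) C"
proof -
  obtain F where F: "0 \<le> F" "\<And>x. x \<in> frontier \<Omega> \<Longrightarrow> norm (f x) \<le> F"
    using compact_bounded_function[OF compact_frontier f] by blast
  obtain H0 where H0: "\<And>x. x \<in> \<Omega> \<Longrightarrow> \<bar>h x\<bar> \<le> H0" using h(2) by (auto simp: bounded_real)
  define H where "H = max H0 0"
  have H: "0 \<le> H" "\<And>x. x \<in> \<Omega> \<Longrightarrow> \<bar>h x\<bar> \<le> H" using H0 by (auto simp: H_def max.coboundedI1)
  note fi = surface_density_integrable[OF _ f] and hi = volume_integrable[OF _ h]
  let ?a = "measure area_measure (frontier \<Omega>)" and ?v = "measure lborel \<Omega>"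
  have est: "\<bar>LINT x:A|M. \<psi> x * g x\<bar> \<le> measure M A * (G * e)"
    if M: "A \<in> sets M" "emeasure M A < \<infinity>" "set_integrable M A (\<lambda>x. \<psi> x * g x)"
      and b: "\<And>x. x \<in> A \<Longrightarrow> \<bar>g x\<bar> \<le> G" "\<And>x. x \<in> A \<Longrightarrow> \<bar>\<psi> x\<bar> \<le> e" "0 \<le> G" "0 \<le> e"
    for M A and \<psi> g :: "real^3 \<Rightarrow> real" and G e :: real
  proof -
    have "\<bar>LINT x:A|M. \<psi> x * g x\<bar> \<le> (LINT x|M. norm (indicator A x *\<^sub>R (\<psi> x * g x)))"
      unfolding set_lebesgue_integral_def real_norm_def[symmetric] by (rule integral_norm_bound)
    also have "\<dots> \<le> (LINT x|M. indicator A x * (G * e))"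
    proof (rule integral_mono)
      show "integrable M (\<lambda>x. norm (indicator A x *\<^sub>R (\<psi> x * g x)))"
        using M(3) by (intro integrable_norm) (simp add: set_integrable_def)
      show "integrable M (\<lambda>x. indicator A x * (G * e))"
        using M(1,2) by (intro integrable_mult_left) simp
      fix x
      show "norm (indicator A x *\<^sub>R (\<psi> x * g x)) \<le> indicator A x * (G * e)"
        using mult_mono[OF b(1) b(2), of x x] b(3,4) by (auto simp: indicator_def abs_mult mult.commute)
    qed
    also have "\<dots> = measure M A * (G * e)" using M(1,2) by simp
    finally show ?thesis .
  qed
  have "compact_functional (surface_volume_functional \<Omega> f h) (closure \<Omega>) (?a * F + ?v * H)"
  proof
    show "compact (closure \<Omega>)" using bounded_domain by simp
    show "surface_volume_functional \<Omega> f h (\<lambda>x. \<psi> x + \<phi> x) =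
       surface_volume_functional \<Omega> f h \<psi> + surface_volume_functional \<Omega> f h \<phi>"
      if "continuous_on UNIV \<psi>" "continuous_on UNIV \<phi>" for \<psi> \<phi>
      using fi[OF that(1)] fi[OF that(2)] hi[OF that(1)] hi[OF that(2)]
      by (simp add: surface_volume_functional_def distrib_right set_integral_add)
    show "surface_volume_functional \<Omega> f h (\<lambda>x. a * \<psi> x) = a * surface_volume_functional \<Omega> f h \<psi>" for a \<psi>
      by (simp add: surface_volume_functional_def mult.assoc distrib_left)
    fix \<psi> :: "real^3 \<Rightarrow> real" and e :: real
    assume \<psi>: "continuous_on UNIV \<psi>" "\<And>x. x \<in> closure \<Omega> \<Longrightarrow> \<bar>\<psi> x\<bar> \<le> e" "0 \<le> e"
    have "\<bar>LINT z:frontier \<Omega>|area_measure. \<psi> z * f z\<bar> \<le> ?a * (F * e)"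
      by (rule est[OF _ emeasure_frontier fi[OF \<psi>(1)]]) (use F \<psi> frontier_subset_closure in auto)
    moreover have "\<bar>LINT x:\<Omega>|lborel. \<psi> x * h x\<bar> \<le> ?v * (H * e)"
      by (rule est[OF _ emeasure_domain hi[OF \<psi>(1)]]) (use H \<psi> open_domain closure_subset[of \<Omega>] in auto)
    ultimately show "\<bar>surface_volume_functional \<Omega> f h \<psi>\<bar> \<le> (?a * F + ?v * H) * e"
      unfolding surface_volume_functional_def distrib_right mult.assoc
      by (intro order_trans[OF abs_triangle_ineq] add_mono)
  qed
  then show ?thesis by blast
qed

text \<open>The volume density is treated first, with balls that stay inside \<open>\<Omega>\<close>
  and so miss the surface term. Once it vanishes, balls centred on the boundary see only the surface
  density.\<close>

lemma densities_zero:
  assumes bump: "\<And>x r. surface_volume_functional \<Omega> f h (\<lambda>y. max 0 (r\<^sup>2 - (dist x y)\<^sup>2)) = 0"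
  shows "\<And>x. x \<in> \<Omega> \<Longrightarrow> h x = 0" and "\<And>z. z \<in> frontier \<Omega> \<Longrightarrow> f z = 0"
proof -
  let ?\<psi> = "\<lambda>x r y. max 0 (r\<^sup>2 - (dist x y)\<^sup>2) :: real"
  have \<psi>c: "continuous_on UNIV (?\<psi> x r)" for x r by (intro continuous_intros)
  have \<psi>pos: "?\<psi> x r y > 0" if "y \<in> ball x r" for x y r
    using that by (auto simp: less_max_iff_disj intro!: power_strict_mono)
  have \<psi>0: "?\<psi> x r y = 0" if "y \<notin> ball x r" "r > 0" for x y r
    using that by (auto simp: max_def not_less intro!: antisym power_mono)
  \<comment> \<open>One argument for both measures: a continuous density has constant sign near a
    point where it is nonzero, and multiplying by that sign makes its integral against a small bump
    strictly positive, as the measure charges every neighbourhood of the point.\<close>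
  have local: False
    if M: "sets M = sets borel" and A: "A \<in> sets borel" and pos: "\<And>r. r > 0 \<Longrightarrow> emeasure M (A \<inter> ball x r) > 0"
      and x: "x \<in> A" "g x \<noteq> 0" and g: "continuous_on A g" and \<rho>: "\<rho> > 0"
      and int: "\<And>r. set_integrable M A (\<lambda>y. ?\<psi> x r y * g y)"
      and zero: "\<And>r. 0 < r \<Longrightarrow> r < \<rho> \<Longrightarrow> (LINT y:A|M. ?\<psi> x r y * g y) = 0"
    for M :: "(real^3) measure" and A x g \<rho>
  proof -
    obtain d where d: "d > 0" "\<And>y. y \<in> A \<Longrightarrow> dist y x < d \<Longrightarrow> dist (g y) (g x) < \<bar>g x\<bar>"
      using g x unfolding continuous_on_iff by (metis zero_less_abs_iff)
    define r where "r = min d \<rho> / 2"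
    have r: "0 < r" "r < \<rho>" "r < d" using d(1) \<rho> by (auto simp: r_def)
    have sgn: "0 < g y * sgn (g x)" if "y \<in> A \<inter> ball x r" for y
    proof -
      have "\<bar>g y - g x\<bar> < \<bar>g x\<bar>" using d(2)[of y] that r by (auto simp: dist_real_def dist_commute)
      then show ?thesis by (auto simp: sgn_real_def abs_if split: if_splits)
    qed
    have "0 < (LINT y:A|M. ?\<psi> x r y * g y * sgn (g x))"
    proof (rule set_integral_pos[where V="A \<inter> ball x r"])
      show "set_integrable M A (\<lambda>y. ?\<psi> x r y * g y * sgn (g x))"
        using int by (rule set_integrable_mult_left)
      show "0 \<le> ?\<psi> x r y * g y * sgn (g x)" if "y \<in> A" for y
      proof (cases "y \<in> ball x r")
        case True
        then show ?thesis using sgn[of y] that \<psi>pos[OF True] by (simp only: mult.assoc) (simp add: less_imp_le)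
      next
        case False
        then show ?thesis using \<psi>0[OF False r(1)] by simp
      qed
      show "0 < ?\<psi> x r y * g y * sgn (g x)" if "y \<in> A \<inter> ball x r" for y
        using \<psi>pos[of y x r] sgn[OF that] that by (simp only: mult.assoc) (rule mult_pos_pos, auto)
    qed (use pos[OF r(1)] A M in auto)
    then show False using zero[OF r(1,2)] by simp
  qed
  show h0: "h x = 0" if x: "x \<in> \<Omega>" for x
  proof (rule ccontr)
    assume hx: "h x \<noteq> 0"
    obtain \<rho> where \<rho>: "\<rho> > 0" "ball x \<rho> \<subseteq> \<Omega>" using open_domain x open_contains_ball by blast
    show False
    proof (rule local[OF _ _ _ x hx h(1) \<rho>(1)])
      show "sets lborel = sets (borel :: (real^3) measure)" by simp
      show "\<Omega> \<in> sets borel" using open_domain by simp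
      show "set_integrable lborel \<Omega> (\<lambda>y. ?\<psi> x r y * h y)" for r by (rule volume_integrable[OF \<psi>c h])
      show "0 < emeasure lborel (\<Omega> \<inter> ball x r)" if r: "r > 0" for r
      proof -
        have "0 < emeasure lborel (ball x (min r \<rho>))"
          using content_ball_pos[of "min r \<rho>" x] r \<rho>(1) by (simp add: measure_def enn2real_positive_iff)
        also have "\<dots> \<le> emeasure lborel (\<Omega> \<inter> ball x r)"
          using \<rho>(2) open_domain by (intro emeasure_mono) auto
        finally show ?thesis .
      qed
      show "(LINT y:\<Omega>|lborel. ?\<psi> x r y * h y) = 0" if r: "0 < r" "r < \<rho>" for r
      proof -
        have "z \<notin> ball x r" if "z \<in> frontier \<Omega>" for z
        proof
          assume "z \<in> ball x r"
          then have "z \<in> ball x \<rho>" using r by simp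
          then show False using frontier_disjoint[OF that] \<rho>(2) by blast
        qed
        then have "?\<psi> x r z = 0" if "z \<in> frontier \<Omega>" for z
          using that r by (intro \<psi>0) auto
        then have "(LINT z:frontier \<Omega>|area_measure. ?\<psi> x r z * f z) = (LINT z:frontier \<Omega>|area_measure. 0)"
          by (intro set_lebesgue_integral_cong) auto
        then show ?thesis using bump[of r x] by (simp add: surface_volume_functional_def)
      qed
    qed
  qed
  show "f z = 0" if z: "z \<in> frontier \<Omega>" for z
  proof (rule ccontr)
    assume fz: "f z \<noteq> 0"
    show False
    proof (rule local[OF _ _ _ z fz f zero_less_one])
      show "sets area_measure = sets (borel :: (real^3) measure)" by simp
      show "frontier \<Omega> \<in> sets borel" by simp
      show "set_integrable area_measure (frontier \<Omega>) (\<lambda>y. ?\<psi> z r y * f y)" for r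
        by (rule surface_density_integrable[OF \<psi>c f])
      show "0 < emeasure area_measure (frontier \<Omega> \<inter> ball z r)" if "r > 0" for r
        using area_outer_frontier_pos[OF open_domain smooth_boundary z that]
        by (simp add: emeasure_area_measure)
      show "(LINT y:frontier \<Omega>|area_measure. ?\<psi> z r y * f y) = 0" for r
      proof -
        have "(LINT x:\<Omega>|lborel. ?\<psi> z r x * h x) = (LINT x:\<Omega>|lborel. 0)"
          using h0 open_domain by (intro set_lebesgue_integral_cong) auto
        then show ?thesis using bump[of r z] by (simp add: surface_volume_functional_def)
      qed
    qed
  qed
qed

lemma densities_zero_of_moments:
  assumes R: "open R" "bounded R" "R \<noteq> {}"
    and van: "\<And>m y. y \<in> frontier R \<Longrightarrow> surface_volume_functional \<Omega> f h (\<lambda>x. (dist y x)\<^sup>2 ^ m) = 0"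
  shows "\<And>x. x \<in> \<Omega> \<Longrightarrow> h x = 0" and "\<And>z. z \<in> frontier \<Omega> \<Longrightarrow> f z = 0"
proof -
  obtain C where "compact_functional (surface_volume_functional \<Omega> f h) (closure \<Omega>) C"
    using compact_functional_surface_volume by blast
  then interpret compact_functional "surface_volume_functional \<Omega> f h" "closure \<Omega>" C .
  have "moment m x = 0" for m x
    by (rule moment_zero[OF R]) (simp add: moment_def van)
  then have bump: "surface_volume_functional \<Omega> f h (\<lambda>y. max 0 (r\<^sup>2 - (dist x y)\<^sup>2)) = 0" for x r
    by (intro radial_zero[where F="\<lambda>s. max 0 (r\<^sup>2 - s)"] continuous_intros)
  show "\<And>x. x \<in> \<Omega> \<Longrightarrow> h x = 0" by (rule densities_zero(1)[OF bump])
  show "\<And>z. z \<in> frontier \<Omega> \<Longrightarrow> f z = 0" by (rule densities_zero(2)[OF bump])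
qed

end

end

section \<open>Currents and their measuring functionals\<close>

lemma pderivative_eqI: "(f has_derivative D) (at x) \<Longrightarrow> pderivative i f x = D (axis i 1)"
  using frechet_derivative_at[of f D x] by (simp add: pderivative_def)

lemma pderivative_eq_grad: "pderivative i f x = grad f x $ i"
  by (simp add: grad_def)

text \<open>\<open>\<sigma>\<close> is prescribed on the closure only, so its own gradient at
  boundary points carries no information; \<open>k\<close> is the gradient of the smooth extension
  and supplies continuous boundary values.\<close>

lemma smooth_on_closed_grad:
  assumes "open \<Omega>" "smooth_on_closed \<sigma> (closure \<Omega>)"
  obtains k where "continuous_on (closure \<Omega>) k" "\<And>x. x \<in> \<Omega> \<Longrightarrow> \<sigma> differentiable (at x)"
    "\<And>x. x \<in> \<Omega> \<Longrightarrow> grad \<sigma> x = k x" "continuous_on (closure \<Omega>) \<sigma>"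
proof -
  obtain U g where g: "open U" "closure \<Omega> \<subseteq> U" "smooth_on g U" "\<And>x. x \<in> closure \<Omega> \<Longrightarrow> \<sigma> x = g x"
    using assms(2) unfolding smooth_on_closed_def by blast
  have eq: "\<sigma> x = g x" if "x \<in> \<Omega>" for x using g(4) that closure_subset by blast
  show ?thesis
  proof
    show "continuous_on (closure \<Omega>) (grad g)"
      using smooth_on_continuous_grad[OF g(3)] g(2) by (rule continuous_on_subset)
    have "continuous_on (closure \<Omega>) g"
      using smooth_on_continuous_on[OF g(3)] g(2) by (rule continuous_on_subset)
    then show "continuous_on (closure \<Omega>) \<sigma>" using g(4) by (simp cong: continuous_on_cong)
    fix x assume x: "x \<in> \<Omega>"
    then have "x \<in> U" using g(2) closure_subset by blast
    then have "(g has_derivative (\<lambda>v. grad g x \<bullet> v)) (at x)"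
      by (intro has_derivative_grad smooth_on_differentiable[OF g(3)])
    then have "(\<sigma> has_derivative (\<lambda>v. grad g x \<bullet> v)) (at x)"
      using has_derivative_transform_within_open[OF _ assms(1) x] eq by metis
    then show "\<sigma> differentiable (at x)" "grad \<sigma> x = grad g x"
      by (auto simp: differentiable_def intro: has_derivative_grad_eq)
  qed
qed

locale neumann_current = smooth_domain +
  fixes \<Omega>1 :: "(real^3) set" and \<sigma> I w :: "real^3 \<Rightarrow> real"
  assumes conductivity: "conductivity \<Omega> \<Omega>1 \<sigma>" and solution: "neumann_solution \<Omega> \<sigma> I w"
begin

abbreviation J :: "real^3 \<Rightarrow> real^3" where "J \<equiv> current \<Omega> \<sigma> w"

lemma smooth: "smooth_on_closed \<sigma> (closure \<Omega>)"
  using conductivity by (simp add: conductivity_def)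

lemma \<sigma>_pos: "x \<in> closure \<Omega> \<Longrightarrow> \<sigma> x > 0"
  using conductivity unfolding conductivity_def by (meson less_le_trans)

lemma \<sigma>_differentiable: "x \<in> \<Omega> \<Longrightarrow> \<sigma> differentiable (at x)"
  using smooth_on_closed_grad[OF open_domain smooth] by metis

lemma continuous_on_\<sigma>: "continuous_on (closure \<Omega>) \<sigma>"
  using smooth_on_closed_grad[OF open_domain smooth] by metis

lemma \<sigma>_frontier: "z \<in> frontier \<Omega> \<Longrightarrow> \<sigma> z = 1"
  using conductivity frontier_subset_closure unfolding conductivity_def by blast

lemma w_C2: "Ck_on 2 w \<Omega>" and continuous_on_closure_grad: "continuous_on (closure \<Omega>) (closure_grad \<Omega> w)"
  using solution by (simp_all add: neumann_solution_def)

lemma w_C1: "Ck_on (Suc 0) (pderivative k w) \<Omega>"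
  using Ck_on_Suc_grad[of "Suc 0" w \<Omega> "axis k 1"] w_C2
  by (simp only: pderivative_def[abs_def] numeral_2_eq_2)

lemma J_eq: "x \<in> \<Omega> \<Longrightarrow> J x = \<sigma> x *\<^sub>R grad w x"
  by (simp add: current_def closure_grad_def)

lemma J_component_has_derivative:
  assumes "x \<in> \<Omega>"
  shows "((\<lambda>y. J y $ k) has_derivative
     (\<lambda>v. \<sigma> x * (grad (pderivative k w) x \<bullet> v) + (grad \<sigma> x \<bullet> v) * pderivative k w x)) (at x)"
proof -
  have "((\<lambda>y. \<sigma> y * pderivative k w y) has_derivative
     (\<lambda>v. \<sigma> x * (grad (pderivative k w) x \<bullet> v) + (grad \<sigma> x \<bullet> v) * pderivative k w x)) (at x)"
    by (intro has_derivative_mult has_derivative_grad \<sigma>_differentiable[OF assms] Ck_on_SucD[OF w_C1 assms])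
  then show ?thesis
    by (rule has_derivative_transform_within_open[OF _ open_domain assms]) (simp add: J_eq pderivative_eq_grad)
qed

lemma J_component_differentiable: "x \<in> \<Omega> \<Longrightarrow> (\<lambda>y. J y $ k) differentiable (at x)"
  using J_component_has_derivative by (auto simp: differentiable_def)

lemma pderivative_J:
  "x \<in> \<Omega> \<Longrightarrow> pderivative l (\<lambda>y. J y $ k) x =
     \<sigma> x * pderivative l (pderivative k w) x + pderivative l \<sigma> x * pderivative k w x"
  using pderivative_eqI[OF J_component_has_derivative] by (simp add: pderivative_eq_grad inner_axis)

lemma continuous_on_grad_\<sigma>: "continuous_on \<Omega> (grad \<sigma>)"
proof -
  obtain k where k: "continuous_on (closure \<Omega>) k" "\<And>x. x \<in> \<Omega> \<Longrightarrow> grad \<sigma> x = k x"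
    using smooth_on_closed_grad[OF open_domain smooth] by metis
  have "continuous_on \<Omega> k" using k(1) closure_subset by (rule continuous_on_subset)
  then show ?thesis using k(2) by (simp cong: continuous_on_cong)
qed

lemma continuous_on_pderivative_J: "continuous_on \<Omega> (pderivative l (\<lambda>y. J y $ k))"
proof -
  have "continuous_on \<Omega> (pderivative l (pderivative k w))"
    using C1_on_continuous_grad[OF w_C1, of k] unfolding pderivative_eq_grad[of l, abs_def]
    by (intro continuous_on_component)
  moreover have "continuous_on \<Omega> (pderivative l \<sigma>)"
    using continuous_on_grad_\<sigma> unfolding pderivative_eq_grad[abs_def] by (intro continuous_on_component)
  moreover have "continuous_on \<Omega> (pderivative k w)" by (rule Ck_on_continuous_on[OF w_C1])
  moreover have "continuous_on \<Omega> \<sigma>" using continuous_on_\<sigma> closure_subset by (rule continuous_on_subset)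
  ultimately have "continuous_on \<Omega> (\<lambda>x. \<sigma> x * pderivative l (pderivative k w) x + pderivative l \<sigma> x * pderivative k w x)"
    by (intro continuous_intros)
  then show ?thesis using pderivative_J by (simp cong: continuous_on_cong)
qed

lemma divg_J: assumes "x \<in> \<Omega>" shows "divg J x = 0"
proof -
  have "pderivative i (\<lambda>y. J y $ i) x = pderivative i (\<lambda>y. (\<sigma> y *\<^sub>R grad w y) $ i) x" for i
    unfolding pderivative_eq_grad
    by (rule arg_cong[OF grad_cong_open[OF open_domain assms]]) (simp add: J_eq)
  then have "divg J x = divg (\<lambda>y. \<sigma> y *\<^sub>R grad w y) x" by (simp add: divg_def)
  then show ?thesis using solution assms by (simp add: neumann_solution_def)
qed

text \<open>The second derivatives of \<open>w\<close> cancel, since gradients are free of rotation;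
  a first-order expression is left.\<close>

lemma curl_J: assumes "x \<in> \<Omega>" shows "curl J x = cross3 (grad \<sigma> x) (grad w x)"
  using pderivative_commute[OF open_domain w_C2 assms]
  by (simp add: curl_def cross3_def pderivative_J[OF assms] grad_def algebra_simps)

lemma continuous_on_J: "continuous_on (closure \<Omega>) J"
  unfolding current_def[abs_def] by (intro continuous_intros continuous_on_\<sigma> continuous_on_closure_grad)

lemma J_normal: "z \<in> frontier \<Omega> \<Longrightarrow> J z \<bullet> ext_normal \<Omega> z = I z"
  using solution \<sigma>_frontier by (simp add: neumann_solution_def current_def)

text \<open>Second derivatives of \<open>w\<close> are not controlled near the boundary, but
  \<open>curl_J\<close> involves first derivatives only, and these extend continuously to the
  compact closure. Hence the volume density is bounded.\<close>

lemma curl_density: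
  "continuous_on \<Omega> (\<lambda>x. B \<bullet> curl J x)" "bounded ((\<lambda>x. B \<bullet> curl J x) ` \<Omega>)"
proof -
  obtain k where k: "continuous_on (closure \<Omega>) k" "\<And>x. x \<in> \<Omega> \<Longrightarrow> grad \<sigma> x = k x"
    using smooth_on_closed_grad[OF open_domain smooth] by metis
  define h where "h x = B \<bullet> cross3 (k x) (closure_grad \<Omega> w x)" for x
  have h: "continuous_on (closure \<Omega>) h"
    unfolding h_def by (intro continuous_on_inner continuous_on_const continuous_on_cross k(1) continuous_on_closure_grad)
  have eq: "B \<bullet> curl J x = h x" if "x \<in> \<Omega>" for x
    using that by (simp add: h_def curl_J k(2) closure_grad_def)
  have "continuous_on \<Omega> h" using h closure_subset by (rule continuous_on_subset)
  then show "continuous_on \<Omega> (\<lambda>x. B \<bullet> curl J x)" using eq by (simp cong: continuous_on_cong)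
  have "bounded (h ` closure \<Omega>)"
    using h bounded_domain by (intro compact_imp_bounded compact_continuous_image) auto
  moreover have "(\<lambda>x. B \<bullet> curl J x) ` \<Omega> \<subseteq> h ` closure \<Omega>" using eq closure_subset[of \<Omega>] by auto
  ultimately show "bounded ((\<lambda>x. B \<bullet> curl J x) ` \<Omega>)" by (rule bounded_subset)
qed

lemma surface_density: "continuous_on (frontier \<Omega>) (\<lambda>z. B \<bullet> cross3 (J z) (ext_normal \<Omega> z))"
  by (intro continuous_on_inner continuous_on_const continuous_on_cross
      continuous_on_subset[OF continuous_on_J frontier_subset_closure]
      continuous_on_ext_normal open_domain smooth_boundary)

end

text \<open>The kernel lowers the odd power of the distance by one, and the cutoff to
  \<open>{0..T}\<close> has no effect because \<open>T\<close> dominates every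
  \<open>dist x y / c\<close>. One factor \<open>c\<close> stems from the delta function, one from
  the kernel, and \<open>c ^ (2 * m + 1)\<close> from inserting
  \<open>t = dist x y / c\<close>.\<close>

lemma kernel_integral:
  fixes f :: "real^3 \<Rightarrow> real"
  assumes M: "sets M = sets borel" "A \<in> sets borel" "emeasure M {y} = 0"
    and T: "\<And>x. x \<in> A \<Longrightarrow> dist x y / c \<le> T" and c: "c > 0"
    and int: "set_integrable M A (\<lambda>x. (dist y x)\<^sup>2 ^ m * f x)"
  defines "\<phi> \<equiv> (\<lambda>t::real. indicator {0..T} t * t ^ (2 * m + 1))"
  shows "(LINT x:A|M. (1 / c * \<phi> (dist x y / c)) / (4 * pi * c * dist x y) * f x) =
     1 / (4 * pi * c * c * c ^ (2 * m + 1)) * (LINT x:A|M. (dist y x)\<^sup>2 ^ m * f x)"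
proof -
  let ?\<kappa> = "1 / (4 * pi * c * c * c ^ (2 * m + 1))"
  define G where "G x = ?\<kappa> * (indicator A x *\<^sub>R ((dist y x)\<^sup>2 ^ m * f x))" for x
  have G: "integrable M G" unfolding G_def using int by (intro integrable_mult_right) (simp add: set_integrable_def)
  \<comment> \<open>At \<open>x = y\<close> the left side is 0, as division by zero gives 0, whereas
    the power is 1 for \<open>m = 0\<close>. The source \<open>y\<close> may lie in
    \<open>A\<close>, so this point is removed as a null set.\<close>
  have pw: "indicator A x *\<^sub>R ((1 / c * \<phi> (dist x y / c)) / (4 * pi * c * dist x y) * f x) = indicator (- {y}) x * G x" for x
  proof (cases "x \<in> A \<and> x \<noteq> y")
    case True
    define r where "r = dist x y"
    have r: "r \<noteq> 0" using True by (simp add: r_def)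
    have "\<phi> (r / c) = (r / c) ^ (2 * m + 1)" using T[of x] True c by (simp add: \<phi>_def r_def)
    also have "\<dots> = r * (r\<^sup>2) ^ m / c ^ (2 * m + 1)" by (simp add: power_divide power_mult)
    finally have "(1 / c * \<phi> (r / c)) / (4 * pi * c * r) = ?\<kappa> * (r\<^sup>2) ^ m"
      using r c by (simp add: field_simps del: power_Suc)
    then show ?thesis using True by (simp add: G_def r_def dist_commute)
  qed (auto simp: G_def indicator_def)
  have sy: "{y} \<in> sets M" "- {y} \<in> sets M" using M(1) by auto
  have "AE x in M. x \<noteq> y" using M(3) sy by (intro AE_I[where N="{y}"]) auto
  then have AE: "AE x in M. indicator (- {y}) x * G x = G x" by eventually_elim simp
  have "(LINT x|M. indicator (- {y}) x * G x) = (LINT x|M. G x)"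
    using G sy AE by (intro integral_cong_AE) (auto intro!: borel_measurable_times borel_measurable_indicator)
  then show ?thesis unfolding set_lebesgue_integral_def pw by (simp add: G_def)
qed

section \<open>From the data to the equality of currents\<close>

context smooth_domain
begin

lemma surface_volume_functional_diff:
  assumes "continuous_on UNIV \<psi>" "continuous_on (frontier \<Omega>) f" "continuous_on (frontier \<Omega>) f'"
    "continuous_on \<Omega> h" "bounded (h ` \<Omega>)" "continuous_on \<Omega> h'" "bounded (h' ` \<Omega>)"
  shows "surface_volume_functional \<Omega> (\<lambda>z. f z - f' z) (\<lambda>x. h x - h' x) \<psi> =
     surface_volume_functional \<Omega> f h \<psi> - surface_volume_functional \<Omega> f' h' \<psi>"
  using surface_density_integrable[OF assms(1,2)] surface_density_integrable[OF assms(1,3)]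
    volume_integrable[OF assms(1,4,5)] volume_integrable[OF assms(1,6,7)]
  by (simp add: surface_volume_functional_def right_diff_distrib set_integral_diff)

lemma measuring_functional_moment:
  fixes J :: "real^3 \<Rightarrow> real^3"
  assumes f: "continuous_on (frontier \<Omega>) (\<lambda>z. B \<bullet> cross3 (J z) (ext_normal \<Omega> z))"
    and h: "continuous_on \<Omega> (\<lambda>x. B \<bullet> curl J x)" "bounded ((\<lambda>x. B \<bullet> curl J x) ` \<Omega>)"
    and T: "\<And>x. x \<in> closure \<Omega> \<Longrightarrow> dist x y / c \<le> T" and c: "c > 0"
  shows "measuring_functional \<Omega> \<rho> c J B y (\<lambda>t. indicator {0..T} t * t ^ (2 * m + 1)) =
    1 / \<rho> * (1 / (4 * pi * c * c * c ^ (2 * m + 1))) * surface_volume_functional \<Omega>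
      (\<lambda>z. B \<bullet> cross3 (J z) (ext_normal \<Omega> z)) (\<lambda>x. B \<bullet> curl J x) (\<lambda>x. (dist y x)\<^sup>2 ^ m)"
proof -
  have \<psi>: "continuous_on UNIV (\<lambda>x. (dist y x)\<^sup>2 ^ m)" by (intro continuous_intros)
  have 1: "(LINT z:frontier \<Omega>|area_measure. (1 / c * (indicator {0..T} (dist z y / c) * (dist z y / c) ^ (2 * m + 1))) /
      (4 * pi * c * dist z y) * (B \<bullet> cross3 (J z) (ext_normal \<Omega> z))) =
    1 / (4 * pi * c * c * c ^ (2 * m + 1)) *
      (LINT z:frontier \<Omega>|area_measure. (dist y z)\<^sup>2 ^ m * (B \<bullet> cross3 (J z) (ext_normal \<Omega> z)))"
    by (rule kernel_integral[OF _ _ _ _ c surface_density_integrable[OF \<psi> f]])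
      (use T frontier_subset_closure in \<open>auto simp: emeasure_area_measure_singleton\<close>)
  have 2: "(LINT x:\<Omega>|lborel. (1 / c * (indicator {0..T} (dist x y / c) * (dist x y / c) ^ (2 * m + 1))) /
      (4 * pi * c * dist x y) * (B \<bullet> curl J x)) =
    1 / (4 * pi * c * c * c ^ (2 * m + 1)) * (LINT x:\<Omega>|lborel. (dist y x)\<^sup>2 ^ m * (B \<bullet> curl J x))"
    by (rule kernel_integral[OF _ _ _ _ c volume_integrable[OF \<psi> h]])
      (use T closure_subset[of \<Omega>] open_domain in auto)
  show ?thesis
    unfolding measuring_functional_def 1 2 surface_volume_functional_def by (simp add: algebra_simps)
qed

lemma dist_le_max_dist:
  assumes "bounded S" "x \<in> closure \<Omega>" "y \<in> S"
  shows "dist x y \<le> max_dist (closure \<Omega>) S"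
proof -
  have "bounded (closure \<Omega> \<times> S)" using bounded_domain assms(1) by (intro bounded_Times) auto
  then obtain C where C: "\<And>p. p \<in> closure \<Omega> \<times> S \<Longrightarrow> norm p \<le> C" unfolding bounded_iff by blast
  have "bdd_above ((\<lambda>(x, y). dist x y) ` (closure \<Omega> \<times> S))"
  proof (rule bdd_aboveI2)
    fix p assume p: "p \<in> closure \<Omega> \<times> S"
    have "norm (fst p) \<le> norm p" "norm (snd p) \<le> norm p"
      using norm_fst_le[of "fst p" "snd p"] norm_snd_le[of "snd p" "fst p"] by simp_all
    then show "(case p of (x, y) \<Rightarrow> dist x y) \<le> 2 * C"
      using C[OF p] norm_triangle_ineq4[of "fst p" "snd p"] by (simp add: case_prod_beta dist_norm)
  qed
  then have "(\<lambda>(x, y). dist x y) (x, y) \<le> max_dist (closure \<Omega>) S"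
    unfolding max_dist_def using assms by (intro cSUP_upper) auto
  then show ?thesis by simp
qed

lemma currents_eq:
  fixes \<sigma> \<sigma>' I w w' :: "real^3 \<Rightarrow> real"
  assumes \<rho>: "\<rho> > 0" and c: "c > 0" and b: "b > 0"
    and R: "open R" "bounded R" "R \<noteq> {}"
    and \<sigma>: "conductivity \<Omega> \<Omega>1 \<sigma>" and w: "neumann_solution \<Omega> \<sigma> I w"
    and \<sigma>': "conductivity \<Omega> \<Omega>1 \<sigma>'" and w': "neumann_solution \<Omega> \<sigma>' I w'"
    and data: "\<And>j y. y \<in> frontier R \<Longrightarrow>
           equal_on_interval (max_dist (closure \<Omega>) (frontier R) / c)
             (measuring_functional \<Omega> \<rho> c (current \<Omega> \<sigma> w) (b *\<^sub>R axis j 1) y)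
             (measuring_functional \<Omega> \<rho> c (current \<Omega> \<sigma>' w') (b *\<^sub>R axis j 1) y)"
    and x: "x \<in> \<Omega>"
  shows "current \<Omega> \<sigma> w x = current \<Omega> \<sigma>' w' x"
proof -
  interpret A: neumann_current \<Omega> \<Omega>1 \<sigma> I w using \<sigma> w by unfold_locales
  interpret B: neumann_current \<Omega> \<Omega>1 \<sigma>' I w' using \<sigma>' w' by unfold_locales
  define n where "n = ext_normal \<Omega>"
  define T where "T = max_dist (closure \<Omega>) (frontier R) / c"
  have zero: "(\<forall>y\<in>\<Omega>. b *\<^sub>R axis j 1 \<bullet> curl A.J y - b *\<^sub>R axis j 1 \<bullet> curl B.J y = 0) \<and>
    (\<forall>z\<in>frontier \<Omega>. b *\<^sub>R axis j 1 \<bullet> cross3 (A.J z) (n z) - b *\<^sub>R axis j 1 \<bullet> cross3 (B.J z) (n z) = 0)" for j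
  proof -
    let ?B = "b *\<^sub>R axis j (1::real)"
    have mom: "surface_volume_functional \<Omega> (\<lambda>z. ?B \<bullet> cross3 (A.J z) (n z) - ?B \<bullet> cross3 (B.J z) (n z))
      (\<lambda>x. ?B \<bullet> curl A.J x - ?B \<bullet> curl B.J x) (\<lambda>x. (dist y x)\<^sup>2 ^ m) = 0" if y: "y \<in> frontier R" for m y
    proof -
      have T: "dist x y / c \<le> T" if "x \<in> closure \<Omega>" for x
        unfolding T_def using c
        by (intro divide_right_mono dist_le_max_dist[OF _ that y] compact_imp_bounded compact_frontier_bounded R(2)) simp
      have "continuous_on {0..T} (\<lambda>t. t ^ (2 * m + 1))" by (intro continuous_intros)
      then have meq: "measuring_functional \<Omega> \<rho> c A.J ?B y (\<lambda>t. indicator {0..T} t * t ^ (2 * m + 1)) =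
          measuring_functional \<Omega> \<rho> c B.J ?B y (\<lambda>t. indicator {0..T} t * t ^ (2 * m + 1))"
        using data[OF y, of j] unfolding equal_on_interval_def T_def by blast
      let ?SV = "\<lambda>J. surface_volume_functional \<Omega> (\<lambda>z. ?B \<bullet> cross3 (J z) (ext_normal \<Omega> z)) (\<lambda>x. ?B \<bullet> curl J x) (\<lambda>x. (dist y x)\<^sup>2 ^ m)"
      define \<kappa> where "\<kappa> = 1 / \<rho> * (1 / (4 * pi * c * c * c ^ (2 * m + 1)))"
      have "\<kappa> * ?SV A.J = measuring_functional \<Omega> \<rho> c A.J ?B y (\<lambda>t. indicator {0..T} t * t ^ (2 * m + 1))"
        unfolding \<kappa>_def by (rule measuring_functional_moment[OF A.surface_density A.curl_density T c, symmetric])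
      also note meq
      also have "measuring_functional \<Omega> \<rho> c B.J ?B y (\<lambda>t. indicator {0..T} t * t ^ (2 * m + 1)) = \<kappa> * ?SV B.J"
        unfolding \<kappa>_def by (rule measuring_functional_moment[OF B.surface_density B.curl_density T c])
      finally have "?SV A.J = ?SV B.J" using \<rho> c unfolding mult_cancel_left by (simp add: \<kappa>_def)
      have "continuous_on UNIV (\<lambda>x. (dist y x)\<^sup>2 ^ m)" by (intro continuous_intros)
      from surface_volume_functional_diff[OF this A.surface_density[of ?B] B.surface_density[of ?B]
          A.curl_density[of ?B] B.curl_density[of ?B]] \<open>?SV A.J = ?SV B.J\<close>
      show ?thesis by (simp only: n_def diff_self)
    qed
    have cf: "continuous_on (frontier \<Omega>) (\<lambda>z. ?B \<bullet> cross3 (A.J z) (n z) - ?B \<bullet> cross3 (B.J z) (n z))"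
      unfolding n_def by (intro continuous_on_diff A.surface_density B.surface_density)
    have ch: "continuous_on \<Omega> (\<lambda>x. ?B \<bullet> curl A.J x - ?B \<bullet> curl B.J x)"
      by (intro continuous_on_diff A.curl_density B.curl_density)
    have bh: "bounded ((\<lambda>x. ?B \<bullet> curl A.J x - ?B \<bullet> curl B.J x) ` \<Omega>)"
      by (intro bounded_minus_comp A.curl_density B.curl_density)
    show ?thesis
      using densities_zero_of_moments[OF cf ch bh R mom] by blast
  qed
  \<comment> \<open>The magnetic inductions along the three axes read off the three
    components.\<close>
  have curl_eq: "curl A.J y = curl B.J y" if "y \<in> \<Omega>" for y
    using zero that b by (simp add: vec_eq_iff inner_axis' flip: right_diff_distrib)
  have cross_eq: "cross3 (A.J z) (n z) = cross3 (B.J z) (n z)" if "z \<in> frontier \<Omega>" for z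
    using zero that b by (simp add: vec_eq_iff inner_axis' flip: right_diff_distrib)
  define D where "D y = A.J y - B.J y" for y
  have pD: "pderivative l (\<lambda>y. D y $ k) y = pderivative l (\<lambda>y. A.J y $ k) y - pderivative l (\<lambda>y. B.J y $ k) y"
    and dD: "(\<lambda>y. D y $ k) differentiable (at y)" if "y \<in> \<Omega>" for y k l
  proof -
    have "((\<lambda>y. D y $ k) has_derivative (\<lambda>v. grad (\<lambda>y. A.J y $ k) y \<bullet> v - grad (\<lambda>y. B.J y $ k) y \<bullet> v)) (at y)"
      unfolding D_def vector_minus_component
      by (intro has_derivative_diff has_derivative_grad A.J_component_differentiable B.J_component_differentiable that)
    note deriv = this
    show "pderivative l (\<lambda>y. D y $ k) y = pderivative l (\<lambda>y. A.J y $ k) y - pderivative l (\<lambda>y. B.J y $ k) y"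
      using pderivative_eqI[OF deriv, of l] by (simp add: pderivative_eq_grad inner_axis)
    show "(\<lambda>y. D y $ k) differentiable (at y)"
      using deriv unfolding differentiable_def by blast
  qed
  have "D x = 0"
  proof (rule curl_div_free_zero[OF open_domain bounded_domain _ dD _ _ _ _ x])
    show "continuous_on (closure \<Omega>) D"
      unfolding D_def by (intro continuous_on_diff A.continuous_on_J B.continuous_on_J)
    show "continuous_on \<Omega> (pderivative l (\<lambda>y. D y $ k))" for k l
    proof -
      have "continuous_on \<Omega> (\<lambda>y. pderivative l (\<lambda>y. A.J y $ k) y - pderivative l (\<lambda>y. B.J y $ k) y)"
        by (intro continuous_on_diff A.continuous_on_pderivative_J B.continuous_on_pderivative_J)
      then show ?thesis using pD by (simp cong: continuous_on_cong)
    qed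
    show "divg D y = 0" if "y \<in> \<Omega>" for y
      using A.divg_J[OF that] B.divg_J[OF that] by (simp add: divg_def pD[OF that] sum_subtractf)
    show "pderivative l (\<lambda>y. D y $ k) y = pderivative k (\<lambda>y. D y $ l) y" if y: "y \<in> \<Omega>" for y k l
    proof -
      \<comment> \<open>Vanishing rotation of \<open>D\<close> is the same as symmetry of its
        Jacobian; the diagonal cases are trivial.\<close>
      have "\<forall>k l. pderivative l (\<lambda>y. D y $ k) y = pderivative k (\<lambda>y. D y $ l) y"
        using curl_eq[OF y] unfolding forall_3 pD[OF y]
        by (auto simp: curl_def vec_eq_iff forall_3)
      then show ?thesis by blast
    qed
    show "D z = 0" if z: "z \<in> frontier \<Omega>" for z
    proof -
      \<comment> \<open>Both conductivities are 1 on the boundary, so both currents have the normal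
        component \<open>I z\<close>; the data take care of the tangential part.\<close>
      have "D z \<bullet> n z = 0" using A.J_normal[OF z] B.J_normal[OF z] by (simp add: D_def n_def inner_diff_left)
      moreover have "cross3 (D z) (n z) = 0"
        using cross_eq[OF z] by (simp add: D_def Cross3.left_diff_distrib)
      ultimately have "D z = 0 \<or> n z = 0" using norm_and_cross_eq_0 by blast
      moreover have "norm (n z) = 1" unfolding n_def by (rule norm_ext_normal[OF open_domain smooth_boundary z])
      ultimately show ?thesis by auto
    qed
  qed
  then show ?thesis by (simp add: D_def)
qed

end

section \<open>From the currents to the conductivity\<close>

lemma cross3_zero_two_independent:
  assumes "cross3 a u = 0" "cross3 a v = 0" "u \<noteq> v" "independent {u, v}"
  shows "a = 0"
proof (rule ccontr)
  assume a: "a \<noteq> 0"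
  have "\<exists>s. y = s *\<^sub>R a" if "cross3 a y = 0" for y
    using that a unfolding cross_eq_0 collinear_lemma by (metis scaleR_zero_left)
  then obtain s t where s: "u = s *\<^sub>R a" and t: "v = t *\<^sub>R a" using assms(1,2) by meson
  have "u \<noteq> 0" using assms(4) dependent_zero[of "{u, v}"] by auto
  then have "s \<noteq> 0" using s by auto
  then have "v = (t / s) *\<^sub>R u" by (simp add: s t)
  then have "v \<in> span {u}" by (metis singletonI span_base span_scale)
  moreover have "independent (insert v {u})" using assms(4) by (simp add: insert_commute)
  ultimately show False using assms(3) by (simp add: independent_insert)
qed

theorem theorem4:
  fixes \<Omega> \<Omega>1 R S :: "(real^3) set"
    and \<sigma> \<sigma>' :: "real^3 \<Rightarrow> real"
    and I w w' :: "3 \<Rightarrow> real^3 \<Rightarrow> real"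
    and \<rho> c b :: real
  assumes "open \<Omega>" "connected \<Omega>" "bounded \<Omega>" "\<Omega> \<noteq> {}" "smooth_boundary \<Omega>"
    and "\<Omega>1 \<subseteq> \<Omega>" "\<exists>d>0. \<forall>x\<in>\<Omega>1. \<forall>z\<in>frontier \<Omega>. d \<le> dist x z"
    and "\<rho> > 0" "c > 0" "b > 0"
    and "source_surface \<Omega> \<Omega>1 R S"
    and "\<And>k. boundary_current \<Omega> (I k)"
    and "conductivity \<Omega> \<Omega>1 \<sigma>" "conductivity \<Omega> \<Omega>1 \<sigma>'"
    and "\<And>k. neumann_solution \<Omega> \<sigma> (I k) (w k)"
    and "\<And>k. neumann_solution \<Omega> \<sigma>' (I k) (w' k)"
    and "\<And>x. x \<in> \<Omega> \<Longrightarrow> two_non_parallel (\<lambda>k. current \<Omega> \<sigma> (w k) x)"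
    and "\<And>x. x \<in> \<Omega> \<Longrightarrow> two_non_parallel (\<lambda>k. current \<Omega> \<sigma>' (w' k) x)"
    and "\<And>j k y. y \<in> S \<Longrightarrow>
           equal_on_interval (max_dist (closure \<Omega>) S / c)
             (measuring_functional \<Omega> \<rho> c (current \<Omega> \<sigma> (w k)) (b *\<^sub>R axis j 1) y)
             (measuring_functional \<Omega> \<rho> c (current \<Omega> \<sigma>' (w' k)) (b *\<^sub>R axis j 1) y)"
  shows "\<forall>x\<in>\<Omega>. ln (\<sigma> x) = ln (\<sigma>' x)"
proof -
  interpret smooth_domain \<Omega> using assms(1,3,5) by unfold_locales
  have R: "open R" "bounded R" "R \<noteq> {}" and S: "S = frontier R"
    using assms(11) by (auto simp: source_surface_def)
  have A: "neumann_current \<Omega> \<Omega>1 \<sigma> (I k) (w k)" for k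
    using assms(13,15) by unfold_locales
  have B: "neumann_current \<Omega> \<Omega>1 \<sigma>' (I k) (w' k)" for k
    using assms(14,16) by unfold_locales
  have J_eq: "current \<Omega> \<sigma> (w k) x = current \<Omega> \<sigma>' (w' k) x" if "x \<in> \<Omega>" for k x
    using currents_eq[OF assms(8-10) R assms(13,15,14,16) assms(19)[unfolded S] that] .
  define v where "v x = ln (\<sigma> x) - ln (\<sigma>' x)" for x
  have dv: "(v has_derivative (\<lambda>_. 0)) (at x)" if x: "x \<in> \<Omega>" for x
  proof -
    have xc: "x \<in> closure \<Omega>" using x closure_subset by blast
    have pos: "\<sigma> x > 0" "\<sigma>' x > 0"
      using neumann_current.\<sigma>_pos[OF A xc] neumann_current.\<sigma>_pos[OF B xc] by auto
    \<comment> \<open>\<open>a\<close> is the gradient of \<open>v\<close>. The rotation of each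
      current is the gradient of the log-conductivity crossed with that current; as the currents
      agree, subtracting leaves \<open>a\<close> crossed with the common current equal to 0.\<close>
    define a where "a = grad \<sigma> x /\<^sub>R \<sigma> x - grad \<sigma>' x /\<^sub>R \<sigma>' x"
    have "cross3 a (current \<Omega> \<sigma> (w k) x) = 0" for k
    proof -
      let ?J = "current \<Omega> \<sigma> (w k) x"
      \<comment> \<open>Equality of the fields is known in \<open>\<Omega>\<close>; it passes to
        derivatives because \<open>\<Omega>\<close> is open.\<close>
      have "curl (current \<Omega> \<sigma> (w k)) x = curl (current \<Omega> \<sigma>' (w' k)) x"
        unfolding curl_def pderivative_eq_grad
        by (subst (1 2 3 4 5 6) grad_cong_open[OF assms(1) x, of _ "\<lambda>y. current \<Omega> \<sigma>' (w' k) y $ i" for i])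
          (auto simp: J_eq)
      then have "cross3 (grad \<sigma> x) (grad (w k) x) = cross3 (grad \<sigma>' x) (grad (w' k) x)"
        using neumann_current.curl_J[OF A x] neumann_current.curl_J[OF B x] by simp
      moreover have "?J = \<sigma> x *\<^sub>R grad (w k) x" by (rule neumann_current.J_eq[OF A x])
      then have "grad (w k) x = ?J /\<^sub>R \<sigma> x" using pos by simp
      moreover have "?J = \<sigma>' x *\<^sub>R grad (w' k) x"
        using neumann_current.J_eq[OF B x] J_eq[OF x] by simp
      then have "grad (w' k) x = ?J /\<^sub>R \<sigma>' x" using pos by simp
      ultimately show ?thesis
        by (simp add: a_def Cross3.left_diff_distrib cross_mult_left cross_mult_right)
    qed
    moreover obtain k l where "current \<Omega> \<sigma> (w k) x \<noteq> current \<Omega> \<sigma> (w l) x"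
      "independent {current \<Omega> \<sigma> (w k) x, current \<Omega> \<sigma> (w l) x}"
      using assms(17)[OF x] by (auto simp: two_non_parallel_def)
    ultimately have "a = 0" using cross3_zero_two_independent by blast
    have "(v has_derivative (\<lambda>h. (grad \<sigma> x \<bullet> h) * inverse (\<sigma> x) - (grad \<sigma>' x \<bullet> h) * inverse (\<sigma>' x))) (at x)"
      unfolding v_def
      using has_derivative_grad[OF neumann_current.\<sigma>_differentiable[OF A x]]
        has_derivative_grad[OF neumann_current.\<sigma>_differentiable[OF B x]] pos
      by (auto intro!: derivative_eq_intros simp: divide_inverse)
    moreover have "(grad \<sigma> x \<bullet> h) * inverse (\<sigma> x) - (grad \<sigma>' x \<bullet> h) * inverse (\<sigma>' x) = a \<bullet> h" for h
      by (simp add: a_def inner_diff_left mult.commute)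
    ultimately show ?thesis using \<open>a = 0\<close> by simp
  qed
  \<comment> \<open>The constant value of \<open>v\<close> is found at a point \<open>q\<close> of
    \<open>\<Omega>\<close> so close to the boundary that both conductivities equal 1 there.\<close>
  obtain U where U: "open U" "frontier \<Omega> \<subseteq> U" "\<And>x. x \<in> U \<inter> closure \<Omega> \<Longrightarrow> \<sigma> x = 1"
    using assms(13) unfolding conductivity_def by blast
  obtain U' where U': "open U'" "frontier \<Omega> \<subseteq> U'" "\<And>x. x \<in> U' \<inter> closure \<Omega> \<Longrightarrow> \<sigma>' x = 1"
    using assms(14) unfolding conductivity_def by blast
  have "frontier \<Omega> \<noteq> {}" using assms(3,4) by (metis frontier_eq_empty not_bounded_UNIV)
  then obtain p where p: "p \<in> frontier \<Omega>" by blast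
  then have "p \<in> closure \<Omega>" "p \<in> U \<inter> U'" using frontier_subset_closure U(2) U'(2) by auto
  then have "\<Omega> \<inter> (U \<inter> U') \<noteq> {}"
    using U(1) U'(1) by (metis closure_iff_nhds_not_empty open_Int order_refl)
  then obtain q where q: "q \<in> \<Omega>" "q \<in> U" "q \<in> U'" by blast
  have "v q = 0" using U(3)[of q] U'(3)[of q] q closure_subset[of \<Omega>] by (auto simp: v_def)
  then have "v x = 0" if "x \<in> \<Omega>" for x
    using has_derivative_zero_unique_connected[OF assms(1,2) dv that q(1)] by simp
  then show ?thesis by (simp add: v_def)
qed

end
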